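(* Let $H$ be a finite, simple, connected undirected graph. There are positive integers $d=d(\varepsilon,H)$ and $\ell=\ell(\varepsilon,H)$ depending only on $\varepsilon$ and $H$, and a constant $\delta=\delta(\varepsilon,H)>0$, such that for every planar graph $G$ that is $\varepsilon$-far from $H$-free, $\mathrm{RLBD}(G,H,d,\ell)$ finds a copy of $H$ with probability at least $\delta$. The query complexity of $\mathrm{RLBD}(G,H,d,\ell)$ is $O(d^{\ell})$, which depends only on $\varepsilon$ and $H$.
   Context: Access to $G=(V,E)$, $V=\{1,\dots,n\}$, is via the random neighbor oracle: a query on vertex $v$ returns a uniformly random neighbor of $v$, independently of all other queries. $\mathrm{Traverse}(G,v,d,\ell)$: set $L_0=\{v\}$; for $j=1,\dots,\ell$, every $u\in L_{j-1}$ makes $d$ random neighbor queries, obtaining a set $\Gamma_u$, and the edges $(u,x)$, $x\in\Gamma_u$, are recorded; $L_j$ is the union of the $\Gamma_u$ minus the vertices of $L_0\cup\dots\cup L_{j-1}$; return the subgraph formed by all recorded edges. $\mathrm{RLBD}(G,H,d,\ell)$: pick $v\in V$ uniformly at random, run $\mathrm{Traverse}(G,v,d,\ell)$, and "find a copy of $H$" (reject) iff the returned subgraph contains a (not necessarily induced) copy of $H$. $G$ is $\varepsilon$-far from $H$-free if more than $\varepsilon|V|$ edges must be deleted from $G$ to obtain a graph with no subgraph isomorphic to $H$. *)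

theory Defs
  imports
    "HOL-Analysis.Analysis"
    "HOL-Probability.Probability"
    "HOL-Probability.Product_PMF"
    "Graph_Theory.Graph_Theory"
begin

text \<open>
  Finite simple undirected graphs are the structures satisfying \<^locale>\<open>pair_graph\<close>
  (loop-free symmetric digraphs without parallel arcs). An undirected edge is thus represented by
  two arcs, so edges are counted as two-element vertex sets.
\<close>

definition uedges :: "'a pair_pre_digraph \<Rightarrow> 'a set set" where
  "uedges G = (\<lambda>(u, v). {u, v}) ` parcs G"

definition planar :: "'a pair_pre_digraph \<Rightarrow> bool" where
  "planar G \<longleftrightarrow>
    (\<exists>(p :: 'a \<Rightarrow> complex) (\<gamma> :: 'a set \<Rightarrow> real \<Rightarrow> complex).
      inj_on p (pverts G) \<and>
      (\<forall>e\<in>uedges G.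
        Path_Connected.arc (\<gamma> e) \<and>
        {pathstart (\<gamma> e), pathfinish (\<gamma> e)} = p ` e \<and>
        path_image (\<gamma> e) \<inter> p ` pverts G = p ` e) \<and>
      (\<forall>e\<in>uedges G. \<forall>f\<in>uedges G. e \<noteq> f \<longrightarrow>
        path_image (\<gamma> e) \<inter> path_image (\<gamma> f) = p ` (e \<inter> f)))"

definition contains_copy :: "'h pair_pre_digraph \<Rightarrow> 'a pair_pre_digraph \<Rightarrow> bool" where
  "contains_copy H G \<longleftrightarrow> (\<exists>S. subgraph S (with_proj G) \<and> digraph_iso S (with_proj H))"

text \<open>
  If \<open>H\<close> is a single vertex then no deletion of edges makes a nonempty graph \<open>H\<close>-free, and every
  nonempty graph counts as far.
\<close>

definition far_from_free :: "real \<Rightarrow> 'h pair_pre_digraph \<Rightarrow> 'a pair_pre_digraph \<Rightarrow> bool" where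
  "far_from_free \<epsilon> H G \<longleftrightarrow>
    (\<forall>G' :: 'a pair_pre_digraph.
      pair_graph G' \<and> spanning (with_proj G') (with_proj G) \<and> \<not> contains_copy H G' \<longrightarrow>
      real (card (uedges G - uedges G')) > \<epsilon> * real (card (pverts G)))"

text \<open>An isolated vertex has no neighbour to return; the oracle then answers \<^term>\<open>None\<close>.\<close>

definition random_neighbor :: "'a pair_pre_digraph \<Rightarrow> 'a \<Rightarrow> 'a option pmf" where
  "random_neighbor G v =
    (if parcs G `` {v} = {} then return_pmf None else map_pmf Some (pmf_of_set (parcs G `` {v})))"

text \<open>
  The state after \<open>j\<close> rounds consists of \<open>L\<^sub>0 \<union> \<dots> \<union> L\<^sub>j\<close>, the layer \<open>L\<^sub>j\<close>, the recorded edges (oriented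
  as they were found) and the number of oracle queries made so far. In a round, \<open>A u\<close> is the list
  of the answers to the queries on \<open>u\<close>.
\<close>

definition traverse_round ::
  "'a pair_pre_digraph \<Rightarrow> nat \<Rightarrow> 'a set \<times> 'a set \<times> ('a \<times> 'a) set \<times> nat
    \<Rightarrow> ('a set \<times> 'a set \<times> ('a \<times> 'a) set \<times> nat) pmf" where
  "traverse_round G d = (\<lambda>(W, L, E, q).
    map_pmf
      (\<lambda>A. let \<Gamma> = (\<lambda>u. {x. Some x \<in> set (A u)}); L' = (\<Union>u\<in>L. \<Gamma> u) - W
        in (W \<union> L', L', E \<union> Sigma L \<Gamma>, q + (\<Sum>u\<in>L. length (A u))))
      (Pi_pmf L [] (\<lambda>u. replicate_pmf d (random_neighbor G u))))"

primrec traverse_state ::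
  "'a pair_pre_digraph \<Rightarrow> 'a \<Rightarrow> nat \<Rightarrow> nat \<Rightarrow> ('a set \<times> 'a set \<times> ('a \<times> 'a) set \<times> nat) pmf" where
  "traverse_state G v d 0 = return_pmf ({v}, {v}, {}, 0)"
| "traverse_state G v d (Suc j) = bind_pmf (traverse_state G v d j) (traverse_round G d)"

text \<open>
  The returned subgraph always contains the start vertex, also if that vertex is isolated. All
  other explored vertices are endpoints of recorded edges.
\<close>

definition traverse ::
  "'a pair_pre_digraph \<Rightarrow> 'a \<Rightarrow> nat \<Rightarrow> nat \<Rightarrow> ('a pair_pre_digraph \<times> nat) pmf" where
  "traverse G v d l =
    map_pmf (\<lambda>(W, L, E, q). (\<lparr>pverts = W, parcs = E \<union> E\<inverse>\<rparr>, q)) (traverse_state G v d l)"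

text \<open>The outcome: whether a copy of \<open>H\<close> was found, and the number of queries made.\<close>

definition RLBD ::
  "'a pair_pre_digraph \<Rightarrow> 'h pair_pre_digraph \<Rightarrow> nat \<Rightarrow> nat \<Rightarrow> (bool \<times> nat) pmf" where
  "RLBD G H d l =
    bind_pmf (pmf_of_set (pverts G)) (\<lambda>v.
      map_pmf (\<lambda>(S, q). (contains_copy H S, q)) (traverse G v d l))"

end

theory Submission
  imports Defs
begin

text \<open>
  A planar graph has no \<open>K\<^sub>6\<close> minor, as three arcs with common endpoints do not leave a point of the plane
  connected to each of them around the other two. By Mader's contraction argument all its minors
  are then sparse.

  Being far from \<open>H\<close>-free, \<open>G\<close> contains linearly many edge-disjoint copies of \<open>H\<close>, and a random colouring
  makes the roles of the vertices in these copies disjoint. The vertices of \<open>H\<close> are then eliminated one by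
  one. Sparsity gives an ordering of \<open>G\<close> in which the first vertex of a copy sees only boundedly many
  candidates for its neighbourhood; keeping the most popular one, the image of the eliminated
  vertex determines the images of its neighbours, which become a new hyperedge. Contracting the
  eliminated vertices keeps the hypergraph inside a minor of \<open>G\<close>. This yields an elimination tree of \<open>H\<close> and a positive
  fraction of the copies such that the image of each vertex of \<open>H\<close> determines the image of its parent. Consequently
  copies may be recombined freely along the tree: any choice of vertices consistent with parents is a copy of \<open>H\<close>.

  After discarding the copies through vertices at which they are rare, a random neighbour follows a copy
  with constant probability. An edge of \<open>H\<close> can only be realised by an edge of \<open>G\<close> whose lower
  end has bounded degree, because the copies are edge-disjoint and the lower end
  determines the upper one. Hence, by induction from the leaves of the tree, exploring from the image of a vertex of \<open>H\<close> finds with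
  constant probability a consistent choice for the whole subtree below it and reaches the image of its parent.
\<close>

section \<open>Theta curves in the plane\<close>

text \<open>The obstacle is that degrees are unbounded: at a hub, a prescribed edge is almost never
  returned. A particular edge may be demanded only from the endpoint that determines the other one;
  in the opposite direction the exploration must accept an edge of any copy through the vertex. The
  branches below a vertex are thus found through different copies, which is why recombination is
  indispensable. Colours keep the recombined map injective.

  Each elimination needs sparsity afresh. The neighbours of an eliminated vertex are constrained
  jointly, so they are remembered as one hyperedge, backed by a connected part of \<open>G\<close>.
  Such hyperedges are linear in number because every minor of \<open>G\<close> is sparse, not only
  \<open>G\<close> itself.

  The constant 64 is \<open>2 ^ 6\<close>, the density at which a clique minor on six vertices is
  forced. Six branch sets suit the theta curve: two contain its ends, three carry its arcs, and the
  last one sees all three arcs.\<close>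

lemma two_arcs_regions:
  fixes c1 c2 :: "real \<Rightarrow> complex"
  assumes "Path_Connected.arc c1" "Path_Connected.arc c2" "pathstart c1 = a" "pathfinish c1 = b" "pathstart c2 = a" "pathfinish c2 = b"
      and "path_image c1 \<inter> path_image c2 = {a,b}"
  shows "inside(path_image c1 \<union> path_image c2) \<noteq> {} \<and>
          open(inside(path_image c1 \<union> path_image c2)) \<and>
          Topological_Spaces.connected (inside(path_image c1 \<union> path_image c2)) \<and>
          outside(path_image c1 \<union> path_image c2) \<noteq> {} \<and>
          open(outside(path_image c1 \<union> path_image c2)) \<and>
          Topological_Spaces.connected (outside(path_image c1 \<union> path_image c2)) \<and>
          bounded(inside(path_image c1 \<union> path_image c2)) \<and>
          frontier(inside(path_image c1 \<union> path_image c2)) = path_image c1 \<union> path_image c2"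
proof -
  let ?g = "c1 +++ reversepath c2"
  have s: "simple_path ?g"
    by (rule simple_path_join_loop) (use assms in \<open>auto simp: arc_reversepath\<close>)
  have i: "path_image ?g = path_image c1 \<union> path_image c2"
    using assms by (simp add: path_image_join)
  show ?thesis
    using Jordan_inside_outside[OF s] assms unfolding i by auto
qed

lemma connected_avoiding_subset_inside:
  assumes "Topological_Spaces.connected K" "K \<inter> S = {}" "K \<inter> inside S \<noteq> {}"
  shows "K \<subseteq> inside S"
  using assms by (smt (verit, best) Diff_disjoint disjoint_iff inside_same_component connected_component_def ComplI subsetI)

text \<open>Take \<open>x\<close> inside the curve formed by \<open>c1\<close> and
  \<open>c2\<close>. Under the hypotheses it lies outside the two other curves, as does some
  \<open>y\<close> far away. These two curves meet exactly in the connected set \<open>c3\<close>,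
  so by Janiszewski's theorem their union does not separate \<open>x\<close> from \<open>y\<close>
  either. But that union contains the first curve, which does separate them.\<close>

lemma theta_some_arc_inside:
  fixes c1 c2 c3 :: "real \<Rightarrow> complex"
  assumes arcs: "Path_Connected.arc c1" "Path_Connected.arc c2" "Path_Connected.arc c3"
      and ends: "pathstart c1 = a" "pathfinish c1 = b" "pathstart c2 = a" "pathfinish c2 = b"
        "pathstart c3 = a" "pathfinish c3 = b"
      and int: "path_image c1 \<inter> path_image c2 = {a,b}" "path_image c1 \<inter> path_image c3 = {a,b}"
        "path_image c2 \<inter> path_image c3 = {a,b}"
      and n3: "path_image c3 \<inter> inside (path_image c1 \<union> path_image c2) = {}"
      and n2: "path_image c2 \<inter> inside (path_image c1 \<union> path_image c3) = {}"
      and n1: "path_image c1 \<inter> inside (path_image c2 \<union> path_image c3) = {}"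
  shows False
proof -
  let ?C1 = "path_image c1" and ?C2 = "path_image c2" and ?C3 = "path_image c3"
  note J12 = two_arcs_regions[OF arcs(1,2) ends(1-4) int(1)]
  note J13 = two_arcs_regions[OF arcs(1,3) ends(1,2,5,6) int(2)]
  note J23 = two_arcs_regions[OF arcs(2,3) ends(3-6) int(3)]
  obtain x where x: "x \<in> inside (?C1 \<union> ?C2)" using J12 by blast
  have cmp: "compact ?C1" "compact ?C2" "compact ?C3"
    using arcs by (auto simp: arc_imp_path compact_path_image)
  have ne: "\<exists>y\<in>path_image c. y \<noteq> a \<and> y \<noteq> b" if "Path_Connected.arc c" for c :: "real \<Rightarrow> complex"
  proof (rule ccontr)
    assume "\<not> ?thesis"
    then have "path_image c \<subseteq> {a,b}" by blast
    then have "finite (path_image c)" using finite_subset by blast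
    moreover have "infinite (path_image c)"
      using that by (metis arc_distinct_ends arc_imp_path connected_finite_iff_sing connected_path_image
          path_image_nonempty pathfinish_in_path_image pathstart_in_path_image singletonD)
    ultimately show False by blast
  qed
  \<comment> \<open>Equal interiors would have equal frontiers, yet each arc has a point besides
    \<open>a\<close> and \<open>b\<close>, and the other two arcs miss it.\<close>
  have diff: "inside (?C1 \<union> ?C2) \<noteq> inside (?C1 \<union> ?C3)"
    using J12 J13 ne[OF arcs(2)] int by (metis (no_types, lifting) IntI Un_iff insertE singletonD)
  have diff': "inside (?C1 \<union> ?C2) \<noteq> inside (?C2 \<union> ?C3)"
    using J12 J23 ne[OF arcs(1)] int by (metis (no_types, lifting) IntI Un_iff insertE singletonD)
  have dj: "inside S \<inter> S = {}" for S :: "complex set" by (simp add: inside_no_overlap)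
  have x13: "x \<in> outside (?C1 \<union> ?C3)"
  proof (rule ccontr)
    assume "x \<notin> outside (?C1 \<union> ?C3)"
    moreover have "x \<notin> ?C1 \<union> ?C3" using x n3 dj[of "?C1 \<union> ?C2"] by blast
    ultimately have xi: "x \<in> inside (?C1 \<union> ?C3)" by (simp add: inside_outside)
    have "inside (?C1 \<union> ?C2) \<subseteq> inside (?C1 \<union> ?C3)"
      by (rule connected_avoiding_subset_inside) (use J12 n3 x xi dj[of "?C1 \<union> ?C2"] in blast)+
    moreover have "inside (?C1 \<union> ?C3) \<subseteq> inside (?C1 \<union> ?C2)"
      by (rule connected_avoiding_subset_inside) (use J13 n2 x xi dj[of "?C1 \<union> ?C3"] in blast)+
    ultimately show False using diff by blast
  qed
  have x23: "x \<in> outside (?C2 \<union> ?C3)"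
  proof (rule ccontr)
    assume "x \<notin> outside (?C2 \<union> ?C3)"
    moreover have "x \<notin> ?C2 \<union> ?C3" using x n3 dj[of "?C1 \<union> ?C2"] by blast
    ultimately have xi: "x \<in> inside (?C2 \<union> ?C3)" by (simp add: inside_outside)
    have "inside (?C1 \<union> ?C2) \<subseteq> inside (?C2 \<union> ?C3)"
      by (rule connected_avoiding_subset_inside) (use J12 n3 x xi dj[of "?C1 \<union> ?C2"] in blast)+
    moreover have "inside (?C2 \<union> ?C3) \<subseteq> inside (?C1 \<union> ?C2)"
      by (rule connected_avoiding_subset_inside) (use J23 n1 x xi dj[of "?C2 \<union> ?C3"] in blast)+
    ultimately show False using diff' by blast
  qed
  have "bounded ((?C1 \<union> ?C2 \<union> ?C3) \<union> (inside (?C1 \<union> ?C2) \<union> (inside (?C1 \<union> ?C3) \<union> inside (?C2 \<union> ?C3))))"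
    using cmp J12 J13 J23 by (simp add: compact_imp_bounded)
  then obtain y where y: "y \<notin> (?C1 \<union> ?C2 \<union> ?C3) \<union> (inside (?C1 \<union> ?C2) \<union> (inside (?C1 \<union> ?C3) \<union> inside (?C2 \<union> ?C3)))"
    by (metis UNIV_eq_I not_bounded_UNIV)
  have y13: "y \<in> outside (?C1 \<union> ?C3)" and y23: "y \<in> outside (?C2 \<union> ?C3)" and y12: "y \<in> outside (?C1 \<union> ?C2)"
    using y by (auto simp: outside_inside)
  have cc: "connected_component (- S) x y" if "x \<in> outside S" "y \<in> outside S" "Topological_Spaces.connected (outside S)" for S :: "complex set"
    using that unfolding connected_component_def
    by (metis outside_no_overlap disjoint_eq_subset_Compl inf_commute)
  have "connected_component (- ((?C1 \<union> ?C3) \<union> (?C2 \<union> ?C3))) x y"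
  proof (rule Janiszewski)
    show "Topological_Spaces.connected ((?C1 \<union> ?C3) \<inter> (?C2 \<union> ?C3))"
    proof -
      have "(?C1 \<union> ?C3) \<inter> (?C2 \<union> ?C3) = ?C3" using int by auto
      then show ?thesis using arcs by (simp add: arc_imp_path connected_path_image)
    qed
    show "compact (?C1 \<union> ?C3)" "closed (?C2 \<union> ?C3)"
      using cmp by (auto simp: compact_Un compact_imp_closed)
    show "connected_component (- (?C1 \<union> ?C3)) x y" "connected_component (- (?C2 \<union> ?C3)) x y"
      using cc x13 y13 x23 y23 J13 J23 by blast+
  qed
  then obtain K where K: "Topological_Spaces.connected K" "K \<subseteq> - ((?C1 \<union> ?C3) \<union> (?C2 \<union> ?C3))" "x \<in> K" "y \<in> K"
    unfolding connected_component_def by blast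
  have "K \<subseteq> inside (?C1 \<union> ?C2)"
    by (rule connected_avoiding_subset_inside) (use K x in auto)
  then show False using K(4) y by blast
qed

text \<open>The arc \<open>c3\<close> splits the interior of the curve of \<open>c1\<close> and
  \<open>c2\<close> into two faces. As \<open>K3\<close> reaches \<open>c3\<close> without touching
  the other arcs, \<open>z\<close> lies in one of these faces. The boundary of that face misses
  \<open>c1\<close> or \<open>c2\<close>, so the connected set from \<open>z\<close> towards the
  missing arc is trapped in the face and cannot arrive.\<close>

lemma theta_inside_case:
  fixes c1 c2 c3 :: "real \<Rightarrow> complex"
  assumes arcs: "Path_Connected.arc c1" "Path_Connected.arc c2" "Path_Connected.arc c3"
      and ends: "pathstart c1 = a" "pathfinish c1 = b" "pathstart c2 = a" "pathfinish c2 = b"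
        "pathstart c3 = a" "pathfinish c3 = b"
      and int: "path_image c1 \<inter> path_image c2 = {a,b}" "path_image c1 \<inter> path_image c3 = {a,b}"
        "path_image c2 \<inter> path_image c3 = {a,b}"
      and n3: "path_image c3 \<inter> inside (path_image c1 \<union> path_image c2) \<noteq> {}"
      and z: "z \<notin> path_image c1 \<union> path_image c2 \<union> path_image c3"
      and K: "Topological_Spaces.connected K1" "Topological_Spaces.connected K2" "Topological_Spaces.connected K3" "z \<in> K1" "z \<in> K2" "z \<in> K3"
      and K1: "K1 \<inter> path_image c1 \<noteq> {}" "K1 \<inter> (path_image c2 \<union> path_image c3) = {}"
      and K2: "K2 \<inter> path_image c2 \<noteq> {}" "K2 \<inter> (path_image c1 \<union> path_image c3) = {}"
      and K3: "K3 \<inter> path_image c3 \<noteq> {}" "K3 \<inter> (path_image c1 \<union> path_image c2) = {}"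
  shows False
proof -
  let ?C1 = "path_image c1" and ?C2 = "path_image c2" and ?C3 = "path_image c3"
  have dj: "inside S \<inter> S = {}" for S :: "complex set" by (simp add: inside_no_overlap)
  have abne: "a \<noteq> b" using arcs(1) ends arc_distinct_ends by fastforce
  have *: "inside(?C1 \<union> ?C3) \<inter> inside(?C2 \<union> ?C3) = {} \<and> 
     inside(?C1 \<union> ?C3) \<union> inside(?C2 \<union> ?C3) \<union> (?C3 - {a,b}) = inside(?C1 \<union> ?C2)"
    by (rule split_inside_simple_closed_curve[of c1 a b c2 c3]) 
       (use arcs ends int n3 abne in \<open>auto simp: arc_imp_simple_path\<close>)
  have c3: "?C3 - {a,b} \<subseteq> inside (?C1 \<union> ?C2)" using * by blast
  have ab: "a \<in> ?C1" "b \<in> ?C1" using int by auto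
  have "K3 \<subseteq> inside (?C1 \<union> ?C2)"
    by (rule connected_avoiding_subset_inside) (use K K3 c3 ab in auto)
  then have "z \<in> inside (?C1 \<union> ?C2)" using K by blast
  then consider "z \<in> inside(?C1 \<union> ?C3)" | "z \<in> inside(?C2 \<union> ?C3)" using * z by blast
  then show False
  proof cases
    case 1
    have "K2 \<subseteq> inside (?C1 \<union> ?C3)"
      by (rule connected_avoiding_subset_inside) (use K K2 1 in auto)
    then have "K2 \<subseteq> inside (?C1 \<union> ?C2)" using * by blast
    then show False using K2 dj[of "?C1 \<union> ?C2"] by blast
  next
    case 2
    have "K1 \<subseteq> inside (?C2 \<union> ?C3)"
      by (rule connected_avoiding_subset_inside) (use K K1 2 in auto)
    then have "K1 \<subseteq> inside (?C1 \<union> ?C2)" using * by blast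
    then show False using K1 dj[of "?C1 \<union> ?C2"] by blast
  qed
qed

lemma no_point_sees_theta:
  fixes c :: "nat \<Rightarrow> real \<Rightarrow> complex"
  assumes arcs: "\<And>j. j < 3 \<Longrightarrow> Path_Connected.arc (c j) \<and> pathstart (c j) = a \<and> pathfinish (c j) = b"
      and int: "\<And>i j. i < 3 \<Longrightarrow> j < 3 \<Longrightarrow> i \<noteq> j \<Longrightarrow> path_image (c i) \<inter> path_image (c j) = {a,b}"
      and K: "\<And>j. j < 3 \<Longrightarrow> Topological_Spaces.connected (K j) \<and> z \<in> K j \<and> K j \<inter> path_image (c j) \<noteq> {}"
      and dis: "\<And>i j. i < 3 \<Longrightarrow> j < 3 \<Longrightarrow> i \<noteq> j \<Longrightarrow> K i \<inter> path_image (c j) = {}"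
  shows False
proof -
  have z: "z \<notin> path_image (c j)" if "j < 3" for j
  proof -
    obtain i :: nat where "i < 3" "i \<noteq> j" using that by (metis zero_less_numeral one_less_numeral_iff semiring_norm(77) zero_neq_one)
    then show ?thesis using K[of i] dis[of i j] that by blast
  qed
  have *: "path_image (c k) \<inter> inside (path_image (c i) \<union> path_image (c j)) = {}" 
    if ijk: "i < 3" "j < 3" "k < 3" "i \<noteq> j" "i \<noteq> k" "j \<noteq> k" for i j k
  proof (rule ccontr)
    assume n: "\<not> ?thesis"
    show False
      by (rule theta_inside_case[of "c i" "c j" "c k" a b z "K i" "K j" "K k"])
         (use arcs[OF ijk(1)] arcs[OF ijk(2)] arcs[OF ijk(3)] int K[OF ijk(1)] K[OF ijk(2)] K[OF ijk(3)] dis z n ijk in \<open>auto simp: Int_Un_distrib\<close>)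
  qed
  show False
    by (rule theta_some_arc_inside[of "c 0" "c 1" "c 2" a b])
       (use arcs[of 0] arcs[of 1] arcs[of 2] int[of 0 1] int[of 0 2] int[of 1 2] *[of 0 1 2] *[of 0 2 1] *[of 1 2 0] in auto)
qed

section \<open>Clique minors in dense graphs\<close>

text \<open>No vertex set is fixed: every singleton is connected, even one that \<open>E\<close>
  does not meet. Families of branch sets may therefore contain isolated foreign points.\<close>

definition conn_in :: "('a \<times> 'a) set \<Rightarrow> 'a set \<Rightarrow> bool" where
  "conn_in E S \<longleftrightarrow> S \<noteq> {} \<and> (\<forall>x\<in>S. \<forall>y\<in>S. (x, y) \<in> (E \<inter> S \<times> S)\<^sup>*)"

definition touching :: "('a \<times> 'a) set \<Rightarrow> 'a set \<Rightarrow> 'a set \<Rightarrow> bool" where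
  "touching E A B \<longleftrightarrow> (\<exists>u\<in>A. \<exists>v\<in>B. (u, v) \<in> E)"

definition branch_sets :: "('a \<times> 'a) set \<Rightarrow> 'a set set \<Rightarrow> bool" where
  "branch_sets E \<B> \<longleftrightarrow> finite \<B> \<and> (\<forall>B\<in>\<B>. conn_in E B) \<and> (\<forall>A\<in>\<B>. \<forall>B\<in>\<B>. A \<noteq> B \<longrightarrow> A \<inter> B = {})"

definition clique_minor :: "nat \<Rightarrow> ('a \<times> 'a) set \<Rightarrow> 'a set \<Rightarrow> bool" where
  "clique_minor t E V \<longleftrightarrow> (\<exists>\<B>. branch_sets E \<B> \<and> card \<B> = t \<and> (\<forall>B\<in>\<B>. B \<subseteq> V) \<and>
     (\<forall>A\<in>\<B>. \<forall>B\<in>\<B>. A \<noteq> B \<longrightarrow> touching E A B))"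

lemma conn_inI:
  assumes "sym E" "x \<in> S" "\<And>y. y \<in> S \<Longrightarrow> (x, y) \<in> (E \<inter> S \<times> S)\<^sup>*"
  shows "conn_in E S"
proof -
  have "sym (E \<inter> S \<times> S)" using assms(1) by (auto simp: sym_def)
  then have s: "sym ((E \<inter> S \<times> S)\<^sup>*)" by (rule sym_rtrancl)
  show ?thesis unfolding conn_in_def
    using assms s by (metis symD rtrancl_trans empty_iff)
qed

lemma conn_in_singleton [simp]: "conn_in E {x}"
  by (auto simp: conn_in_def)

lemma conn_in_mono: "conn_in E S \<Longrightarrow> E \<subseteq> E' \<Longrightarrow> conn_in E' S"
  unfolding conn_in_def by (meson Int_mono rtrancl_mono subset_iff order_refl)

text \<open>A walk in the index graph \<open>J\<close> lifts to the union, since each set is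
  connected and consecutive ones touch. The index type is independent of the vertex type, so indices
  may be vertices of a contracted graph, branch sets, or numbers.\<close>

lemma conn_in_UN:
  assumes "sym E" and J: "conn_in J I" and B: "\<And>i. i \<in> I \<Longrightarrow> conn_in E (B i)"
    and t: "\<And>i j. i \<in> I \<Longrightarrow> j \<in> I \<Longrightarrow> (i, j) \<in> J \<Longrightarrow> touching E (B i) (B j)"
  shows "conn_in E (\<Union>i\<in>I. B i)"
proof -
  let ?U = "\<Union>i\<in>I. B i"
  have mono: "(E \<inter> B i \<times> B i)\<^sup>* \<subseteq> (E \<inter> ?U \<times> ?U)\<^sup>*" if "i \<in> I" for i
    using that by (intro rtrancl_mono) auto
  obtain i0 where i0: "i0 \<in> I" using J by (auto simp: conn_in_def)
  obtain x0 where x0: "x0 \<in> B i0" using B[OF i0] by (auto simp: conn_in_def)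
  have step: "\<forall>y\<in>B i. (x0, y) \<in> (E \<inter> ?U \<times> ?U)\<^sup>*" if "(i0, i) \<in> (J \<inter> I \<times> I)\<^sup>*" for i
    using that
  proof induction
    case base
    show ?case using B[OF i0] x0 mono[OF i0] unfolding conn_in_def by blast
  next
    case (step i j)
    then obtain u v where uv: "u \<in> B i" "v \<in> B j" "(u, v) \<in> E" 
      using t[of i j] unfolding touching_def by blast
    then have "(u, v) \<in> E \<inter> ?U \<times> ?U" using step by blast
    then have v: "(x0, v) \<in> (E \<inter> ?U \<times> ?U)\<^sup>*" using step.IH uv by (meson rtrancl.rtrancl_into_rtrancl)
    have j: "j \<in> I" using step by blast
    show ?case using B[OF j] mono[OF j] uv v unfolding conn_in_def by (meson rtrancl_trans subsetD)
  qed
  show ?thesis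
  proof (rule conn_inI[OF assms(1), of x0])
    show "x0 \<in> ?U" using x0 i0 by blast
    fix y assume "y \<in> ?U"
    then obtain i where "i \<in> I" "y \<in> B i" by blast
    then show "(x0, y) \<in> (E \<inter> ?U \<times> ?U)\<^sup>*" using step J i0 unfolding conn_in_def by blast
  qed
qed

text \<open>This is transitivity of the minor relation: a branch set of the minor is replaced by the
  union of the sets that its elements stand for.\<close>

lemma clique_minor_lift:
  assumes "sym E" and cm: "clique_minor t J I" and B: "\<And>i. i \<in> I \<Longrightarrow> conn_in E (B i) \<and> B i \<subseteq> V"
    and disj: "\<And>i j. i \<in> I \<Longrightarrow> j \<in> I \<Longrightarrow> i \<noteq> j \<Longrightarrow> B i \<inter> B j = {}"
    and t: "\<And>i j. i \<in> I \<Longrightarrow> j \<in> I \<Longrightarrow> (i, j) \<in> J \<Longrightarrow> touching E (B i) (B j)"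
  shows "clique_minor t E V"
proof -
  obtain \<B> where b: "branch_sets J \<B>" "card \<B> = t" "\<And>S. S \<in> \<B> \<Longrightarrow> S \<subseteq> I"
    "\<And>A B. A \<in> \<B> \<Longrightarrow> B \<in> \<B> \<Longrightarrow> A \<noteq> B \<Longrightarrow> touching J A B"
    using cm unfolding clique_minor_def by metis
  let ?f = "\<lambda>S. \<Union>i\<in>S. B i"
  have c: "conn_in E (?f S)" if "S \<in> \<B>" for S
    by (rule conn_in_UN[OF assms(1), of J]) (use that b B t in \<open>auto simp: branch_sets_def subset_iff\<close>)
  have d: "?f S \<inter> ?f T = {}" if "S \<in> \<B>" "T \<in> \<B>" "S \<noteq> T" for S T
  proof -
    have "S \<inter> T = {}" using that b(1) unfolding branch_sets_def by blast
    then show ?thesis using disj b(3)[OF that(1)] b(3)[OF that(2)] by blast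
  qed
  have inj: "inj_on ?f \<B>"
  proof (rule inj_onI)
    fix S T assume "S \<in> \<B>" "T \<in> \<B>" "?f S = ?f T"
    then show "S = T" using d[of S T] c[of S] unfolding conn_in_def by fastforce
  qed
  show ?thesis unfolding clique_minor_def
  proof (intro exI[of _ "?f ` \<B>"] conjI)
    show "branch_sets E (?f ` \<B>)" unfolding branch_sets_def
    proof (intro conjI ballI impI)
      show "finite (?f ` \<B>)" using b(1) by (simp add: branch_sets_def)
      show "conn_in E B" if "B \<in> ?f ` \<B>" for B using that c by blast
      show "X \<inter> Y = {}" if "X \<in> ?f ` \<B>" "Y \<in> ?f ` \<B>" "X \<noteq> Y" for X Y
      proof -
        obtain S T where "S \<in> \<B>" "T \<in> \<B>" "X = ?f S" "Y = ?f T" using \<open>X \<in> _\<close> \<open>Y \<in> _\<close> by auto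
        then show ?thesis using d[of S T] \<open>X \<noteq> Y\<close> by blast
      qed
    qed
    show "card (?f ` \<B>) = t" using inj b(2) by (simp add: card_image)
    show "\<forall>X\<in>?f ` \<B>. X \<subseteq> V" using B b(3) by blast
    show "\<forall>X\<in>?f ` \<B>. \<forall>Y\<in>?f ` \<B>. X \<noteq> Y \<longrightarrow> touching E X Y"
    proof (intro ballI impI)
      fix X Y assume "X \<in> ?f ` \<B>" "Y \<in> ?f ` \<B>" "X \<noteq> Y"
      then obtain S T where ST: "S \<in> \<B>" "T \<in> \<B>" "X = ?f S" "Y = ?f T" "S \<noteq> T" by blast
      then obtain i j where "i \<in> S" "j \<in> T" "(i, j) \<in> J" using b(4) unfolding touching_def by blast
      then have "touching E (B i) (B j)" using t b(3) ST by blast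
      then show "touching E X Y" using \<open>i \<in> S\<close> \<open>j \<in> T\<close> ST unfolding touching_def by blast
    qed
  qed
qed

text \<open>Merging \<open>v\<close> into \<open>u\<close> destroys the two arcs between them, and
  for every common neighbour \<open>w\<close> it identifies the arcs joining \<open>v\<close> and
  \<open>w\<close> with those joining \<open>u\<close> and \<open>w\<close>. Outside the set
  \<open>?R\<close> of these arcs at \<open>v\<close> the contraction is injective on arcs.\<close>

lemma contraction_card:
  fixes E :: "('a \<times> 'a) set"
  assumes fin: "finite E" and sym: "sym E" and uv: "(u, v) \<in> E" "u \<noteq> v"
    and f: "f = (\<lambda>z. if z = v then u else z)"
    and E': "E' = {(f a, f b) | a b. (a, b) \<in> E \<and> f a \<noteq> f b}" and irr: "irrefl E"
  shows "card E \<le> card E' + 2 + 2 * card {w. (u, w) \<in> E \<and> (v, w) \<in> E}"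
proof -
  let ?W = "{w. (u, w) \<in> E \<and> (v, w) \<in> E}"
  let ?R = "{(u,v),(v,u)} \<union> ((\<lambda>w. (v,w)) ` ?W \<union> (\<lambda>w. (w,v)) ` ?W)"
  have finW: "finite ?W" 
    by (rule finite_subset[of _ "E `` {u}"]) (use fin in \<open>auto simp: finite_Image\<close>)
  have "card ?R \<le> 2 + (card ?W + card ?W)"
  proof -
    have "card {(u, v), (v, u)} \<le> 2" using card_length[of "[(u, v), (v, u)]"] by simp
    moreover have "card ((\<lambda>w. (v, w)) ` ?W) \<le> card ?W" "card ((\<lambda>w. (w, v)) ` ?W) \<le> card ?W"
      by (rule card_image_le[OF finW])+
    moreover have "card ?R \<le> card {(u, v), (v, u)} + card ((\<lambda>w. (v, w)) ` ?W \<union> (\<lambda>w. (w, v)) ` ?W)"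
      "card ((\<lambda>w. (v, w)) ` ?W \<union> (\<lambda>w. (w, v)) ` ?W) \<le> card ((\<lambda>w. (v, w)) ` ?W) + card ((\<lambda>w. (w, v)) ` ?W)"
      by (rule card_Un_le)+
    ultimately show ?thesis by linarith
  qed
  moreover have "card (E - ?R) \<le> card E'"
  proof (rule card_inj_on_le[of "map_prod f f"])
    show "inj_on (map_prod f f) (E - ?R)"
    proof (rule inj_onI)
      fix p q assume pq: "p \<in> E - ?R" "q \<in> E - ?R" and eq: "map_prod f f p = map_prod f f q"
      obtain a b c d where abcd: "p = (a, b)" "q = (c, d)" by (metis surj_pair)
      have eqs: "f a = f c" "f b = f d" using eq abcd by auto
      have E: "(a, b) \<in> E" "(c, d) \<in> E" "(b, a) \<in> E" "(d, c) \<in> E" and R: "(a, b) \<notin> ?R" "(c, d) \<notin> ?R"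
        using pq abcd sym by (auto dest: symD)
      have ne: "a \<noteq> b" "c \<noteq> d" using E irr by (auto simp: irrefl_def)
      have ac: "a = c \<or> (a = u \<and> c = v) \<or> (a = v \<and> c = u)"
        and bd: "b = d \<or> (b = u \<and> d = v) \<or> (b = v \<and> d = u)"
        using eqs unfolding f by (metis)+
      show "p = q"
      proof (cases "a = c")
        case True
        have "b = d"
        proof (rule ccontr)
          assume "b \<noteq> d"
          then have "a \<in> ?W" using bd E True by auto
          then show False using bd R True \<open>b \<noteq> d\<close> by auto
        qed
        then show ?thesis using True abcd by simp
      next
        case False
        have "b = d"
        proof (rule ccontr)
          assume "b \<noteq> d"
          then show False using False ac bd R ne by auto
        qed
        then have "b \<in> ?W" using ac E False by auto
        then show ?thesis using ac R False \<open>b = d\<close> by auto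
      qed
    qed
    show "map_prod f f ` (E - ?R) \<subseteq> E'"
    proof
      fix r assume "r \<in> map_prod f f ` (E - ?R)"
      then obtain a b where r: "r = (f a, f b)" "(a, b) \<in> E" "(a, b) \<notin> ?R" by auto
      have "a \<noteq> b" using r irr by (auto simp: irrefl_def)
      then have "f a \<noteq> f b" using r(3) unfolding f by auto
      then show "r \<in> E'" using r unfolding E' by blast
    qed
    have "E' \<subseteq> map_prod f f ` E" unfolding E' by force
    then show "finite E'" using fin finite_surj by blast
  qed
  moreover have "card E \<le> card (E - ?R) + card ?R"
  proof -
    have "card E \<le> card ((E - ?R) \<union> ?R)" by (rule card_mono) (use fin finW in auto)
    then show ?thesis using card_Un_le order_trans by blast
  qed
  ultimately show ?thesis by linarith
qed

text \<open>If some edge has few common neighbours, contracting it keeps the density. Otherwise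
  every neighbourhood is dense enough for the clique minor of the previous order, and its centre
  serves as the additional branch set. Since arcs are counted, every undirected edge counts
  twice.\<close>

theorem mader_clique_minor:
  fixes E :: "('a \<times> 'a) set"
  assumes "finite V" "V \<noteq> {}" "E \<subseteq> V \<times> V" "sym E" "irrefl E" "card E \<ge> 2 ^ t * card V" "t \<ge> 1"
  shows "clique_minor t E V"
  using assms(7,1-6)
proof (induction t arbitrary: V E rule: nat_induct_at_least)
  case base
  then obtain x where "x \<in> V" by blast
  then show ?case unfolding clique_minor_def branch_sets_def
    by (intro exI[of _ "{{x}}"]) auto
next
  case (Suc t)
  note IHt = Suc.IH
  show ?case using Suc.prems
  proof (induction "card V" arbitrary: V E rule: less_induct)
    case less
    have finE: "finite E" using less.prems by (meson finite_SigmaI finite_subset)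
    show ?case
    proof (cases "\<exists>u v. (u, v) \<in> E \<and> card {w. (u, w) \<in> E \<and> (v, w) \<in> E} < 2 ^ t")
      case True
      then obtain u v where uv: "(u, v) \<in> E" and cw: "card {w. (u, w) \<in> E \<and> (v, w) \<in> E} < 2 ^ t" by blast
      have ne: "u \<noteq> v" using uv less.prems by (auto simp: irrefl_def)
      have V: "u \<in> V" "v \<in> V" using uv less.prems by auto
      define f where "f = (\<lambda>z. if z = v then u else z)"
      define E' where "E' = {(f a, f b) | a b. (a, b) \<in> E \<and> f a \<noteq> f b}"
      have "card E \<le> card E' + 2 + 2 * card {w. (u, w) \<in> E \<and> (v, w) \<in> E}"
        by (rule contraction_card[OF finE _ uv ne f_def E'_def]) (use less.prems in auto)
      moreover have cV: "card V = Suc (card (V - {v}))" using V less.prems by (metis card_Suc_Diff1)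
      \<comment> \<open>One vertex less lowers the required number of arcs by
        \<open>2 * 2 ^ t\<close>. The contraction loses at most \<open>2 + 2 * (2 ^ t - 1)\<close>
        arcs, which is the same number.\<close>
      moreover have "2 ^ Suc t * card V = 2 ^ Suc t * card (V - {v}) + 2 * (2::nat) ^ t" by (simp add: cV)
      ultimately have c': "card E' \<ge> 2 ^ Suc t * card (V - {v})" using less.prems(6) cw by linarith
      have cm: "clique_minor (Suc t) E' (V - {v})"
      proof (rule less.hyps)
        show "card (V - {v}) < card V" using cV by simp
        show "V - {v} \<noteq> {}" using V ne by auto
        show "E' \<subseteq> (V - {v}) \<times> (V - {v})"
          using less.prems(3) V ne unfolding E'_def f_def by (auto split: if_splits)
        show "sym E'"
        proof (rule symI)
          fix x y assume "(x, y) \<in> E'"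
          then obtain a b where "x = f a" "y = f b" "(a, b) \<in> E" "f a \<noteq> f b" unfolding E'_def by auto
          then show "(y, x) \<in> E'" using symD[OF less.prems(4)] unfolding E'_def by fastforce
        qed
        show "irrefl E'" unfolding E'_def irrefl_def by auto
      qed (use less.prems c' in auto)
      show ?thesis
      proof (rule clique_minor_lift[OF _ cm, of E "\<lambda>i. if i = u then {u, v} else {i}"])
        show "sym E" by fact
        fix i assume i: "i \<in> V - {v}"
        have "conn_in E {u, v}"
          by (rule conn_inI[OF less.prems(4), of u]) (use uv in auto)
        then show "conn_in E (if i = u then {u, v} else {i}) \<and> (if i = u then {u, v} else {i}) \<subseteq> V"
          using i V by auto
      next
        fix i j assume "(i, j) \<in> E'"
        then show "touching E (if i = u then {u, v} else {i}) (if j = u then {u, v} else {j})"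
          unfolding E'_def f_def touching_def by (auto split: if_splits)
      qed (auto)
    next
      case False
      have "card V > 0" using less.prems by (simp add: card_gt_0_iff)
      then have "0 < 2 ^ Suc t * card V" by simp
      then have "card E > 0" using less.prems(6) by linarith
      then have "E \<noteq> {}" by auto
      then obtain x y where xy: "(x, y) \<in> E" by auto
      \<comment> \<open>Each edge now has at least \<open>2 ^ t\<close> common neighbours, so every
        vertex of the graph induced on the neighbourhood of \<open>x\<close> has at least that
        degree. The outer induction applies there, and \<open>{x}\<close> touches every branch set
        it provides.\<close>
      let ?N = "E `` {x}"
      have finN: "finite ?N" using finE by (metis finite_Image)
      have card_nb: "card {w. (x, w) \<in> E \<and> (z, w) \<in> E} \<ge> 2 ^ t" if "z \<in> ?N" for z
      proof -
        have "(x, z) \<in> E" using that by simp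
        then have "\<not> card {w. (x, w) \<in> E \<and> (z, w) \<in> E} < 2 ^ t" using False by blast
        then show ?thesis by simp
      qed
      let ?E = "E \<inter> ?N \<times> ?N"
      have "?E = (SIGMA z:?N. {w. (x, w) \<in> E \<and> (z, w) \<in> E})" by auto
      then have "card ?E = (\<Sum>z\<in>?N. card {w. (x, w) \<in> E \<and> (z, w) \<in> E})"
        using finN by (simp add: finite_subset[OF _ finN] subset_iff)
      also have "\<dots> \<ge> (\<Sum>z\<in>?N. 2 ^ t)" using card_nb by (rule sum_mono)
      finally have c: "card ?E \<ge> 2 ^ t * card ?N" by (simp add: mult.commute)
      have "clique_minor t ?E ?N"
        by (rule IHt) (use finN xy c less.prems in \<open>auto simp: sym_def irrefl_def\<close>)
      then obtain \<B> where b: "branch_sets ?E \<B>" "card \<B> = t" "\<And>S. S \<in> \<B> \<Longrightarrow> S \<subseteq> ?N"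
        "\<And>A B. A \<in> \<B> \<Longrightarrow> B \<in> \<B> \<Longrightarrow> A \<noteq> B \<Longrightarrow> touching ?E A B"
        unfolding clique_minor_def by metis
      have xN: "x \<notin> ?N" using less.prems by (auto simp: irrefl_def)
      have ne: "S \<noteq> {}" if "S \<in> \<B>" for S using b(1) that by (auto simp: branch_sets_def conn_in_def)
      have tx: "touching E {x} S \<and> touching E S {x}" if S: "S \<in> \<B>" for S
      proof -
        obtain w where "w \<in> S" "(x, w) \<in> E" using ne[OF S] b(3)[OF S] by blast
        then show ?thesis using less.prems(4) by (auto simp: touching_def sym_def)
      qed
      have tt: "touching E A B" if "A \<in> \<B>" "B \<in> \<B>" "A \<noteq> B" for A B
        using b(4)[OF that] unfolding touching_def by blast
      have xB: "{x} \<notin> \<B>" using b(3) xN by blast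
      show ?thesis unfolding clique_minor_def
      proof (intro exI[of _ "insert {x} \<B>"] conjI)
        show "branch_sets E (insert {x} \<B>)"
          unfolding branch_sets_def
        proof (intro conjI ballI impI)
          show "finite (insert {x} \<B>)" using b(1) by (simp add: branch_sets_def)
          show "conn_in E B" if "B \<in> insert {x} \<B>" for B
            using that b(1) conn_in_mono[of ?E B E] unfolding branch_sets_def by auto
          show "A \<inter> B = {}" if "A \<in> insert {x} \<B>" "B \<in> insert {x} \<B>" "A \<noteq> B" for A B
          proof -
            have "A \<inter> B = {}" if "A \<in> \<B>" "B \<in> \<B>" using that b(1) \<open>A \<noteq> B\<close> unfolding branch_sets_def by simp
            moreover have "x \<notin> S" if "S \<in> \<B>" for S using b(3)[OF that] xN by blast
            ultimately show ?thesis using that by auto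
          qed
        qed
        show "card (insert {x} \<B>) = Suc t" using b(1,2) xB by (simp add: branch_sets_def)
        show "\<forall>B\<in>insert {x} \<B>. B \<subseteq> V"
        proof
          fix B assume "B \<in> insert {x} \<B>"
          moreover have "?N \<subseteq> V" "x \<in> V" using less.prems(3) xy by auto
          ultimately show "B \<subseteq> V" using b(3)[of B] by blast
        qed
        show "\<forall>A\<in>insert {x} \<B>. \<forall>B\<in>insert {x} \<B>. A \<noteq> B \<longrightarrow> touching E A B"
          using tx tt by blast
      qed
    qed
  qed
qed

text \<open>A bound on the average degree of every minor, given by its family of branch sets.
  Subfamilies are again families of branch sets, so every minor is also degenerate.\<close>

definition minor_sparse :: "nat \<Rightarrow> ('a \<times> 'a) set \<Rightarrow> bool" where
  "minor_sparse c E \<longleftrightarrow> (\<forall>\<B>. branch_sets E \<B> \<longrightarrow>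
     card {(A, B) \<in> \<B> \<times> \<B>. A \<noteq> B \<and> touching E A B} \<le> c * card \<B>)"

text \<open>A dense family of branch sets, taken as the vertex set of a graph, has a clique minor,
  and this lifts back to \<open>E\<close>.\<close>

lemma minor_sparse_if_no_clique_minor:
  assumes "sym E" "\<not> clique_minor t E UNIV" "t \<ge> 1"
  shows "minor_sparse (2 ^ t) E"
  unfolding minor_sparse_def
proof (intro allI impI)
  fix \<B> assume b: "branch_sets E \<B>"
  let ?J = "{(A, B) \<in> \<B> \<times> \<B>. A \<noteq> B \<and> touching E A B}"
  show "card ?J \<le> 2 ^ t * card \<B>"
  proof (rule ccontr)
    assume n: "\<not> ?thesis"
    have "clique_minor t ?J \<B>"
    proof (rule mader_clique_minor)
      show "\<B> \<noteq> {}" using n by auto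
      show "sym ?J" using assms(1) by (auto simp: sym_def touching_def)
    qed (use n b assms(3) in \<open>auto simp: branch_sets_def irrefl_def\<close>)
    then have "clique_minor t E UNIV"
      by (rule clique_minor_lift[OF assms(1), where B = "\<lambda>B. B"])
         (use b in \<open>auto simp: branch_sets_def\<close>)
    then show False using assms(2) by blast
  qed
qed

section \<open>Plane drawings and clique minors\<close>

definition gpath :: "('a \<times> 'a) set \<Rightarrow> 'a list \<Rightarrow> bool" where
  "gpath E xs \<longleftrightarrow> xs \<noteq> [] \<and> distinct xs \<and> successively (\<lambda>u v. (u, v) \<in> E) xs"

fun path_edges :: "'a list \<Rightarrow> 'a set set" where
  "path_edges (x # y # zs) = insert {x, y} (path_edges (y # zs))"
| "path_edges _ = {}"

lemma path_edges_subset: "e \<in> path_edges xs \<Longrightarrow> e \<subseteq> set xs"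
  by (induction xs rule: path_edges.induct) auto

lemma path_edges_nth: "e \<in> path_edges xs \<Longrightarrow> \<exists>i. Suc i < length xs \<and> e = {xs ! i, xs ! Suc i}"
proof (induction xs rule: path_edges.induct)
  case (1 x y zs)
  show ?case
  proof (cases "e = {x, y}")
    case True
    then show ?thesis by (intro exI[of _ 0]) auto
  next
    case False
    then obtain i where "Suc i < length (y # zs)" "e = {(y # zs) ! i, (y # zs) ! Suc i}"
      using 1 by auto
    then show ?thesis by (intro exI[of _ "Suc i"]) auto
  qed
qed auto

text \<open>Two paths of a theta share only their two end vertices; the lemma excludes that they
  share the edge between these.\<close>

lemma path_edges_ends:
  assumes "distinct xs" "length xs \<ge> 3"
  shows "{hd xs, last xs} \<notin> path_edges xs"
proof
  assume "{hd xs, last xs} \<in> path_edges xs"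
  then obtain i where i: "Suc i < length xs" "{hd xs, last xs} = {xs ! i, xs ! Suc i}"
    using path_edges_nth by blast
  have h: "hd xs = xs ! 0" "last xs = xs ! (length xs - 1)"
    using assms by (metis hd_conv_nth last_conv_nth list.size(3) not_numeral_le_zero)+
  have eq: "xs ! j = xs ! k \<longleftrightarrow> j = k" if "j < length xs" "k < length xs" for j k
    using that assms(1) nth_eq_iff_index_eq by blast
  have l: "0 < length xs" "length xs - 1 < length xs" using assms(2) by auto
  have "xs ! 0 = xs ! i \<and> xs ! (length xs - 1) = xs ! Suc i \<or>
        xs ! 0 = xs ! Suc i \<and> xs ! (length xs - 1) = xs ! i"
    using i(2) unfolding h doubleton_eq_iff .
  then show False
    using eq[OF l(1), of i] eq[OF l(1) i(1)] eq[OF l(2) i(1)] eq[OF l(2), of i] i(1) assms(2) by auto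
qed

lemma path_edges_in_graph:
  "successively (\<lambda>u v. (u, v) \<in> E) xs \<Longrightarrow> e \<in> path_edges xs \<Longrightarrow> e \<in> (\<lambda>(u, v). {u, v}) ` E"
  by (induction xs rule: path_edges.induct) force+

lemma gpath_append:
  "gpath E xs \<Longrightarrow> gpath E ys \<Longrightarrow> (last xs, hd ys) \<in> E \<Longrightarrow> set xs \<inter> set ys = {} \<Longrightarrow> gpath E (xs @ ys)"
  unfolding gpath_def by (auto simp: successively_append_iff)

lemma gpath_rev: "sym E \<Longrightarrow> gpath E (rev xs) \<longleftrightarrow> gpath E xs"
proof -
  assume "sym E"
  then have "(v, u) \<in> E \<longleftrightarrow> (u, v) \<in> E" for u v by (auto dest: symD)
  then show ?thesis unfolding gpath_def by simp
qed

lemma gpath_exists: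
  assumes "(x, y) \<in> (E \<inter> S \<times> S)\<^sup>*" "x \<in> S"
  shows "\<exists>xs. gpath E xs \<and> hd xs = x \<and> last xs = y \<and> set xs \<subseteq> S"
  using assms
proof induction
  case base
  then show ?case by (intro exI[of _ "[x]"]) (auto simp: gpath_def)
next
  case (step y z)
  then obtain xs where xs: "gpath E xs" "hd xs = x" "last xs = y" "set xs \<subseteq> S" by blast
  show ?case
  proof (cases "z \<in> set xs")
    case True
    then obtain as bs where ab: "xs = as @ z # bs" by (meson split_list)
    then have "gpath E (as @ [z])" using xs(1) by (auto simp: gpath_def successively_append_iff)
    moreover have "hd (as @ [z]) = x" using xs(2) ab by (cases as) auto
    ultimately show ?thesis using xs(4) ab by (intro exI[of _ "as @ [z]"]) auto
  next
    case False
    have "gpath E [z]" by (simp add: gpath_def)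
    then have "gpath E (xs @ [z])" using xs step False by (intro gpath_append) auto
    moreover have "hd (xs @ [z]) = x" using xs by (auto simp: gpath_def)
    ultimately show ?thesis using xs(4) step by (intro exI[of _ "xs @ [z]"]) auto
  qed
qed

lemma conn_in_gpath:
  assumes "conn_in E S" "x \<in> S" "y \<in> S"
  obtains xs where "gpath E xs" "hd xs = x" "last xs = y" "set xs \<subseteq> S"
  using assms gpath_exists[of x y E S] unfolding conn_in_def by blast

text \<open>Walk from \<open>u 2\<close> towards \<open>u 0\<close> and stop at the first vertex
  \<open>w\<close> on a fixed path from \<open>u 0\<close> to \<open>u 1\<close>. This vertex splits
  the fixed path into two legs, and the walk up to \<open>w\<close> is the third. A leg may consist
  of \<open>w\<close> alone.\<close>

lemma tripod:
  fixes u :: "nat \<Rightarrow> 'a"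
  assumes "sym E" "conn_in E S" "\<And>j. j < 3 \<Longrightarrow> u j \<in> S"
  shows "\<exists>w P. (\<forall>j<3. gpath E (P j) \<and> hd (P j) = w \<and> last (P j) = u j \<and> set (P j) \<subseteq> S) \<and>
    (\<forall>i<3. \<forall>j<3. i \<noteq> j \<longrightarrow> set (P i) \<inter> set (P j) = {w})"
proof -
  obtain xs where xs: "gpath E xs" "hd xs = u 0" "last xs = u 1" "set xs \<subseteq> S"
    using conn_in_gpath[OF assms(2), of "u 0" "u 1"] assms(3) by (metis one_less_numeral_iff semiring_norm(77) zero_less_numeral)
  obtain ys where ys: "gpath E ys" "hd ys = u 2" "last ys = u 0" "set ys \<subseteq> S"
    using conn_in_gpath[OF assms(2), of "u 2" "u 0"] assms(3) by (metis lessI numeral_3_eq_3 numeral_2_eq_2 zero_less_numeral)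
  have "u 0 \<in> set xs \<and> u 0 \<in> set ys" using xs ys unfolding gpath_def by (metis hd_in_set last_in_set)
  \<comment> \<open>Taking the first hit ensures that the third leg meets the fixed path in
    \<open>w\<close> only.\<close>
  then obtain ys1 w zs where w: "ys = ys1 @ w # zs" "w \<in> set xs" "\<forall>y\<in>set ys1. y \<notin> set xs"
    using split_list_first_prop[of ys "\<lambda>y. y \<in> set xs"] by blast
  obtain as bs where ab: "xs = as @ w # bs" using w(2) by (meson split_list)
  define P where "P = (\<lambda>j::nat. if j = 0 then rev (as @ [w]) else if j = 1 then w # bs else rev (ys1 @ [w]))"
  have g: "gpath E (as @ [w])" "gpath E (w # bs)" "gpath E (ys1 @ [w])"
    using xs(1) ys(1) unfolding ab w(1) by (auto simp: gpath_def successively_append_iff)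
  have dis: "set as \<inter> set bs = {}" "w \<notin> set as" "w \<notin> set bs" "w \<notin> set ys1"
    "set ys1 \<inter> set as = {}" "set ys1 \<inter> set bs = {}"
    using xs(1) ys(1) w(3) unfolding ab w(1) gpath_def by auto
  have h: "last (w # bs) = u 1" "last (rev (as @ [w])) = u 0" "last (rev (ys1 @ [w])) = u 2"
    using xs ys unfolding ab w(1) by (auto simp: last_rev hd_append)
  have j3: "j = 0 \<or> j = 1 \<or> j = 2" if "j < 3" for j :: nat using that by auto
  have main: "gpath E (P j) \<and> hd (P j) = w \<and> last (P j) = u j \<and> set (P j) \<subseteq> S" if "j < 3" for j
    using j3[OF that] g h xs(4) ys(4) gpath_rev[OF assms(1), of "as @ [w]"] gpath_rev[OF assms(1), of "ys1 @ [w]"]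
    unfolding ab w(1) P_def by auto
  have int: "set (P i) \<inter> set (P j) = {w}" if "i < 3" "j < 3" "i \<noteq> j" for i j
    using j3[OF that(1)] j3[OF that(2)] that(3) dis unfolding P_def by auto
  show ?thesis by (intro exI[of _ w] exI[of _ P]) (simp add: main int)
qed

locale plane_embedding =
  fixes E :: "('a \<times> 'a) set" and V :: "'a set" and p :: "'a \<Rightarrow> complex" and \<gamma> :: "'a set \<Rightarrow> real \<Rightarrow> complex"
  assumes symE: "sym E" and irreflE: "irrefl E" and EV: "E \<subseteq> V \<times> V"
    and inj: "inj_on p V"
    and arc: "\<And>u v. (u, v) \<in> E \<Longrightarrow> Path_Connected.arc (\<gamma> {u, v})"
    and ends: "\<And>u v. (u, v) \<in> E \<Longrightarrow> {pathstart (\<gamma> {u, v}), pathfinish (\<gamma> {u, v})} = {p u, p v}"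
    and vert: "\<And>u v. (u, v) \<in> E \<Longrightarrow> path_image (\<gamma> {u, v}) \<inter> p ` V = {p u, p v}"
    and cross: "\<And>e f. e \<in> (\<lambda>(u, v). {u, v}) ` E \<Longrightarrow> f \<in> (\<lambda>(u, v). {u, v}) ` E \<Longrightarrow> e \<noteq> f \<Longrightarrow>
      path_image (\<gamma> e) \<inter> path_image (\<gamma> f) = p ` (e \<inter> f)"
begin

abbreviation "edges \<equiv> (\<lambda>(u, v). {u, v}) ` E"

lemma edge_arc:
  assumes "(u, v) \<in> E"
  shows "\<exists>g. Path_Connected.arc g \<and> pathstart g = p u \<and> pathfinish g = p v \<and> path_image g = path_image (\<gamma> {u, v})"
  using ends[OF assms] arc[OF assms] unfolding doubleton_eq_iff
  by (metis arc_reversepath path_image_reversepath pathfinish_reversepath pathstart_reversepath)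

lemma gpath_arc:
  assumes "gpath E xs" "length xs \<ge> 2"
  shows "\<exists>g. Path_Connected.arc g \<and> pathstart g = p (hd xs) \<and> pathfinish g = p (last xs) \<and>
    path_image g = (\<Union>e\<in>path_edges xs. path_image (\<gamma> e))"
  using assms
proof (induction xs rule: path_edges.induct)
  case (1 x y zs)
  then have xy: "(x, y) \<in> E" by (auto simp: gpath_def)
  obtain h where h: "Path_Connected.arc h" "pathstart h = p x" "pathfinish h = p y" "path_image h = path_image (\<gamma> {x, y})"
    using edge_arc[OF xy] by blast
  show ?case
  proof (cases zs)
    case Nil
    then show ?thesis using h by (intro exI[of _ h]) auto
  next
    case (Cons z ws)
    have gy: "gpath E (y # zs)" using 1(2) by (auto simp: gpath_def)
    then obtain g where g: "Path_Connected.arc g" "pathstart g = p y" "pathfinish g = p (last (y # zs))"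
      "path_image g = (\<Union>e\<in>path_edges (y # zs). path_image (\<gamma> e))"
      using 1(1) Cons by auto
    have int: "path_image (\<gamma> {x, y}) \<inter> path_image (\<gamma> e) \<subseteq> {p y}" if "e \<in> path_edges (y # zs)" for e
    proof -
      have "e \<subseteq> set (y # zs)" using path_edges_subset[OF that] .
      moreover have "x \<notin> set (y # zs)" using 1(2) by (auto simp: gpath_def)
      ultimately have x: "x \<notin> e" by blast
      have "e \<in> edges" using path_edges_in_graph[OF _ that] gy by (auto simp: gpath_def)
      then have "path_image (\<gamma> {x, y}) \<inter> path_image (\<gamma> e) = p ` ({x, y} \<inter> e)"
        using xy x by (intro cross) auto
      then show ?thesis using x by auto
    qed
    have "Path_Connected.arc (h +++ g)"
      by (rule arc_join) (use h g int in auto)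
    moreover have "path_image (h +++ g) = (\<Union>e\<in>path_edges (x # y # zs). path_image (\<gamma> e))"
      using h g by (subst path_image_join) auto
    ultimately show ?thesis using h g Cons by (intro exI[of _ "h +++ g"]) auto
  qed
qed auto

definition drawing :: "'a set \<Rightarrow> complex set" where
  "drawing S = p ` S \<union> (\<Union>e\<in>{e \<in> edges. e \<subseteq> S}. path_image (\<gamma> e))"

lemma connected_drawing:
  assumes "conn_in E S"
  shows "Topological_Spaces.connected (drawing S)"
proof -
  obtain x0 where x0: "x0 \<in> S" using assms by (auto simp: conn_in_def)
  have edge: "connected_component (drawing S) (p u) q"
    if "(u, v) \<in> E" "u \<in> S" "v \<in> S" "q \<in> path_image (\<gamma> {u, v})" for u v q
    unfolding connected_component_def
  proof (intro exI[of _ "path_image (\<gamma> {u, v})"] conjI)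
    show "Topological_Spaces.connected (path_image (\<gamma> {u, v}))" using arc[OF that(1)] by (simp add: arc_imp_path connected_path_image)
    show "path_image (\<gamma> {u, v}) \<subseteq> drawing S" using that unfolding drawing_def by auto
    show "p u \<in> path_image (\<gamma> {u, v})" using vert[OF that(1)] by auto
  qed (use that in auto)
  have vtx: "connected_component (drawing S) (p x0) (p y)" if "(x0, y) \<in> (E \<inter> S \<times> S)\<^sup>*" for y
    using that
  proof induction
    case base
    then show ?case using x0 by (auto simp: drawing_def intro: connected_component_refl)
  next
    case (step y z)
    then have "connected_component (drawing S) (p y) (p z)" using vert[of y z] by (intro edge) auto
    then show ?case using step connected_component_trans by metis
  qed
  have x0c: "connected_component (drawing S) (p x0) q" if "q \<in> drawing S" for q
  proof -
    from that consider y where "y \<in> S" "q = p y" | u v where "(u, v) \<in> E" "u \<in> S" "v \<in> S" "q \<in> path_image (\<gamma> {u, v})"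
      unfolding drawing_def by auto
    then show ?thesis
    proof cases
      case 1
      then show ?thesis using vtx assms x0 unfolding conn_in_def by blast
    next
      case 2
      then have "connected_component (drawing S) (p x0) (p u)" using vtx assms x0 unfolding conn_in_def by blast
      then show ?thesis using edge[OF 2] connected_component_trans by metis
    qed
  qed
  have "connected_component (drawing S) a b" if "a \<in> drawing S" "b \<in> drawing S" for a b
    using connected_component_trans[OF connected_component_sym[OF x0c[OF that(1)]] x0c[OF that(2)]] .
  then show ?thesis
    by (simp add: connected_iff_connected_component)
qed

lemma drawing_disjoint_path:
  assumes "gpath E xs" "S \<subseteq> V" "S \<inter> set xs = {}"
  shows "drawing S \<inter> (\<Union>e\<in>path_edges xs. path_image (\<gamma> e)) = {}"
proof -
  have "p x \<notin> path_image (\<gamma> f)" if "x \<in> S" "f \<in> path_edges xs" for x f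
  proof
    assume a: "p x \<in> path_image (\<gamma> f)"
    have "f \<in> edges" using path_edges_in_graph[OF _ that(2)] assms(1) by (auto simp: gpath_def)
    then obtain u v where uv: "f = {u, v}" "(u, v) \<in> E" by auto
    then have "p x \<in> {p u, p v}" using vert[OF uv(2)] a that assms(2) by auto
    then have "x \<in> f" using uv EV inj that(1) assms(2) by (auto dest: inj_onD)
    then show False using path_edges_subset[OF that(2)] that(1) assms(3) by blast
  qed
  moreover have "path_image (\<gamma> e) \<inter> path_image (\<gamma> f) = {}" if "e \<in> edges" "e \<subseteq> S" "f \<in> path_edges xs" for e f
  proof -
    have "f \<in> edges" using path_edges_in_graph[OF _ that(3)] assms(1) by (auto simp: gpath_def)
    moreover have "e \<inter> f = {}" using path_edges_subset[OF that(3)] that(2) assms(3) by blast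
    moreover have "e \<noteq> {}" using that(1) by auto
    ultimately show ?thesis using cross[OF that(1), of f] by auto
  qed
  ultimately show ?thesis unfolding drawing_def by blast
qed

text \<open>The branch sets \<open>h 3\<close> and \<open>h 4\<close> each contain a tripod whose
  feet touch \<open>h 0\<close>, \<open>h 1\<close> and \<open>h 2\<close>. Joining corresponding
  feet inside these three sets gives a theta curve between the tripod centres. A point of
  \<open>h 5\<close> is then connected to each arc through \<open>h j\<close> while avoiding the two
  others, which the plane forbids.\<close>

lemma no_clique_minor_6: "\<not> clique_minor 6 E V"
proof
  assume "clique_minor 6 E V"
  then obtain \<B> where b: "branch_sets E \<B>" "card \<B> = 6" "\<And>S. S \<in> \<B> \<Longrightarrow> S \<subseteq> V"
    "\<And>A B. A \<in> \<B> \<Longrightarrow> B \<in> \<B> \<Longrightarrow> A \<noteq> B \<Longrightarrow> touching E A B"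
    unfolding clique_minor_def by metis
  have "finite \<B>" using b(1) by (simp add: branch_sets_def)
  then obtain h :: "nat \<Rightarrow> 'a set" where h: "bij_betw h {0..<6} \<B>"
    using ex_bij_betw_nat_finite b(2) by metis
  have hB: "h i \<in> \<B>" if "i < 6" for i using h that by (auto simp: bij_betw_def)
  have hne: "h i \<noteq> h j" if "i < 6" "j < 6" "i \<noteq> j" for i j
    using h that by (auto simp: bij_betw_def inj_on_def)
  have conn: "conn_in E (h i)" if "i < 6" for i using hB[OF that] b(1) by (auto simp: branch_sets_def)
  have disj: "h i \<inter> h j = {}" if "i < 6" "j < 6" "i \<noteq> j" for i j
    using hB[OF that(1)] hB[OF that(2)] hne[OF that] b(1) unfolding branch_sets_def by blast
  have touch: "\<exists>u v. u \<in> h i \<and> v \<in> h j \<and> (u, v) \<in> E" if "i < 6" "j < 6" "i \<noteq> j" for i j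
    using b(4)[OF hB[OF that(1)] hB[OF that(2)] hne[OF that]] unfolding touching_def by blast
  have sel: "\<exists>uv. \<forall>j<3. fst (uv j) \<in> h i \<and> snd (uv j) \<in> h j \<and> uv j \<in> E" if i: "3 \<le> i" "i < 6" for i
  proof -
    have "\<exists>uv. j < 3 \<longrightarrow> fst uv \<in> h i \<and> snd uv \<in> h j \<and> uv \<in> E" for j
    proof (cases "j < 3")
      case True
      then obtain u v where "u \<in> h i" "v \<in> h j" "(u, v) \<in> E" using touch[of i j] i by auto
      then show ?thesis by (intro exI[of _ "(u, v)"]) simp
    qed simp
    then have "\<exists>uv. \<forall>j. j < 3 \<longrightarrow> fst (uv j) \<in> h i \<and> snd (uv j) \<in> h j \<and> uv j \<in> E"
      by (intro choice allI)
    then show ?thesis by simp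
  qed
  obtain uv3 where uv3: "\<forall>j<3. fst (uv3 j) \<in> h 3 \<and> snd (uv3 j) \<in> h j \<and> uv3 j \<in> E"
    using sel[of 3] by auto
  obtain uv4 where uv4: "\<forall>j<3. fst (uv4 j) \<in> h 4 \<and> snd (uv4 j) \<in> h j \<and> uv4 j \<in> E"
    using sel[of 4] by auto
  define u1 v1 u2 v2 where "u1 j = fst (uv3 j)" and "v1 j = snd (uv3 j)" and "u2 j = fst (uv4 j)" and "v2 j = snd (uv4 j)" for j
  have uv1: "u1 j \<in> h 3 \<and> v1 j \<in> h j \<and> (u1 j, v1 j) \<in> E" if "j < 3" for j
    using uv3 that by (simp add: u1_def v1_def)
  have uv2: "u2 j \<in> h 4 \<and> v2 j \<in> h j \<and> (u2 j, v2 j) \<in> E" if "j < 3" for j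
    using uv4 that by (simp add: u2_def v2_def)
  have "\<exists>w P. (\<forall>j<3. gpath E (P j) \<and> hd (P j) = w \<and> last (P j) = u1 j \<and> set (P j) \<subseteq> h 3) \<and>
      (\<forall>i<3. \<forall>j<3. i \<noteq> j \<longrightarrow> set (P i) \<inter> set (P j) = {w})"
    by (rule tripod[OF symE conn]) (use uv1 in auto)
  then obtain w1 P1 where P1': "(\<forall>j<3. gpath E (P1 j) \<and> hd (P1 j) = w1 \<and> last (P1 j) = u1 j \<and> set (P1 j) \<subseteq> h 3) \<and>
      (\<forall>i<3. \<forall>j<3. i \<noteq> j \<longrightarrow> set (P1 i) \<inter> set (P1 j) = {w1})"
    by (elim exE)
  have P1: "\<And>j. j < 3 \<Longrightarrow> gpath E (P1 j) \<and> hd (P1 j) = w1 \<and> last (P1 j) = u1 j \<and> set (P1 j) \<subseteq> h 3"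
    "\<And>i j. i < 3 \<Longrightarrow> j < 3 \<Longrightarrow> i \<noteq> j \<Longrightarrow> set (P1 i) \<inter> set (P1 j) = {w1}"
    using P1' by simp_all
  have "\<exists>w P. (\<forall>j<3. gpath E (P j) \<and> hd (P j) = w \<and> last (P j) = u2 j \<and> set (P j) \<subseteq> h 4) \<and>
      (\<forall>i<3. \<forall>j<3. i \<noteq> j \<longrightarrow> set (P i) \<inter> set (P j) = {w})"
    by (rule tripod[OF symE conn]) (use uv2 in auto)
  then obtain w2 P2 where P2': "(\<forall>j<3. gpath E (P2 j) \<and> hd (P2 j) = w2 \<and> last (P2 j) = u2 j \<and> set (P2 j) \<subseteq> h 4) \<and>
      (\<forall>i<3. \<forall>j<3. i \<noteq> j \<longrightarrow> set (P2 i) \<inter> set (P2 j) = {w2})"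
    by (elim exE)
  have P2: "\<And>j. j < 3 \<Longrightarrow> gpath E (P2 j) \<and> hd (P2 j) = w2 \<and> last (P2 j) = u2 j \<and> set (P2 j) \<subseteq> h 4"
    "\<And>i j. i < 3 \<Longrightarrow> j < 3 \<Longrightarrow> i \<noteq> j \<Longrightarrow> set (P2 i) \<inter> set (P2 j) = {w2}"
    using P2' by simp_all
  have "\<exists>Q. gpath E Q \<and> hd Q = v1 j \<and> last Q = v2 j \<and> set Q \<subseteq> h j" if "j < 3" for j
  proof -
    have "v1 j \<in> h j" "v2 j \<in> h j" "j < 6" using uv1[OF that] uv2[OF that] that by auto
    then obtain Q where "gpath E Q" "hd Q = v1 j" "last Q = v2 j" "set Q \<subseteq> h j"
      using conn_in_gpath[OF conn[of j], of "v1 j" "v2 j"] by auto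
    then show ?thesis by auto
  qed
  then obtain Q where Q: "\<And>j. j < 3 \<Longrightarrow> gpath E (Q j) \<and> hd (Q j) = v1 j \<and> last (Q j) = v2 j \<and> set (Q j) \<subseteq> h j"
    by metis
  define X where "X j = P1 j @ Q j @ rev (P2 j)" for j
  have Xset: "set (X j) = set (P1 j) \<union> set (Q j) \<union> set (P2 j)" for j by (auto simp: X_def)
  have X: "gpath E (X j) \<and> hd (X j) = w1 \<and> last (X j) = w2 \<and> length (X j) \<ge> 3" if j: "j < 3" for j
  proof -
    note p = P1(1)[OF j] P2(1)[OF j] Q[OF j]
    have ne: "P1 j \<noteq> []" "Q j \<noteq> []" "P2 j \<noteq> []" using p by (auto simp: gpath_def)
    have "gpath E (Q j @ rev (P2 j))"
    proof (rule gpath_append)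
      show "gpath E (rev (P2 j))" using p symE by (simp add: gpath_rev)
      show "(last (Q j), hd (rev (P2 j))) \<in> E" using p uv2[OF j] symE by (auto simp: hd_rev dest: symD)
      show "set (Q j) \<inter> set (rev (P2 j)) = {}" using p disj[of j 4] j by auto
    qed (use p in auto)
    then have "gpath E (X j)" unfolding X_def
    proof (rule gpath_append[rotated])
      show "(last (P1 j), hd (Q j @ rev (P2 j))) \<in> E" using p ne uv1[OF j] by auto
      show "set (P1 j) \<inter> set (Q j @ rev (P2 j)) = {}" using p disj[of j 3] disj[of 3 4] j by auto
    qed (use p in auto)
    moreover have "length (X j) \<ge> 3"
      using ne by (cases "P1 j"; cases "Q j"; cases "P2 j") (auto simp: X_def)
    ultimately show ?thesis using p ne by (auto simp: X_def last_rev)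
  qed
  have w: "w1 \<in> h 3" "w2 \<in> h 4" using P1[of 0] P2[of 0] unfolding gpath_def by fastforce+
  have Xint: "set (X i) \<inter> set (X j) = {w1, w2}" if "i < 3" "j < 3" "i \<noteq> j" for i j
  proof -
    have d: "h 3 \<inter> h 4 = {}" "h i \<inter> h j = {}" "h i \<inter> h 3 = {}" "h i \<inter> h 4 = {}" "h j \<inter> h 3 = {}" "h j \<inter> h 4 = {}"
      using disj that by auto
    have sub: "set (P1 i) \<subseteq> h 3" "set (P1 j) \<subseteq> h 3" "set (P2 i) \<subseteq> h 4" "set (P2 j) \<subseteq> h 4" "set (Q i) \<subseteq> h i" "set (Q j) \<subseteq> h j"
      using P1(1)[OF that(1)] P1(1)[OF that(2)] P2(1)[OF that(1)] P2(1)[OF that(2)] Q[OF that(1)] Q[OF that(2)] by simp_all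
    have e1: "set (P1 i) \<inter> set (Q j) = {}" "set (P1 i) \<inter> set (P2 j) = {}" using sub d by blast+
    have e2: "set (P2 i) \<inter> set (Q j) = {}" "set (P2 i) \<inter> set (P1 j) = {}" using sub d by blast+
    have e3: "set (Q i) \<inter> set (Q j) = {}" "set (Q i) \<inter> set (P1 j) = {}" "set (Q i) \<inter> set (P2 j) = {}" using sub d by blast+
    show ?thesis
      unfolding Xset Int_Un_distrib Int_Un_distrib2 e1 e2 e3 P1(2)[OF that] P2(2)[OF that] by auto
  qed
  have "\<forall>j. \<exists>c. j < 3 \<longrightarrow> Path_Connected.arc c \<and> pathstart c = p w1 \<and> pathfinish c = p w2 \<and>
      path_image c = (\<Union>e\<in>path_edges (X j). path_image (\<gamma> e))"
  proof (intro allI)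
    fix j
    show "\<exists>c. j < 3 \<longrightarrow> Path_Connected.arc c \<and> pathstart c = p w1 \<and> pathfinish c = p w2 \<and>
      path_image c = (\<Union>e\<in>path_edges (X j). path_image (\<gamma> e))"
    proof (cases "j < 3")
      case True
      then have "gpath E (X j)" "length (X j) \<ge> 2" "hd (X j) = w1" "last (X j) = w2" using X[OF True] by auto
      then show ?thesis using gpath_arc[of "X j"] by simp
    qed simp
  qed
  from choice[OF this] obtain c where c': "\<forall>j. j < 3 \<longrightarrow> Path_Connected.arc (c j) \<and> pathstart (c j) = p w1 \<and> pathfinish (c j) = p w2 \<and>
      path_image (c j) = (\<Union>e\<in>path_edges (X j). path_image (\<gamma> e))" by (elim exE)
  have c: "Path_Connected.arc (c j) \<and> pathstart (c j) = p w1 \<and> pathfinish (c j) = p w2 \<and>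
      path_image (c j) = (\<Union>e\<in>path_edges (X j). path_image (\<gamma> e))" if "j < 3" for j
    using c' that by simp
  have Xe: "path_edges (X j) \<subseteq> edges" if "j < 3" for j
    using X[OF that] path_edges_in_graph unfolding gpath_def by blast
  have cint: "path_image (c i) \<inter> path_image (c j) = {p w1, p w2}" if ij: "i < 3" "j < 3" "i \<noteq> j" for i j
  proof
    show "{p w1, p w2} \<subseteq> path_image (c i) \<inter> path_image (c j)"
      using c[OF ij(1)] c[OF ij(2)] by (metis IntI insert_subset empty_subsetI pathfinish_in_path_image pathstart_in_path_image)
    have "path_image (\<gamma> e) \<inter> path_image (\<gamma> f) \<subseteq> {p w1, p w2}" if ef: "e \<in> path_edges (X i)" "f \<in> path_edges (X j)" for e f
    proof -
      have s: "e \<inter> f \<subseteq> {w1, w2}" using path_edges_subset[OF ef(1)] path_edges_subset[OF ef(2)] Xint[OF ij] by blast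
      \<comment> \<open>A common edge would join the two centres \<open>w1\<close> and
        \<open>w2\<close>. These are the ends of a path with at least three vertices, so the edge is
        not on it.\<close>
      have "e \<noteq> f"
      proof
        assume "e = f"
        then have "e \<subseteq> {w1, w2}" using s by blast
        moreover obtain u v where "e = {u, v}" "(u, v) \<in> E" using Xe[OF ij(1)] ef(1) by auto
        moreover have "u \<noteq> v" using \<open>(u, v) \<in> E\<close> irreflE by (auto simp: irrefl_def)
        ultimately have "e = {w1, w2}" by auto
        then show False using path_edges_ends[of "X i"] X[OF ij(1)] ef(1) unfolding gpath_def by auto
      qed
      then have "path_image (\<gamma> e) \<inter> path_image (\<gamma> f) = p ` (e \<inter> f)"
        using Xe ij ef by (intro cross) auto
      then show ?thesis using s by auto
    qed
    then show "path_image (c i) \<inter> path_image (c j) \<subseteq> {p w1, p w2}"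
      using c[OF ij(1)] c[OF ij(2)] by blast
  qed
  obtain a where a: "a \<in> h 5" using conn[of 5] by (auto simp: conn_in_def)
  \<comment> \<open>The drawing of \<open>h 5\<close> together with \<open>h j\<close> is connected
    since the two sets touch. It avoids the other arcs because its vertices are not on their
    paths.\<close>
  define K where "K j = drawing (h 5 \<union> h j)" for j
  have Kconn: "Topological_Spaces.connected (K j)" if "j < 3" for j
    unfolding K_def
  proof (rule connected_drawing)
    have "conn_in E (\<Union>i\<in>{5, j}. h i)"
    proof (rule conn_in_UN[OF symE, of "{(5, j), (j, 5)}"])
      show "conn_in {(5, j), (j, 5)} {5, j}"
        by (rule conn_inI[of _ 5]) (auto simp: sym_def)
    qed (use that conn touch b(4) hB hne in \<open>auto simp: touching_def\<close>)
    then show "conn_in E (h 5 \<union> h j)" by simp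
  qed
  show False
  proof (rule no_point_sees_theta[of c "p w1" "p w2" K "p a"])
    fix j :: nat assume j: "j < 3"
    show "Path_Connected.arc (c j) \<and> pathstart (c j) = p w1 \<and> pathfinish (c j) = p w2" using c[OF j] by blast
    \<comment> \<open>The meeting point is the image of \<open>v1 j\<close>, where the path enters
      \<open>h j\<close> from the first tripod.\<close>
    have pj: "p (v1 j) \<in> path_image (c j)"
    proof -
      have ne: "P1 j \<noteq> []" using P1(1)[OF j] by (auto simp: gpath_def)
      have qn: "Q j \<noteq> []" using Q[OF j] by (auto simp: gpath_def)
      have "path_edges (xs @ [x] @ y # zs) \<supseteq> {{x, y}}" for xs zs and x y :: 'a
        by (induction xs rule: path_edges.induct) auto
      from this[of "last (P1 j)" "hd (Q j)" "butlast (P1 j)" "tl (Q j) @ rev (P2 j)"]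
      have "{last (P1 j), hd (Q j)} \<in> path_edges (X j)"
        using ne qn unfolding X_def by (metis append.assoc append_Cons append_butlast_last_id insert_subset list.collapse)
      then have "{u1 j, v1 j} \<in> path_edges (X j)" using P1(1)[OF j] Q[OF j] by simp
      moreover have "p (v1 j) \<in> path_image (\<gamma> {u1 j, v1 j})" using vert[of "u1 j" "v1 j"] uv1[OF j] by auto
      ultimately show ?thesis using c[OF j] by auto
    qed
    show "Topological_Spaces.connected (K j) \<and> p a \<in> K j \<and> K j \<inter> path_image (c j) \<noteq> {}"
      using Kconn[OF j] a pj uv1[OF j] unfolding K_def drawing_def by blast
  next
    fix i j :: nat assume ij: "i < 3" "j < 3" "i \<noteq> j"
    show "path_image (c i) \<inter> path_image (c j) = {p w1, p w2}" using cint[OF ij] .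
    have "(h 5 \<union> h i) \<inter> set (X j) = {}"
    proof -
      have "h 5 \<inter> h j = {}" "h 5 \<inter> h 3 = {}" "h 5 \<inter> h 4 = {}" "h i \<inter> h j = {}" "h i \<inter> h 3 = {}" "h i \<inter> h 4 = {}"
        using disj ij by auto
      moreover have "set (P1 j) \<subseteq> h 3" "set (P2 j) \<subseteq> h 4" "set (Q j) \<subseteq> h j"
        using P1(1)[OF ij(2)] P2(1)[OF ij(2)] Q[OF ij(2)] by simp_all
      ultimately show ?thesis unfolding Xset by blast
    qed
    then show "K i \<inter> path_image (c j) = {}"
      using drawing_disjoint_path[of "X j" "h 5 \<union> h i"] X[OF ij(2)] b(3)[OF hB[of 5]] b(3)[OF hB[of i]] ij c[OF ij(2)]
      unfolding K_def by auto
  qed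
qed

end

text \<open>The bound is \<open>2 ^ 6\<close>. Sparsity concerns arbitrary branch sets, whereas the
  plane argument speaks of vertices of \<open>G\<close>, so the branch sets have to be located
  there.\<close>

lemma planar_minor_sparse:
  assumes "pair_graph G" "planar G"
  shows "minor_sparse 64 (parcs G)"
proof -
  interpret pair_graph G by fact
  have s: "sym (parcs G)" using pair_sym_arcs by (simp add: symmetric_def)
  obtain p :: "'a \<Rightarrow> complex" and \<gamma> where p\<gamma>: "inj_on p (pverts G) \<and> (\<forall>e\<in>uedges G. Path_Connected.arc (\<gamma> e) \<and>
        {pathstart (\<gamma> e), pathfinish (\<gamma> e)} = p ` e \<and>
        path_image (\<gamma> e) \<inter> p ` pverts G = p ` e) \<and>
     (\<forall>e\<in>uedges G. \<forall>f\<in>uedges G. e \<noteq> f \<longrightarrow> path_image (\<gamma> e) \<inter> path_image (\<gamma> f) = p ` (e \<inter> f))"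
    using assms(2) unfolding planar_def by (elim exE)
  then have e: "Path_Connected.arc (\<gamma> e) \<and> {pathstart (\<gamma> e), pathfinish (\<gamma> e)} = p ` e \<and>
        path_image (\<gamma> e) \<inter> p ` pverts G = p ` e" if "e \<in> uedges G" for e using that by simp
  interpret plane_embedding "parcs G" "pverts G" p \<gamma>
  proof unfold_locales
    fix u v assume "(u, v) \<in> parcs G"
    then have "{u, v} \<in> uedges G" by (auto simp: uedges_def)
    from e[OF this] show "Path_Connected.arc (\<gamma> {u, v})"
       "{pathstart (\<gamma> {u, v}), pathfinish (\<gamma> {u, v})} = {p u, p v}"
       "path_image (\<gamma> {u, v}) \<inter> p ` pverts G = {p u, p v}" by auto
  next
    show "irrefl (parcs G)" using pair_no_loops by (intro irreflI) fastforce
    show "parcs G \<subseteq> pverts G \<times> pverts G" using in_arcsD1 in_arcsD2 by auto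
    fix e f assume "e \<in> (\<lambda>(u, v). {u, v}) ` parcs G" "f \<in> (\<lambda>(u, v). {u, v}) ` parcs G" "e \<noteq> f"
    then show "path_image (\<gamma> e) \<inter> path_image (\<gamma> f) = p ` (e \<inter> f)" 
      using p\<gamma> unfolding uedges_def[symmetric] by blast
  qed (use s p\<gamma> in simp_all)
  have "\<not> clique_minor 6 (parcs G) UNIV"
  proof
    assume "clique_minor 6 (parcs G) UNIV"
    then obtain \<B> where b: "branch_sets (parcs G) \<B>" "card \<B> = 6" 
      "\<And>A B. A \<in> \<B> \<Longrightarrow> B \<in> \<B> \<Longrightarrow> A \<noteq> B \<Longrightarrow> touching (parcs G) A B"
      unfolding clique_minor_def by metis
    \<comment> \<open>Each of the six branch sets touches another one, so it contains an end of an
      arc, and connectedness places the rest of it in the graph as well.\<close>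
    have "B \<subseteq> pverts G" if B: "B \<in> \<B>" for B
    proof
      fix x assume x: "x \<in> B"
      have "finite \<B>" using b(1) by (simp add: branch_sets_def)
      then have "\<exists>A. A \<in> \<B> \<and> A \<noteq> B" using b(2) B
      proof -
        have "\<not> \<B> \<subseteq> {B}" using card_mono[of "{B}" \<B>] b(2) by auto
        then show ?thesis by blast
      qed
      then obtain A where "A \<in> \<B>" "A \<noteq> B" by blast
      then obtain y z where yz: "y \<in> B" "(y, z) \<in> parcs G" using b(3)[OF B] unfolding touching_def by blast
      show "x \<in> pverts G"
      proof (cases "x = y")
        case True
        then show ?thesis using yz EV by auto
      next
        case False
        have "(x, y) \<in> (parcs G \<inter> B \<times> B)\<^sup>*" using b(1) B x yz unfolding branch_sets_def conn_in_def by blast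
        then show ?thesis using False EV by (meson IntD1 SigmaD1 converse_rtranclE subsetD)
      qed
    qed
    then have "clique_minor 6 (parcs G) (pverts G)" using b unfolding clique_minor_def by blast
    then show False using no_clique_minor_6 by blast
  qed
  from minor_sparse_if_no_clique_minor[OF s this] show ?thesis by simp
qed

section \<open>Sparse hypergraphs in minor-closed classes\<close>

lemma average_le:
  fixes f :: "'a \<Rightarrow> nat"
  assumes "finite X" "X \<noteq> {}" "(\<Sum>x\<in>X. f x) \<le> c * card X"
  shows "\<exists>x\<in>X. f x \<le> c"
proof (rule ccontr)
  assume "\<not> ?thesis"
  then have "\<And>x. x \<in> X \<Longrightarrow> c < f x" by (simp add: not_le)
  then have "(\<Sum>x\<in>X. c) < (\<Sum>x\<in>X. f x)" using assms by (intro sum_strict_mono) auto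
  then show False using assms(3) by (simp add: mult.commute)
qed

text \<open>Remove a vertex \<open>x\<close> of degree at most \<open>c\<close>. A clique through
  \<open>x\<close> is determined by a subset of its neighbourhood, which gives at most
  \<open>2 ^ c\<close> cliques per removed vertex.\<close>

lemma card_cliques_le:
  fixes P :: "('a \<times> 'a) set"
  assumes "finite X" "\<And>Y. Y \<subseteq> X \<Longrightarrow> card (P \<inter> Y \<times> Y) \<le> c * card Y"
  shows "card {T. T \<subseteq> X \<and> T \<noteq> {} \<and> (\<forall>a\<in>T. \<forall>b\<in>T. a \<noteq> b \<longrightarrow> (a, b) \<in> P)} \<le> 2 ^ c * card X"
  using assms
proof (induction "card X" arbitrary: X)
  case 0
  then show ?case by auto
next
  case (Suc n)
  let ?cl = "\<lambda>X. {T. T \<subseteq> X \<and> T \<noteq> {} \<and> (\<forall>a\<in>T. \<forall>b\<in>T. a \<noteq> b \<longrightarrow> (a, b) \<in> P)}"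
  have ne: "X \<noteq> {}" using Suc by auto
  have "P \<inter> X \<times> X = (SIGMA x:X. {y \<in> X. (x, y) \<in> P})" by auto
  then have "(\<Sum>x\<in>X. card {y \<in> X. (x, y) \<in> P}) \<le> c * card X"
    using Suc.prems(1) Suc.prems(2)[of X] by simp
  then obtain x where x: "x \<in> X" "card {y \<in> X. (x, y) \<in> P} \<le> c"
    using average_le Suc.prems(1) ne by blast
  let ?N = "{y \<in> X. (x, y) \<in> P}"
  have finN: "finite ?N" using Suc.prems by simp
  have "?cl X \<subseteq> ?cl (X - {x}) \<union> insert x ` Pow ?N"
  proof
    fix T assume T: "T \<in> ?cl X"
    show "T \<in> ?cl (X - {x}) \<union> insert x ` Pow ?N"
    proof (cases "x \<in> T")
      case True
      then have "T = insert x (T - {x})" "T - {x} \<in> Pow ?N" using T by auto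
      then show ?thesis by blast
    next
      case False
      then show ?thesis using T by auto
    qed
  qed
  then have "card (?cl X) \<le> card (?cl (X - {x}) \<union> insert x ` Pow ?N)"
    using Suc.prems(1) finN by (intro card_mono) auto
  also have "\<dots> \<le> card (?cl (X - {x})) + card (insert x ` Pow ?N)" by (rule card_Un_le)
  also have "\<dots> \<le> 2 ^ c * card (X - {x}) + 2 ^ c"
  proof (rule add_mono)
    show "card (?cl (X - {x})) \<le> 2 ^ c * card (X - {x})"
    proof (rule Suc.hyps(1))
      show "n = card (X - {x})" using Suc.hyps(2) x Suc.prems(1) by simp
      show "finite (X - {x})" using Suc.prems(1) by simp
      fix Y assume "Y \<subseteq> X - {x}"
      then show "card (P \<inter> Y \<times> Y) \<le> c * card Y" using Suc.prems(2) by blast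
    qed
    have "card (insert x ` Pow ?N) \<le> card (Pow ?N)" using finN by (intro card_image_le) simp
    also have "\<dots> \<le> 2 ^ c" using x(2) finN by (simp add: card_Pow)
    finally show "card (insert x ` Pow ?N) \<le> 2 ^ c" .
  qed
  also have "\<dots> = 2 ^ c * card X" using x Suc.prems(1) by (metis card_Suc_Diff1 mult_Suc_right add.commute)
  finally show ?case .
qed

lemma minor_sparse_edges:
  assumes "minor_sparse c E" "finite X" "irrefl E"
  shows "card (E \<inter> X \<times> X) \<le> c * card X"
proof -
  let ?B = "(\<lambda>x. {x}) ` X"
  let ?J = "{(A, B) \<in> ?B \<times> ?B. A \<noteq> B \<and> touching E A B}"
  have "branch_sets E ?B" using assms(2) by (auto simp: branch_sets_def)
  then have "card ?J \<le> c * card ?B" using assms(1) unfolding minor_sparse_def by blast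
  moreover have "card ?B = card X" by (simp add: card_image)
  moreover have "card (E \<inter> X \<times> X) \<le> card ?J"
  proof (rule card_inj_on_le[of "\<lambda>(x, y). ({x}, {y})"])
    show "inj_on (\<lambda>(x, y). ({x}, {y})) (E \<inter> X \<times> X)" by (auto simp: inj_on_def)
    show "(\<lambda>(x, y). ({x}, {y})) ` (E \<inter> X \<times> X) \<subseteq> ?J"
      using assms(3) by (auto simp: touching_def irrefl_def)
    show "finite ?J" by (rule finite_subset[of _ "?B \<times> ?B"]) (use assms(2) in auto)
  qed
  ultimately show ?thesis by simp
qed

section \<open>Counting hyperedges by contraction\<close>

lemma conn_in_star:
  assumes "sym E" "\<And>i. i \<in> I \<Longrightarrow> conn_in E (B i)" "\<And>i. i \<in> I \<Longrightarrow> touching E {x} (B i)"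
  shows "conn_in E (insert x (\<Union>i\<in>I. B i))"
proof (rule conn_inI[OF assms(1), of x])
  let ?U = "insert x (\<Union>i\<in>I. B i)"
  fix y assume "y \<in> ?U"
  then consider "y = x" | i where "i \<in> I" "y \<in> B i" by blast
  then show "(x, y) \<in> (E \<inter> ?U \<times> ?U)\<^sup>*"
  proof cases
    case (2 i)
    then obtain v where v: "v \<in> B i" "(x, v) \<in> E" using assms(3) by (auto simp: touching_def)
    then have "(x, v) \<in> E \<inter> ?U \<times> ?U" using 2 by blast
    moreover have "(v, y) \<in> (E \<inter> B i \<times> B i)\<^sup>*" using assms(2)[OF 2(1)] v 2 by (auto simp: conn_in_def)
    moreover have "(E \<inter> B i \<times> B i)\<^sup>* \<subseteq> (E \<inter> ?U \<times> ?U)\<^sup>*" using 2 by (intro rtrancl_mono) auto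
    ultimately show ?thesis by (meson converse_rtrancl_into_rtrancl subsetD)
  qed simp
qed simp

text \<open>Contracting each \<open>Z T\<close> into the first component of its own pair \<open>f T\<close> turns the chosen pairs
  into edges of a minor.\<close>

lemma card_pair_representatives_le:
  fixes E :: "('a \<times> 'a) set"
  assumes "minor_sparse c E" "sym E" "finite X"
    and Z: "\<And>T. T \<in> \<S> \<Longrightarrow> conn_in E (Z T) \<and> Z T \<inter> X = {} \<and> (\<forall>t\<in>T. touching E {t} (Z T))"
    and disj: "\<And>S T. S \<in> \<S> \<Longrightarrow> T \<in> \<S> \<Longrightarrow> S \<noteq> T \<Longrightarrow> Z S \<inter> Z T = {}"
    and f: "inj_on f \<S>" "\<And>T. T \<in> \<S> \<Longrightarrow> f T \<in> T \<times> T \<and> f T \<in> X \<times> X \<and> fst (f T) \<noteq> snd (f T)"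
  shows "card \<S> \<le> c * card X"
proof -
  define B where "B x = insert x (\<Union>T\<in>{T \<in> \<S>. fst (f T) = x}. Z T)" for x
  have conn: "conn_in E (B x)" for x
    unfolding B_def
  proof (rule conn_in_star[OF assms(2)])
    fix T assume T: "T \<in> {T \<in> \<S>. fst (f T) = x}"
    then show "conn_in E (Z T)" using Z by simp
    have "x \<in> T" using f(2)[of T] T by auto
    then show "touching E {x} (Z T)" using Z T by simp
  qed
  have Bdisj: "B x \<inter> B y = {}" if xy: "x \<in> X" "y \<in> X" "x \<noteq> y" for x y
  proof (rule ccontr)
    assume "B x \<inter> B y \<noteq> {}"
    then obtain z where z: "z \<in> B x" "z \<in> B y" by blast
    have zX: "z \<notin> X" if "T \<in> \<S>" "z \<in> Z T" for T using Z[OF that(1)] that(2) by blast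
    from z(1) consider "z = x" | S where "S \<in> \<S>" "fst (f S) = x" "z \<in> Z S" unfolding B_def by blast
    then show False
    proof cases
      case 1
      then show False using z(2) zX xy unfolding B_def by blast
    next
      case (2 S)
      from z(2) consider "z = y" | T where "T \<in> \<S>" "fst (f T) = y" "z \<in> Z T" unfolding B_def by blast
      then show False
      proof cases
        case 1
        then show False using zX 2 xy by blast
      next
        case (2 T)
        then have "S \<noteq> T" using \<open>fst (f S) = x\<close> xy by blast
        then show False using disj[of S T] \<open>S \<in> \<S>\<close> 2 \<open>z \<in> Z S\<close> by blast
      qed
    qed
  qed
  have xB: "x \<in> B x" for x by (simp add: B_def)
  have injB: "inj_on B X"
  proof (rule inj_onI)
    fix x y assume "x \<in> X" "y \<in> X" "B x = B y"
    then show "x = y" using Bdisj[of x y] xB[of x] by auto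
  qed
  let ?J = "{(A, C) \<in> B ` X \<times> B ` X. A \<noteq> C \<and> touching E A C}"
  have "branch_sets E (B ` X)"
    unfolding branch_sets_def
  proof (intro conjI ballI impI)
    show "finite (B ` X)" using assms(3) by simp
    show "conn_in E A" if "A \<in> B ` X" for A using that conn by auto
    show "A \<inter> C = {}" if "A \<in> B ` X" "C \<in> B ` X" "A \<noteq> C" for A C
      using that Bdisj by auto
  qed
  then have "card ?J \<le> c * card (B ` X)" using assms(1) unfolding minor_sparse_def by blast
  then have J: "card ?J \<le> c * card X" using injB by (simp add: card_image)
  let ?g = "\<lambda>T. (B (fst (f T)), B (snd (f T)))"
  have "inj_on ?g \<S>"
  proof (rule inj_onI)
    fix S T assume ST: "S \<in> \<S>" "T \<in> \<S>" "?g S = ?g T"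
    then have "f S = f T" using f(2)[of S] f(2)[of T] injB by (auto simp: inj_on_def prod_eq_iff mem_Times_iff)
    then show "S = T" using f(1) ST by (auto simp: inj_on_def)
  qed
  moreover have "?g ` \<S> \<subseteq> ?J"
  proof
    fix q assume "q \<in> ?g ` \<S>"
    then obtain T where T: "T \<in> \<S>" "q = ?g T" by blast
    obtain a b where ab: "f T = (a, b)" by (cases "f T")
    have abX: "a \<in> X" "b \<in> X" "a \<in> T" "b \<in> T" "a \<noteq> b" using f(2)[OF T(1)] ab by auto
    have "touching E {b} (Z T)" using Z[OF T(1)] abX by simp
    then obtain z where z: "z \<in> Z T" "(b, z) \<in> E" by (auto simp: touching_def)
    have "z \<in> B a" using T ab z unfolding B_def by auto
    then have "touching E (B a) (B b)" using z(2) xB[of b] assms(2) unfolding touching_def by (meson symD)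
    moreover have "B a \<noteq> B b" using injB abX by (auto simp: inj_on_def)
    ultimately show "q \<in> ?J" using T ab abX by auto
  qed
  moreover have "finite ?J" by (rule finite_subset[of _ "B ` X \<times> B ` X"]) (use assms(3) in auto)
  ultimately have "card \<S> \<le> card ?J" by (rule card_inj_on_le)
  then show ?thesis using J by linarith
qed

text \<open>The set \<open>Z T\<close> plays an additional vertex outside \<open>X\<close> adjacent
  to all of \<open>T\<close>. The incidence graph of the hypergraph is thus a minor of
  \<open>E\<close>.\<close>

definition hyper :: "('a \<times> 'a) set \<Rightarrow> nat \<Rightarrow> 'a set \<Rightarrow> 'a set set \<Rightarrow> ('a set \<Rightarrow> 'a set) \<Rightarrow> bool" where
  "hyper E h X \<T> Z \<longleftrightarrow> finite X \<and> finite \<T> \<and>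
     (\<forall>T\<in>\<T>. T \<subseteq> X \<and> T \<noteq> {} \<and> card T \<le> h \<and> conn_in E (Z T) \<and> Z T \<inter> X = {} \<and> (\<forall>t\<in>T. touching E {t} (Z T))) \<and>
     (\<forall>S\<in>\<T>. \<forall>T\<in>\<T>. S \<noteq> T \<longrightarrow> Z S \<inter> Z T = {})"

text \<open>The term \<open>c\<close> bounds the average number of graph neighbours. The second term
  bounds the average number of hyperedges at a vertex: there are at most \<open>c + 2 ^ c\<close>
  hyperedges per vertex, each with at most \<open>h\<close> elements.\<close>

definition degen_const :: "nat \<Rightarrow> nat \<Rightarrow> nat" where
  "degen_const c h = c + h * (c + 2 ^ c)"

text \<open>Take a largest subfamily whose members can be assigned distinct pairs of their own
  elements. Contraction turns these pairs into edges of a minor, so the subfamily has at most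
  \<open>c * card X\<close> members. By maximality each remaining hyperedge is a clique in the graph
  of chosen pairs. That graph is itself sparse on every subset of \<open>X\<close>, which leaves at
  most \<open>2 ^ c * card X\<close> cliques.\<close>

lemma hyper_card_le:
  assumes ms: "minor_sparse c E" and "sym E" and hy: "hyper E h X \<T> Z"
  shows "card \<T> \<le> (c + 2 ^ c) * card X"
proof -
  have fin: "finite X" "finite \<T>" using hy by (auto simp: hyper_def)
  define good where "good \<S> f \<longleftrightarrow> \<S> \<subseteq> \<T> \<and> inj_on f \<S> \<and> (\<forall>T\<in>\<S>. f T \<in> T \<times> T \<and> fst (f T) \<noteq> snd (f T))"
    for \<S> and f :: "'a set \<Rightarrow> 'a \<times> 'a"
  have rep: "card \<S> \<le> c * card Y" if "good \<S> f" "Y \<subseteq> X" "\<And>T. T \<in> \<S> \<Longrightarrow> f T \<in> Y \<times> Y" for \<S> f Y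
  proof (rule card_pair_representatives_le[OF ms assms(2), where Z = Z and f = f])
    show "finite Y" using that fin finite_subset by blast
    fix T assume T: "T \<in> \<S>"
    then have "T \<in> \<T>" using that(1) by (auto simp: good_def)
    then have "conn_in E (Z T)" "Z T \<inter> X = {}" "\<forall>t\<in>T. touching E {t} (Z T)" using hy by (auto simp: hyper_def)
    then show "conn_in E (Z T) \<and> Z T \<inter> Y = {} \<and> (\<forall>t\<in>T. touching E {t} (Z T))" using that(2) by blast
    show "f T \<in> T \<times> T \<and> f T \<in> Y \<times> Y \<and> fst (f T) \<noteq> snd (f T)" using that(1) that(3)[OF T] T by (auto simp: good_def)
  next
    fix S T assume "S \<in> \<S>" "T \<in> \<S>" "S \<noteq> T"
    moreover have "\<S> \<subseteq> \<T>" using that(1) by (auto simp: good_def)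
    ultimately show "Z S \<inter> Z T = {}" using hy unfolding hyper_def by blast
  next
    show "inj_on f \<S>" using that(1) by (auto simp: good_def)
  qed
  have "\<exists>f. good {} f" by (simp add: good_def)
  moreover have "\<forall>\<S>. (\<exists>f. good \<S> f) \<longrightarrow> card \<S> < Suc (card \<T>)"
  proof (intro allI impI)
    fix \<S> assume "\<exists>f. good \<S> f"
    then have "\<S> \<subseteq> \<T>" by (auto simp: good_def)
    then show "card \<S> < Suc (card \<T>)" using fin(2) by (simp add: card_mono less_Suc_eq_le)
  qed
  ultimately have "\<exists>\<S>. (\<exists>f. good \<S> f) \<and> (\<forall>\<S>'. (\<exists>f. good \<S>' f) \<longrightarrow> card \<S>' \<le> card \<S>)"
    by (intro ex_has_greatest_nat[of "\<lambda>\<S>. \<exists>f. good \<S> f" "{}" card "Suc (card \<T>)"]) auto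
  then obtain \<S> f where \<S>: "good \<S> f" and max: "\<And>\<S>' f'. good \<S>' f' \<Longrightarrow> card \<S>' \<le> card \<S>" by blast
  have sub: "\<S> \<subseteq> \<T>" and finS: "finite \<S>" using \<S> fin(2) finite_subset by (auto simp: good_def)
  have fX: "f T \<in> X \<times> X" if "T \<in> \<S>" for T
  proof -
    have "T \<subseteq> X" using that sub hy by (auto simp: hyper_def)
    moreover have "f T \<in> T \<times> T" using \<S> that unfolding good_def by blast
    ultimately show ?thesis by (auto simp: mem_Times_iff)
  qed
  have cS: "card \<S> \<le> c * card X" by (rule rep[OF \<S> order_refl fX])
  let ?P = "f ` \<S>"
  let ?cl = "{T. T \<subseteq> X \<and> T \<noteq> {} \<and> (\<forall>a\<in>T. \<forall>b\<in>T. a \<noteq> b \<longrightarrow> (a, b) \<in> ?P)}"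
  have "card ?cl \<le> 2 ^ c * card X"
  proof (rule card_cliques_le[OF fin(1)])
    fix Y assume Y: "Y \<subseteq> X"
    let ?S = "{T \<in> \<S>. f T \<in> Y \<times> Y}"
    have "f ` \<S> \<inter> B = f ` {T \<in> \<S>. f T \<in> B}" for B by blast
    from this[of "Y \<times> Y"] have "?P \<inter> Y \<times> Y = f ` ?S" .
    then have "card (?P \<inter> Y \<times> Y) \<le> card ?S" using finS by (simp add: card_image_le)
    also have "\<dots> \<le> c * card Y"
      by (rule rep[of _ f, OF _ Y]) (use \<S> in \<open>auto simp: good_def intro: inj_on_subset\<close>)
    finally show "card (?P \<inter> Y \<times> Y) \<le> c * card Y" .
  qed
  moreover have "\<T> - \<S> \<subseteq> ?cl"
  proof
    fix T assume T: "T \<in> \<T> - \<S>"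
    have "(a, b) \<in> ?P" if ab: "a \<in> T" "b \<in> T" "a \<noteq> b" for a b
    proof (rule ccontr)
      assume n: "(a, b) \<notin> ?P"
      have "inj_on (f(T := (a, b))) \<S>" using T \<S> by (auto simp: good_def inj_on_def)
      moreover have "(f(T := (a, b))) ` \<S> = ?P" using T by auto
      ultimately have "inj_on (f(T := (a, b))) (insert T \<S>)" using n T by (auto simp: inj_on_insert)
      then have "good (insert T \<S>) (f(T := (a, b)))" using T \<S> ab unfolding good_def by auto
      from max[OF this] show False using T finS by simp
    qed
    moreover have "T \<subseteq> X" "T \<noteq> {}" using T hy by (auto simp: hyper_def)
    ultimately show "T \<in> ?cl" by blast
  qed
  moreover have "finite ?cl" using fin(1) by simp
  ultimately have "card (\<T> - \<S>) \<le> 2 ^ c * card X" by (meson card_mono order_trans)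
  moreover have "card \<T> = card \<S> + card (\<T> - \<S>)"
    using sub finS fin(2) by (metis card_Diff_subset card_mono le_add_diff_inverse)
  ultimately show ?thesis using cS by (simp add: algebra_simps)
qed

lemma hyper_low_degree:
  assumes ms: "minor_sparse c E" and "sym E" "irrefl E" and hy: "hyper E h X \<T> Z" and "X \<noteq> {}"
  shows "\<exists>x\<in>X. card {y \<in> X. (x, y) \<in> E} + card {T \<in> \<T>. x \<in> T} \<le> degen_const c h"
proof (rule average_le)
  have fin: "finite X" "finite \<T>" using hy by (auto simp: hyper_def)
  show "finite X" by fact
  have "E \<inter> X \<times> X = (SIGMA x:X. {y \<in> X. (x, y) \<in> E})" by auto
  then have 1: "(\<Sum>x\<in>X. card {y \<in> X. (x, y) \<in> E}) \<le> c * card X"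
    using minor_sparse_edges[OF ms fin(1) assms(3)] fin(1) by simp
  have "(\<Sum>x\<in>X. card {T \<in> \<T>. x \<in> T}) = card (SIGMA x:X. {T \<in> \<T>. x \<in> T})" using fin by simp
  also have "\<dots> = card (SIGMA T:\<T>. {x \<in> X. x \<in> T})"
    by (rule bij_betw_same_card[of prod.swap]) (auto simp: bij_betw_def inj_on_def image_iff)
  also have "\<dots> = (\<Sum>T\<in>\<T>. card {x \<in> X. x \<in> T})" using fin by simp
  also have "\<dots> \<le> (\<Sum>T\<in>\<T>. h)"
  proof (rule sum_mono)
    fix T assume "T \<in> \<T>"
    then have "T \<subseteq> X" "card T \<le> h" using hy by (auto simp: hyper_def)
    moreover from this have "{x \<in> X. x \<in> T} = T" by blast
    ultimately show "card {x \<in> X. x \<in> T} \<le> h" by simp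
  qed
  also have "\<dots> = h * card \<T>" by simp
  also have "\<dots> \<le> h * ((c + 2 ^ c) * card X)" using hyper_card_le[OF ms assms(2) hy] by simp
  finally have 2: "(\<Sum>x\<in>X. card {T \<in> \<T>. x \<in> T}) \<le> h * ((c + 2 ^ c) * card X)" .
  show "(\<Sum>x\<in>X. card {y \<in> X. (x, y) \<in> E} + card {T \<in> \<T>. x \<in> T}) \<le> degen_const c h * card X"
    using 1 2 unfolding sum.distrib degen_const_def by (simp add: algebra_simps)
qed fact

text \<open>Vertices of low degree are peeled off one by one. The hyperedges through a peeled vertex
  are dropped rather than shrunk, so the final bound counts only the hyperedges in which
  \<open>x\<close> comes first.\<close>

lemma hyper_order:
  assumes ms: "minor_sparse c E" and "sym E" "irrefl E" and hy: "hyper E h X \<T> Z"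
  shows "\<exists>\<rho> :: 'a \<Rightarrow> nat. (\<forall>x\<in>X. card {y \<in> X. \<rho> x \<le> \<rho> y \<and> (x, y) \<in> E} +
      card {T \<in> \<T>. x \<in> T \<and> (\<forall>y\<in>T. \<rho> x \<le> \<rho> y)} \<le> degen_const c h)"
  using hy
proof (induction "card X" arbitrary: X \<T>)
  case 0
  then have "X = {}" by (auto simp: hyper_def)
  then show ?case by simp
next
  case (Suc n)
  then have "X \<noteq> {}" by auto
  then obtain x where x: "x \<in> X" "card {y \<in> X. (x, y) \<in> E} + card {T \<in> \<T>. x \<in> T} \<le> degen_const c h"
    using hyper_low_degree[OF ms assms(2,3) Suc.prems] by blast
  have fin: "finite X" "finite \<T>" using Suc.prems by (auto simp: hyper_def)
  let ?T = "{T \<in> \<T>. x \<notin> T}"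
  have hy': "hyper E h (X - {x}) ?T Z" unfolding hyper_def
  proof (intro conjI ballI impI)
    fix T assume T: "T \<in> ?T"
    then show "T \<subseteq> X - {x}" "T \<noteq> {}" "card T \<le> h" "conn_in E (Z T)" using Suc.prems by (auto simp: hyper_def)
    have "Z T \<inter> X = {}" using T Suc.prems by (simp add: hyper_def)
    then show "Z T \<inter> (X - {x}) = {}" by blast
    fix t assume "t \<in> T"
    then show "touching E {t} (Z T)" using T Suc.prems by (simp add: hyper_def)
  next
    fix S T assume "S \<in> ?T" "T \<in> ?T" "S \<noteq> T"
    then show "Z S \<inter> Z T = {}" using Suc.prems by (simp add: hyper_def)
  qed (use fin in auto)
  have "n = card (X - {x})" using Suc.hyps(2) x fin by simp
  from Suc.hyps(1)[OF this hy'] obtain \<rho> :: "'a \<Rightarrow> nat" where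
    \<rho>: "\<forall>z\<in>X - {x}. card {y \<in> X - {x}. \<rho> z \<le> \<rho> y \<and> (z, y) \<in> E} +
      card {T \<in> ?T. z \<in> T \<and> (\<forall>y\<in>T. \<rho> z \<le> \<rho> y)} \<le> degen_const c h" by blast
  define \<rho>' where "\<rho>' z = (if z = x then 0 else Suc (\<rho> z))" for z
  show ?case
  proof (intro exI[of _ \<rho>'] ballI)
    fix z assume z: "z \<in> X"
    show "card {y \<in> X. \<rho>' z \<le> \<rho>' y \<and> (z, y) \<in> E} + card {T \<in> \<T>. z \<in> T \<and> (\<forall>y\<in>T. \<rho>' z \<le> \<rho>' y)} \<le> degen_const c h"
    proof (cases "z = x")
      case True
      then show ?thesis using x(2) by (simp add: \<rho>'_def)
    next
      case False
      then have "{y \<in> X. \<rho>' z \<le> \<rho>' y \<and> (z, y) \<in> E} = {y \<in> X - {x}. \<rho> z \<le> \<rho> y \<and> (z, y) \<in> E}"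
        by (auto simp: \<rho>'_def split: if_splits)
      moreover have "{T \<in> \<T>. z \<in> T \<and> (\<forall>y\<in>T. \<rho>' z \<le> \<rho>' y)} = {T \<in> ?T. z \<in> T \<and> (\<forall>y\<in>T. \<rho> z \<le> \<rho> y)}"
        using False by (auto simp: \<rho>'_def split: if_splits)
      ultimately show ?thesis using \<rho> z False by simp
    qed
  qed
qed

section \<open>Eliminating the vertices of \<open>H\<close>\<close>

lemma pigeonhole_fiber:
  assumes "finite F" "finite A" "A \<noteq> {}" "\<And>x. x \<in> F \<Longrightarrow> f x \<in> A"
  shows "\<exists>a\<in>A. card F \<le> card A * card {x \<in> F. f x = a}"
proof (rule ccontr)
  assume n: "\<not> ?thesis"
  have "F = (\<Union>a\<in>A. {x \<in> F. f x = a})" using assms(4) by auto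
  then have "card F \<le> (\<Sum>a\<in>A. card {x \<in> F. f x = a})"
    using card_UN_le[OF assms(2), of "\<lambda>a. {x \<in> F. f x = a}"] by simp
  then have "card A * card F \<le> (\<Sum>a\<in>A. card A * card {x \<in> F. f x = a})"
    by (simp add: sum_distrib_left[symmetric])
  also have "\<dots> < (\<Sum>a\<in>A. card F)" using n assms(2,3) by (intro sum_strict_mono) (auto simp: not_le)
  finally show False by simp
qed

text \<open>In every fibre of \<open>g\<close> only the members with the most frequent value of
  \<open>f\<close> are kept. A fibre has at most \<open>D\<close> values, so a \<open>D\<close>-th
  part survives, and on the survivors \<open>g\<close> determines \<open>f\<close>.\<close>

lemma popular_choice:
  assumes "finite F" "\<And>x. card (f ` {\<phi> \<in> F. g \<phi> = x}) \<le> D"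
  shows "\<exists>F'\<subseteq>F. card F \<le> D * card F' \<and> (\<forall>\<phi>\<in>F'. \<forall>\<psi>\<in>F'. g \<phi> = g \<psi> \<longrightarrow> f \<phi> = f \<psi>)"
proof -
  have "\<exists>a. card {\<phi> \<in> F. g \<phi> = x} \<le> D * card {\<phi> \<in> F. g \<phi> = x \<and> f \<phi> = a}" for x
  proof (cases "{\<phi> \<in> F. g \<phi> = x} = {}")
    case False
    then obtain a where "card {\<phi> \<in> F. g \<phi> = x} \<le> card (f ` {\<phi> \<in> F. g \<phi> = x}) * card {\<phi> \<in> {\<phi> \<in> F. g \<phi> = x}. f \<phi> = a}"
      using pigeonhole_fiber[of "{\<phi> \<in> F. g \<phi> = x}" "f ` {\<phi> \<in> F. g \<phi> = x}" f] assms(1) by auto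
    also have "\<dots> \<le> D * card {\<phi> \<in> {\<phi> \<in> F. g \<phi> = x}. f \<phi> = a}" using assms(2)[of x] by (intro mult_right_mono) auto
    also have "{\<phi> \<in> {\<phi> \<in> F. g \<phi> = x}. f \<phi> = a} = {\<phi> \<in> F. g \<phi> = x \<and> f \<phi> = a}" by auto
    finally show ?thesis by blast
  next
    case True
    then show ?thesis by (metis card.empty le0)
  qed
  then have "\<forall>x. \<exists>a. card {\<phi> \<in> F. g \<phi> = x} \<le> D * card {\<phi> \<in> F. g \<phi> = x \<and> f \<phi> = a}" by (intro allI)
  from choice[OF this] obtain a where
    a: "\<forall>x. card {\<phi> \<in> F. g \<phi> = x} \<le> D * card {\<phi> \<in> F. g \<phi> = x \<and> f \<phi> = a x}" by (elim exE)
  define F' where "F' = {\<phi> \<in> F. f \<phi> = a (g \<phi>)}"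
  have finF': "finite F'" using assms(1) by (simp add: F'_def)
  have fib: "card F0 = (\<Sum>x\<in>g ` F. card {\<phi> \<in> F0. g \<phi> = x})" if "F0 \<subseteq> F" for F0
  proof -
    have "(\<Sum>x\<in>g ` F. \<Sum>\<phi>\<in>{\<phi> \<in> F0. g \<phi> = x}. 1) = (\<Sum>\<phi>\<in>F0. (1::nat))"
      by (rule sum.group) (use that assms(1) finite_subset in auto)
    then show ?thesis by simp
  qed
  have "card F = (\<Sum>x\<in>g ` F. card {\<phi> \<in> F. g \<phi> = x})" by (rule fib) simp
  also have "\<dots> \<le> (\<Sum>x\<in>g ` F. D * card {\<phi> \<in> F'. g \<phi> = x})"
  proof (rule sum_mono)
    fix x
    have "{\<phi> \<in> F'. g \<phi> = x} = {\<phi> \<in> F. g \<phi> = x \<and> f \<phi> = a x}" by (auto simp: F'_def)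
    then show "card {\<phi> \<in> F. g \<phi> = x} \<le> D * card {\<phi> \<in> F'. g \<phi> = x}" using a by simp
  qed
  also have "\<dots> = D * card F'" using fib[of F'] by (simp add: F'_def sum_distrib_left)
  finally have "card F \<le> D * card F'" .
  then show ?thesis by (intro exI[of _ F']) (auto simp: F'_def)
qed

section \<open>Elimination trees given by a parent map\<close>

definition anc :: "('h \<Rightarrow> 'h) \<Rightarrow> 'h \<Rightarrow> 'h \<Rightarrow> bool" where
  "anc p i a \<longleftrightarrow> (\<exists>n. (p ^^ n) i = a)"

text \<open>The root is its own parent, so the parent map can be iterated freely. The function
  \<open>dep\<close> need not be the true depth: it merely decreases towards the root and is bounded
  by \<open>card R\<close>, which suffices for inductions and for counting climbs.\<close>

definition rooted_tree :: "'h set \<Rightarrow> ('h \<Rightarrow> 'h) \<Rightarrow> 'h \<Rightarrow> ('h \<Rightarrow> nat) \<Rightarrow> bool" where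
  "rooted_tree R p r dep \<longleftrightarrow> r \<in> R \<and> p r = r \<and> (\<forall>i\<in>R. p i \<in> R \<and> dep i < card R) \<and>
     (\<forall>i\<in>R - {r}. dep (p i) < dep i)"

lemma anc_refl [simp]: "anc p i i"
  unfolding anc_def by (intro exI[of _ 0]) simp

lemma anc_step: "anc p (p i) a \<Longrightarrow> anc p i a"
  unfolding anc_def by (metis funpow_Suc_right comp_apply)

lemma anc_parent: "anc p i a \<Longrightarrow> anc p i (p a)"
  unfolding anc_def by (metis funpow.simps(2) comp_apply)

lemma anc_trans: "anc p i j \<Longrightarrow> anc p j k \<Longrightarrow> anc p i k"
  unfolding anc_def by (metis funpow_add comp_apply)

lemma anc_cases: "anc p i a \<Longrightarrow> a = i \<or> anc p (p i) a"
proof -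
  assume "anc p i a"
  then obtain n where "(p ^^ n) i = a" by (auto simp: anc_def)
  then show ?thesis by (cases n) (auto simp: anc_def funpow_Suc_right simp del: funpow.simps)
qed

lemma funpow_in:
  assumes "rooted_tree R p r dep" "i \<in> R"
  shows "(p ^^ n) i \<in> R"
  using assms by (induction n) (auto simp: rooted_tree_def)

lemma parent_dep_le: "rooted_tree R p r dep \<Longrightarrow> i \<in> R \<Longrightarrow> p i = i \<or> dep (p i) < dep i"
  unfolding rooted_tree_def by blast

lemma anc_dep:
  assumes "rooted_tree R p r dep" "i \<in> R" "anc p i a"
  shows "a = i \<or> dep a < dep i"
proof -
  obtain n where "(p ^^ n) i = a" using assms(3) by (auto simp: anc_def)
  then show ?thesis
  proof (induction n arbitrary: a)
    case (Suc n)
    let ?b = "(p ^^ n) i"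
    have "?b \<in> R" by (rule funpow_in[OF assms(1,2)])
    then have "p ?b = ?b \<or> dep (p ?b) < dep ?b" by (rule parent_dep_le[OF assms(1)])
    then show ?case using Suc.IH[of ?b] Suc.prems by auto
  qed simp
qed

section \<open>One elimination step\<close>

definition linked :: "('h \<times> 'h) set \<Rightarrow> 'h set set \<Rightarrow> 'h \<Rightarrow> 'h \<Rightarrow> bool" where
  "linked A \<E> i j \<longleftrightarrow> (i, j) \<in> A \<or> (\<exists>e\<in>\<E>. i \<in> e \<and> j \<in> e)"

text \<open>\<open>R\<close> is the set of vertices of \<open>H\<close> that are still present, and \<open>\<E>\<close> consists of the traces on \<open>R\<close>
  of connected sets of eliminated vertices; the part of \<open>G\<close> that realises the trace \<open>\<phi> ` e\<close> is
  contracted to the branch set \<open>Z (\<phi> ` e)\<close>.\<close>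

definition elim_state ::
  "('a \<times> 'a) set \<Rightarrow> ('h \<times> 'h) set \<Rightarrow> ('a \<Rightarrow> 'h) \<Rightarrow> ('h \<Rightarrow> 'a) set \<Rightarrow> 'h set \<Rightarrow> 'h set set \<Rightarrow> ('a set \<Rightarrow> 'a set) \<Rightarrow> bool" where
  "elim_state E A \<kappa> F R \<E> Z \<longleftrightarrow>
    (\<forall>\<phi>\<in>F. \<forall>i\<in>R. \<kappa> (\<phi> i) = i) \<and>
    (\<forall>\<phi>\<in>F. \<forall>i\<in>R. \<forall>j\<in>R. (i, j) \<in> A \<longrightarrow> (\<phi> i, \<phi> j) \<in> E) \<and>
    (\<forall>e\<in>\<E>. e \<subseteq> R \<and> e \<noteq> {}) \<and>
    (\<forall>\<phi>\<in>F. \<forall>e\<in>\<E>. conn_in E (Z (\<phi> ` e)) \<and> (\<forall>\<psi>\<in>F. \<forall>i\<in>R. \<psi> i \<notin> Z (\<phi> ` e)) \<and>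
       (\<forall>i\<in>e. touching E {\<phi> i} (Z (\<phi> ` e)))) \<and>
    (\<forall>\<phi>\<in>F. \<forall>\<psi>\<in>F. \<forall>e\<in>\<E>. \<forall>e'\<in>\<E>. \<phi> ` e \<noteq> \<psi> ` e' \<longrightarrow> Z (\<phi> ` e) \<inter> Z (\<psi> ` e') = {}) \<and>
    (\<forall>S. S \<subset> R \<and> S \<noteq> {} \<longrightarrow> (\<exists>i\<in>S. \<exists>j\<in>R - S. linked A \<E> i j))"

text \<open>The factor \<open>h\<close> pays for fixing which vertex of \<open>H\<close> has the
  first image. Each of the at most \<open>h\<close> vertices linked to it then has at most
  \<open>degen_const c h\<close> later neighbours, and at most \<open>degen_const c h * h\<close>
  elements of hyperedges, as possible images.\<close>

definition step_const :: "nat \<Rightarrow> nat \<Rightarrow> nat" where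
  "step_const c h = h * (degen_const c h + degen_const c h * h) ^ h"

text \<open>Order the images by the sparse ordering and let \<open>s\<close> be the vertex of
  \<open>H\<close> that most often has the first image. Seen from the image of \<open>s\<close>,
  everything linked to it comes later, so few tuples are possible for the images of the linked
  vertices. Keeping the most popular tuple makes the image of \<open>s\<close> determine it.\<close>

lemma elim_state_select:
  fixes E :: "('a \<times> 'a) set" and R :: "'h set"
  assumes ms: "minor_sparse c E" and "sym E" "irrefl E" and c: "c \<ge> 1"
    and finR: "finite R" "R \<noteq> {}" "card R \<le> h" and finF: "finite F" and st: "elim_state E A \<kappa> F R \<E> Z"
  shows "\<exists>s\<in>R. \<exists>F'\<subseteq>F. card F \<le> step_const c h * card F' \<and>
    (\<forall>\<phi>\<in>F'. \<forall>\<psi>\<in>F'. \<phi> s = \<psi> s \<longrightarrow> (\<forall>j\<in>{j \<in> R - {s}. linked A \<E> s j}. \<phi> j = \<psi> j))"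
proof -
  let ?C = "degen_const c h"
  let ?D = "?C + ?C * h"
  define X where "X = (\<Union>\<phi>\<in>F. \<phi> ` R)"
  define \<T> where "\<T> = (\<Union>\<phi>\<in>F. (\<lambda>e. \<phi> ` e) ` \<E>)"
  have Xmem: "\<phi> i \<in> X" if "\<phi> \<in> F" "i \<in> R" for \<phi> i using that unfolding X_def by blast
  have eR: "e \<subseteq> R" "e \<noteq> {}" if "e \<in> \<E>" for e using st that by (auto simp: elim_state_def)
  have fin\<E>: "finite \<E>" by (rule finite_subset[of _ "Pow R"]) (use eR finR in auto)
  have finX: "finite X" using finF finR by (auto simp: X_def)
  have hy: "hyper E h X \<T> Z"
    unfolding hyper_def
  proof (intro conjI ballI impI)
    show "finite \<T>" using finF fin\<E> by (auto simp: \<T>_def)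
    fix T assume "T \<in> \<T>"
    then obtain \<phi> e where T: "\<phi> \<in> F" "e \<in> \<E>" "T = \<phi> ` e" by (auto simp: \<T>_def)
    show "T \<subseteq> X" using T eR[OF T(2)] Xmem by auto
    show "T \<noteq> {}" using T eR[OF T(2)] by auto
    have "card T \<le> card e" using T finite_subset[OF eR(1)[OF T(2)] finR(1)] by (simp add: card_image_le)
    also have "\<dots> \<le> card R" using eR[OF T(2)] finR by (simp add: card_mono)
    finally show "card T \<le> h" using finR by simp
    show "conn_in E (Z T)" using st T by (simp add: elim_state_def)
    have "\<psi> i \<notin> Z T" if "\<psi> \<in> F" "i \<in> R" for \<psi> i using st T that by (simp add: elim_state_def)
    then show "Z T \<inter> X = {}" unfolding X_def by blast
    fix t assume "t \<in> T"
    then obtain i where "i \<in> e" "t = \<phi> i" using T by blast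
    then show "touching E {t} (Z T)" using st T by (simp add: elim_state_def)
  next
    fix S T assume S: "S \<in> \<T>" and T: "T \<in> \<T>" and ne: "S \<noteq> T"
    obtain \<phi> e where "\<phi> \<in> F" "e \<in> \<E>" "S = \<phi> ` e" using S unfolding \<T>_def by blast
    moreover obtain \<psi> e' where "\<psi> \<in> F" "e' \<in> \<E>" "T = \<psi> ` e'" using T unfolding \<T>_def by blast
    ultimately show "Z S \<inter> Z T = {}" using st ne by (simp add: elim_state_def)
  qed (rule finX)
  obtain \<rho> :: "'a \<Rightarrow> nat" where \<rho>: "\<forall>x\<in>X. card {y \<in> X. \<rho> x \<le> \<rho> y \<and> (x, y) \<in> E} +
      card {T \<in> \<T>. x \<in> T \<and> (\<forall>y\<in>T. \<rho> x \<le> \<rho> y)} \<le> ?C"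
    using hyper_order[OF ms assms(2,3) hy] by blast
  have "\<exists>i. i \<in> R \<and> (\<forall>j\<in>R. \<rho> (\<phi> i) \<le> \<rho> (\<phi> j))" for \<phi>
  proof -
    have "arg_min_on (\<lambda>i. \<rho> (\<phi> i)) R \<in> R" using arg_min_if_finite(1)[OF finR(1,2)] .
    moreover have "\<rho> (\<phi> (arg_min_on (\<lambda>i. \<rho> (\<phi> i)) R)) \<le> \<rho> (\<phi> j)" if "j \<in> R" for j
      by (rule arg_min_least[OF finR(1,2) that])
    ultimately show ?thesis by blast
  qed
  then have "\<forall>\<phi>. \<exists>i. i \<in> R \<and> (\<forall>j\<in>R. \<rho> (\<phi> i) \<le> \<rho> (\<phi> j))" by (intro allI)
  from choice[OF this] obtain first where
    first': "\<forall>\<phi>. first \<phi> \<in> R \<and> (\<forall>j\<in>R. \<rho> (\<phi> (first \<phi>)) \<le> \<rho> (\<phi> j))" by (elim exE)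
  have first: "first \<phi> \<in> R" "\<And>j. j \<in> R \<Longrightarrow> \<rho> (\<phi> (first \<phi>)) \<le> \<rho> (\<phi> j)" for \<phi> using first' by simp_all
  obtain s where s: "s \<in> R" "card F \<le> card R * card {\<phi> \<in> F. first \<phi> = s}"
    using pigeonhole_fiber[OF finF finR(1,2), of first] first(1) by blast
  define F1 where "F1 = {\<phi> \<in> F. first \<phi> = s}"
  define N where "N = {j \<in> R - {s}. linked A \<E> s j}"
  have finF1: "finite F1" using finF by (simp add: F1_def)
  have finN: "finite N" "card N \<le> h"
    using finR by (auto simp: N_def intro: order_trans[OF card_mono[OF finR(1)]])
  have "\<exists>F'\<subseteq>F1. card F1 \<le> ?D ^ h * card F' \<and> (\<forall>\<phi>\<in>F'. \<forall>\<psi>\<in>F'. \<phi> s = \<psi> s \<longrightarrow> restrict \<phi> N = restrict \<psi> N)"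
  proof (rule popular_choice[OF finF1])
    fix x
    show "card ((\<lambda>\<phi>. restrict \<phi> N) ` {\<phi> \<in> F1. \<phi> s = x}) \<le> ?D ^ h"
    proof (cases "x \<in> X")
      case False
      then have e: "{\<phi> \<in> F1. \<phi> s = x} = {}" using Xmem s(1) by (auto simp: F1_def)
      show ?thesis unfolding e by simp
    next
      case True
      let ?T = "{T \<in> \<T>. x \<in> T \<and> (\<forall>y\<in>T. \<rho> x \<le> \<rho> y)}"
      \<comment> \<open>The candidates for the image of a linked vertex: a later neighbour of
        \<open>x\<close> in the graph, or a member of a hyperedge in which \<open>x\<close> is
        first.\<close>
      let ?U = "{y \<in> X. \<rho> x \<le> \<rho> y \<and> (x, y) \<in> E} \<union> \<Union> ?T"
      have fT: "finite ?T" using hy by (simp add: hyper_def)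
      have TX: "T \<subseteq> X" "card T \<le> h" if "T \<in> \<T>" for T using hy that by (auto simp: hyper_def)
      have finU: "finite ?U" by (rule finite_subset[of _ X]) (use TX finX in auto)
      have "card ?U \<le> card {y \<in> X. \<rho> x \<le> \<rho> y \<and> (x, y) \<in> E} + card (\<Union> ?T)" by (rule card_Un_le)
      also have "card (\<Union> ?T) \<le> (\<Sum>T\<in>?T. card T)" by (rule card_Union_le_sum_card)
      also have "\<dots> \<le> (\<Sum>T\<in>?T. h)" using TX by (intro sum_mono) auto
      also have "\<dots> = card ?T * h" by simp
      also have "card {y \<in> X. \<rho> x \<le> \<rho> y \<and> (x, y) \<in> E} + card ?T * h \<le> ?C + ?C * h"
        using \<rho> True by (intro add_mono mult_right_mono) (auto intro: order_trans[rotated])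
      finally have cU: "card ?U \<le> ?D" by simp
      have "(\<lambda>\<phi>. restrict \<phi> N) ` {\<phi> \<in> F1. \<phi> s = x} \<subseteq> N \<rightarrow>\<^sub>E ?U"
      proof clarify
        fix \<phi> assume \<phi>: "\<phi> \<in> F1" "x = \<phi> s"
        then have \<phi>F: "\<phi> \<in> F" "first \<phi> = s" by (auto simp: F1_def)
        show "restrict \<phi> N \<in> N \<rightarrow>\<^sub>E ({y \<in> X. \<rho> (\<phi> s) \<le> \<rho> y \<and> (\<phi> s, y) \<in> E} \<union> \<Union> {T \<in> \<T>. \<phi> s \<in> T \<and> (\<forall>y\<in>T. \<rho> (\<phi> s) \<le> \<rho> y)})"
        proof (rule restrict_PiE_iff[THEN iffD2], intro ballI)
          fix j assume j: "j \<in> N"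
          then have jR: "j \<in> R" and l: "linked A \<E> s j" by (auto simp: N_def)
          have le: "\<rho> (\<phi> s) \<le> \<rho> (\<phi> k)" if "k \<in> R" for k using first(2)[OF that, of \<phi>] \<phi>F by simp
          from l consider "(s, j) \<in> A" | e where "e \<in> \<E>" "s \<in> e" "j \<in> e" unfolding linked_def by blast
          then show "\<phi> j \<in> {y \<in> X. \<rho> (\<phi> s) \<le> \<rho> y \<and> (\<phi> s, y) \<in> E} \<union> \<Union> {T \<in> \<T>. \<phi> s \<in> T \<and> (\<forall>y\<in>T. \<rho> (\<phi> s) \<le> \<rho> y)}"
          proof cases
            case 1
            then have "(\<phi> s, \<phi> j) \<in> E" using st \<phi>F s jR by (simp add: elim_state_def)
            then show ?thesis using le[OF jR] Xmem[OF \<phi>F(1) jR] by simp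
          next
            case (2 e)
            then have "\<phi> ` e \<in> \<T>" using \<phi>F by (auto simp: \<T>_def)
            moreover have "\<forall>y\<in>\<phi> ` e. \<rho> (\<phi> s) \<le> \<rho> y" using le eR[OF 2(1)] by auto
            ultimately have "\<phi> ` e \<in> {T \<in> \<T>. \<phi> s \<in> T \<and> (\<forall>y\<in>T. \<rho> (\<phi> s) \<le> \<rho> y)}" using 2 by simp
            moreover have "\<phi> j \<in> \<phi> ` e" using 2 by simp
            ultimately show ?thesis by blast
          qed
        qed
      qed
      then have "card ((\<lambda>\<phi>. restrict \<phi> N) ` {\<phi> \<in> F1. \<phi> s = x}) \<le> card (N \<rightarrow>\<^sub>E ?U)"
        by (intro card_mono finite_PiE finN finU)
      also have "\<dots> = card ?U ^ card N" using finN by (simp add: card_PiE)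
      also have "\<dots> \<le> ?D ^ card N" using cU by (rule power_mono) simp
      also have "\<dots> \<le> ?D ^ h" using finN(2) c by (intro power_increasing) (auto simp: degen_const_def)
      finally show ?thesis .
    qed
  qed
  then obtain F' where F': "F' \<subseteq> F1" "card F1 \<le> ?D ^ h * card F'"
    "\<And>\<phi> \<psi>. \<phi> \<in> F' \<Longrightarrow> \<psi> \<in> F' \<Longrightarrow> \<phi> s = \<psi> s \<Longrightarrow> restrict \<phi> N = restrict \<psi> N" by blast
  have "card F \<le> card R * card F1" using s(2) by (simp add: F1_def)
  also have "\<dots> \<le> h * (?D ^ h * card F')" using F'(2) finR(3) by (intro mult_mono) auto
  finally have "card F \<le> step_const c h * card F'" by (simp add: step_const_def mult.assoc)
  moreover have "\<phi> j = \<psi> j" if "\<phi> \<in> F'" "\<psi> \<in> F'" "\<phi> s = \<psi> s" "j \<in> N" for \<phi> \<psi> j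
    using F'(3)[OF that(1-3)] that(4) by (metis restrict_apply')
  moreover have "F' \<subseteq> F" using F'(1) by (auto simp: F1_def)
  ultimately show ?thesis using s(1) unfolding N_def by blast
qed

text \<open>The new hyperedge \<open>N\<close> is backed by the image of \<open>s\<close> merged
  with the branch sets of all hyperedges that contained \<open>s\<close>. These sets stay disjoint
  for different images of \<open>N\<close>, because the image of \<open>s\<close> determines the
  images of \<open>N\<close>.\<close>

lemma elim_state_step:
  fixes E :: "('a \<times> 'a) set" and R :: "'h set"
  assumes "sym E" and st: "elim_state E A \<kappa> F R \<E> Z" and s: "s \<in> R" "R \<noteq> {s}" and F': "F' \<subseteq> F"
    and N: "N = {j \<in> R - {s}. linked A \<E> s j}" and symA: "sym A"
    and det: "\<And>\<phi> \<psi> j. \<phi> \<in> F' \<Longrightarrow> \<psi> \<in> F' \<Longrightarrow> \<phi> s = \<psi> s \<Longrightarrow> j \<in> N \<Longrightarrow> \<phi> j = \<psi> j"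
  shows "\<exists>Z'. elim_state E A \<kappa> F' (R - {s}) (insert N {e \<in> \<E>. s \<notin> e}) Z'"
proof -
  have col: "\<kappa> (\<phi> i) = i" if "\<phi> \<in> F" "i \<in> R" for \<phi> i using st that by (simp add: elim_state_def)
  have adj: "(\<phi> i, \<phi> j) \<in> E" if "\<phi> \<in> F" "i \<in> R" "j \<in> R" "(i, j) \<in> A" for \<phi> i j using st that by (simp add: elim_state_def)
  have eR: "e \<subseteq> R" "e \<noteq> {}" if "e \<in> \<E>" for e using st that by (auto simp: elim_state_def)
  have Zc: "conn_in E (Z (\<phi> ` e))" if "\<phi> \<in> F" "e \<in> \<E>" for \<phi> e using st that by (simp add: elim_state_def)
  have Zn: "\<psi> i \<notin> Z (\<phi> ` e)" if "\<phi> \<in> F" "e \<in> \<E>" "\<psi> \<in> F" "i \<in> R" for \<phi> e \<psi> i using st that by (simp add: elim_state_def)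
  have Zt: "touching E {\<phi> i} (Z (\<phi> ` e))" if "\<phi> \<in> F" "e \<in> \<E>" "i \<in> e" for \<phi> e i using st that by (simp add: elim_state_def)
  have Zd: "Z (\<phi> ` e) \<inter> Z (\<psi> ` e') = {}" if "\<phi> \<in> F" "e \<in> \<E>" "\<psi> \<in> F" "e' \<in> \<E>" "\<phi> ` e \<noteq> \<psi> ` e'" for \<phi> e \<psi> e'
    using st that by (simp add: elim_state_def)
  have cut: "\<exists>i\<in>S. \<exists>j\<in>R - S. linked A \<E> i j" if "S \<subset> R" "S \<noteq> {}" for S
    using st that unfolding elim_state_def by simp
  have lsym: "linked A B i j \<longleftrightarrow> linked A B j i" for B i j using symA unfolding linked_def by (auto dest: symD)
  have NR: "N \<subseteq> R - {s}" by (auto simp: N)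
  define old where "old = (\<Union>\<phi>\<in>F'. (\<lambda>e. \<phi> ` e) ` {e \<in> \<E>. s \<notin> e})"
  \<comment> \<open>Several images of \<open>s\<close> may yield the same image of \<open>N\<close>;
    one copy is chosen to supply the branch set for all of them.\<close>
  define pick where "pick T = (SOME \<phi>. \<phi> \<in> F' \<and> \<phi> ` N = T)" for T
  define new where "new T = insert (pick T s) (\<Union>e\<in>{e \<in> \<E>. s \<in> e}. Z (pick T ` e))" for T
  \<comment> \<open>An image of \<open>N\<close> may coincide with the image of a surviving
    hyperedge. Branch sets are indexed by the image alone, so the old one is retained in that
    case.\<close>
  define Z' where "Z' T = (if T \<in> old then Z T else new T)" for T
  let ?E = "insert N {e \<in> \<E>. s \<notin> e}"
  have pick: "pick (\<phi> ` N) \<in> F' \<and> pick (\<phi> ` N) ` N = \<phi> ` N" if "\<phi> \<in> F'" for \<phi>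
    unfolding pick_def by (rule someI[of _ \<phi>]) (use that in simp)
  have oldE: "\<exists>\<phi>\<in>F'. \<exists>e\<in>\<E>. s \<notin> e \<and> T = \<phi> ` e" if "T \<in> old" for T using that by (auto simp: old_def)
  have eN: "e = N" if "\<phi> \<in> F'" "e \<in> ?E" "\<phi> ` e \<notin> old" for \<phi> e using that by (auto simp: old_def)
  have sT: "\<psi> s \<notin> \<phi> ` e" if "\<psi> \<in> F" "\<phi> \<in> F" "e \<subseteq> R" "s \<notin> e" for \<phi> \<psi> e
  proof
    assume "\<psi> s \<in> \<phi> ` e"
    then obtain j where "j \<in> e" "\<psi> s = \<phi> j" by blast
    then have "s = j" using col[OF that(1) s(1)] col[OF that(2), of j] that(3) by auto
    then show False using \<open>j \<in> e\<close> that(4) by simp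
  qed
  have new_conn: "conn_in E (new (\<phi> ` N))" if "\<phi> \<in> F'" for \<phi>
    unfolding new_def
    by (rule conn_in_star[OF assms(1)]) (use pick[OF that] F' Zc Zt in auto)
  have new_notin: "\<psi> i \<notin> new (\<phi> ` N)" if "\<phi> \<in> F'" "\<psi> \<in> F'" "i \<in> R - {s}" for \<phi> \<psi> i
  proof -
    let ?p = "pick (\<phi> ` N)"
    have p: "?p \<in> F" using pick[OF that(1)] F' by blast
    have "\<psi> \<in> F" using that F' by blast
    then have "\<psi> i \<noteq> ?p s" using col[OF p s(1)] col[of \<psi> i] that(3) by auto
    moreover have "\<psi> i \<notin> Z (?p ` e)" if "e \<in> \<E>" for e using Zn[OF p that \<open>\<psi> \<in> F\<close>, of i] \<open>i \<in> R - {s}\<close> by blast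
    ultimately show ?thesis unfolding new_def by blast
  qed
  have new_touch: "touching E {\<phi> i} (new (\<phi> ` N))" if "\<phi> \<in> F'" "i \<in> N" for \<phi> i
  proof -
    let ?p = "pick (\<phi> ` N)"
    have p: "?p \<in> F" "?p ` N = \<phi> ` N" using pick[OF that(1)] F' by auto
    have "\<phi> i \<in> ?p ` N" using that(2) p by blast
    then obtain j where j: "j \<in> N" "\<phi> i = ?p j" by blast
    then have jR: "j \<in> R" and l: "linked A \<E> s j" by (auto simp: N)
    from l consider "(s, j) \<in> A" | e where "e \<in> \<E>" "s \<in> e" "j \<in> e" unfolding linked_def by blast
    then show ?thesis
    proof cases
      case 1
      then have "(\<phi> i, ?p s) \<in> E" using adj[OF p(1) s(1) jR] j assms(1) by (auto dest: symD)
      then show ?thesis unfolding touching_def new_def by blast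
    next
      case (2 e)
      then have "touching E {?p j} (Z (?p ` e))" using Zt p by simp
      then show ?thesis using j 2 unfolding touching_def new_def by auto
    qed
  qed
  have old_new: "Z T \<inter> new (\<phi> ` N) = {}" if T: "T \<in> old" and \<phi>: "\<phi> \<in> F'" for T \<phi>
  proof -
    let ?p = "pick (\<phi> ` N)"
    obtain \<psi> e where \<psi>: "\<psi> \<in> F" "e \<in> \<E>" "s \<notin> e" "T = \<psi> ` e" using oldE[OF T] F' by blast
    have p: "?p \<in> F" using pick[OF \<phi>] F' by blast
    have "?p s \<notin> Z T" using Zn[OF \<psi>(1,2) p s(1)] \<psi>(4) by simp
    moreover have "Z T \<inter> Z (?p ` e') = {}" if e': "e' \<in> \<E>" "s \<in> e'" for e'
    proof -
      have "?p s \<notin> T" using sT[OF p \<psi>(1) eR(1)[OF \<psi>(2)] \<psi>(3)] \<psi>(4) by simp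
      then have "T \<noteq> ?p ` e'" using e'(2) by blast
      then show ?thesis using Zd[OF \<psi>(1,2) p e'(1)] \<psi>(4) by simp
    qed
    ultimately show ?thesis unfolding new_def by blast
  qed
  have new_new: "new (\<phi> ` N) \<inter> new (\<psi> ` N) = {}" if \<phi>: "\<phi> \<in> F'" and \<psi>: "\<psi> \<in> F'" and ne: "\<phi> ` N \<noteq> \<psi> ` N" for \<phi> \<psi>
  proof -
    let ?p = "pick (\<phi> ` N)" and ?q = "pick (\<psi> ` N)"
    have p: "?p \<in> F'" "?p ` N = \<phi> ` N" "?q \<in> F'" "?q ` N = \<psi> ` N" using pick \<phi> \<psi> by blast+
    have pF: "?p \<in> F" "?q \<in> F" using p F' by auto
    have pq: "?p s \<noteq> ?q s"
    proof
      assume "?p s = ?q s"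
      then have "?p ` N = ?q ` N" using det[OF p(1,3)] by (intro image_cong) auto
      then show False using p ne by simp
    qed
    have "?p s \<notin> Z (?q ` e)" if "e \<in> \<E>" for e using Zn[OF pF(2) that pF(1) s(1)] .
    moreover have "?q s \<notin> Z (?p ` e)" if "e \<in> \<E>" for e using Zn[OF pF(1) that pF(2) s(1)] .
    moreover have "Z (?p ` e) \<inter> Z (?q ` e') = {}" if e: "e \<in> \<E>" "s \<in> e" "e' \<in> \<E>" for e e'
    proof (rule Zd[OF pF(1) e(1) pF(2) e(3)])
      show "?p ` e \<noteq> ?q ` e'"
      proof
        assume "?p ` e = ?q ` e'"
        then obtain j where "j \<in> e'" "?p s = ?q j" using e(2) by (metis imageE imageI)
        then show False using col[OF pF(1) s(1)] col[OF pF(2), of j] eR(1)[OF e(3)] pq by auto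
      qed
    qed
    ultimately show ?thesis using pq unfolding new_def by (simp add: disjoint_iff) blast
  qed
  show ?thesis
  proof (intro exI[of _ Z'], unfold elim_state_def, intro conjI)
    show "\<forall>\<phi>\<in>F'. \<forall>i\<in>R - {s}. \<kappa> (\<phi> i) = i" using col F' by blast
    show "\<forall>\<phi>\<in>F'. \<forall>i\<in>R - {s}. \<forall>j\<in>R - {s}. (i, j) \<in> A \<longrightarrow> (\<phi> i, \<phi> j) \<in> E" using adj F' by blast
    show "\<forall>e\<in>?E. e \<subseteq> R - {s} \<and> e \<noteq> {}"
    proof -
      obtain j where "j \<in> R - {s}" "linked A \<E> s j" using cut[of "{s}"] s by blast
      then have "N \<noteq> {}" unfolding N by blast
      then show ?thesis using NR eR by blast
    qed
    show "\<forall>\<phi>\<in>F'. \<forall>e\<in>?E. conn_in E (Z' (\<phi> ` e)) \<and> (\<forall>\<psi>\<in>F'. \<forall>i\<in>R - {s}. \<psi> i \<notin> Z' (\<phi> ` e)) \<and>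
       (\<forall>i\<in>e. touching E {\<phi> i} (Z' (\<phi> ` e)))"
    proof (intro ballI)
      fix \<phi> e assume \<phi>: "\<phi> \<in> F'" and e: "e \<in> ?E"
      show "conn_in E (Z' (\<phi> ` e)) \<and> (\<forall>\<psi>\<in>F'. \<forall>i\<in>R - {s}. \<psi> i \<notin> Z' (\<phi> ` e)) \<and> (\<forall>i\<in>e. touching E {\<phi> i} (Z' (\<phi> ` e)))"
      proof (cases "\<phi> ` e \<in> old")
        case True
        then obtain \<psi> d where \<psi>: "\<psi> \<in> F" "d \<in> \<E>" "\<phi> ` e = \<psi> ` d" using oldE F' by blast
        have "touching E {\<phi> i} (Z (\<phi> ` e))" if "i \<in> e" for i
        proof -
          have "\<phi> i \<in> \<psi> ` d" using \<psi>(3) that by blast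
          then obtain k where "k \<in> d" "\<phi> i = \<psi> k" by blast
          then show ?thesis using Zt[OF \<psi>(1,2)] \<psi>(3) by simp
        qed
        moreover have "\<theta> i \<notin> Z (\<phi> ` e)" if "\<theta> \<in> F'" "i \<in> R - {s}" for \<theta> i
          using Zn[OF \<psi>(1,2), of \<theta> i] that F' \<psi>(3) by auto
        ultimately show ?thesis using True Zc[OF \<psi>(1,2)] \<psi>(3) unfolding Z'_def by simp
      next
        case False
        then have "e = N" using eN \<phi> e by blast
        then show ?thesis using False new_conn[OF \<phi>] new_notin[OF \<phi>] new_touch[OF \<phi>] unfolding Z'_def by simp
      qed
    qed
    show "\<forall>\<phi>\<in>F'. \<forall>\<psi>\<in>F'. \<forall>e\<in>?E. \<forall>e'\<in>?E. \<phi> ` e \<noteq> \<psi> ` e' \<longrightarrow> Z' (\<phi> ` e) \<inter> Z' (\<psi> ` e') = {}"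
    proof (intro ballI impI)
      fix \<phi> \<psi> e e' assume a: "\<phi> \<in> F'" "\<psi> \<in> F'" "e \<in> ?E" "e' \<in> ?E" "\<phi> ` e \<noteq> \<psi> ` e'"
      show "Z' (\<phi> ` e) \<inter> Z' (\<psi> ` e') = {}"
      proof (cases "\<phi> ` e \<in> old"; cases "\<psi> ` e' \<in> old")
        assume o: "\<phi> ` e \<in> old" "\<psi> ` e' \<in> old"
        obtain \<phi>' d where 1: "\<phi>' \<in> F" "d \<in> \<E>" "\<phi> ` e = \<phi>' ` d" using oldE[OF o(1)] F' by blast
        obtain \<psi>' d' where 2: "\<psi>' \<in> F" "d' \<in> \<E>" "\<psi> ` e' = \<psi>' ` d'" using oldE[OF o(2)] F' by blast
        show ?thesis using Zd[OF 1(1,2) 2(1,2)] 1(3) 2(3) a(5) o unfolding Z'_def by simp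
      next
        assume o: "\<phi> ` e \<in> old" "\<psi> ` e' \<notin> old"
        then have "e' = N" using eN a by blast
        then show ?thesis using old_new[OF o(1) a(2)] o unfolding Z'_def by simp
      next
        assume o: "\<phi> ` e \<notin> old" "\<psi> ` e' \<in> old"
        then have "e = N" using eN a by blast
        then show ?thesis using old_new[OF o(2) a(1)] o unfolding Z'_def by (simp add: Int_commute)
      next
        assume o: "\<phi> ` e \<notin> old" "\<psi> ` e' \<notin> old"
        then have "e = N" "e' = N" using eN a by blast+
        then show ?thesis using new_new[OF a(1,2)] a(5) o unfolding Z'_def by simp
      qed
    qed
    show "\<forall>S. S \<subset> R - {s} \<and> S \<noteq> {} \<longrightarrow> (\<exists>i\<in>S. \<exists>j\<in>R - {s} - S. linked A ?E i j)"
    proof (intro allI impI)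
      fix S assume S: "S \<subset> R - {s} \<and> S \<noteq> {}"
      have keep: "linked A ?E i j" if "linked A \<E> i j" "i \<in> R - {s}" "j \<in> R - {s}" for i j
      proof -
        from that(1) consider "(i, j) \<in> A" | e where "e \<in> \<E>" "i \<in> e" "j \<in> e" unfolding linked_def by blast
        then show ?thesis
        proof cases
          case (2 e)
          show ?thesis
          proof (cases "s \<in> e")
            case True
            then have "linked A \<E> s i" "linked A \<E> s j" using 2 unfolding linked_def by auto
            then have "i \<in> N" "j \<in> N" using that by (auto simp: N)
            then show ?thesis unfolding linked_def by auto
          next
            case False
            then show ?thesis using 2 unfolding linked_def by auto
          qed
        qed (auto simp: linked_def)
      qed
      \<comment> \<open>The old connectivity is applied to both sides of the cut. If both crossing
        links lead to \<open>s\<close>, their other ends lie in \<open>N\<close> and are joined by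
        the new hyperedge.\<close>
      let ?S' = "R - {s} - S"
      have S1: "S \<subset> R" "?S' \<subset> R" "?S' \<noteq> {}" using S s by auto
      obtain i j where ij: "i \<in> S" "j \<in> R - S" "linked A \<E> i j" using cut[OF S1(1)] S by blast
      obtain k l where kl: "k \<in> ?S'" "l \<in> R - ?S'" "linked A \<E> k l" using cut[OF S1(2,3)] by blast
      have Nmem: "x \<in> N" if "x \<in> R - {s}" "linked A \<E> s x" for x using that by (simp add: N)
      have both: "linked A ?E x y" if "x \<in> N" "y \<in> N" for x y using that unfolding linked_def by blast
      show "\<exists>i\<in>S. \<exists>j\<in>R - {s} - S. linked A ?E i j"
      proof (cases "j = s")
        case False
        then have "j \<in> ?S'" "i \<in> R - {s}" using ij S by auto
        moreover have "linked A ?E i j"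
          using keep[OF ij(3)] \<open>j \<in> ?S'\<close> \<open>i \<in> R - {s}\<close> by auto
        ultimately show ?thesis using ij(1) by blast
      next
        case True
        then have iN: "i \<in> N" using ij S lsym[of \<E> i s] by (intro Nmem) auto
        show ?thesis
        proof (cases "l = s")
          case True
          then have "k \<in> N" using kl lsym[of \<E> k s] by (intro Nmem) auto
          then show ?thesis using both[OF iN] ij(1) kl(1) by blast
        next
          case False
          then have l: "l \<in> S" using kl by blast
          have "linked A \<E> l k" using kl lsym by blast
          then have "linked A ?E l k"
            using keep[of l k] l kl(1) S by auto
          then show ?thesis using l kl(1) by blast
        qed
      qed
    qed
  qed
qed

lemma step_const_pos: "c \<ge> 1 \<Longrightarrow> h \<ge> 1 \<Longrightarrow> step_const c h \<ge> 1"
  by (simp add: step_const_def degen_const_def Suc_le_eq)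

text \<open>The eliminated vertex \<open>s\<close> is hung as a leaf into the tree built for the
  rest. Its neighbours \<open>N\<close> are pairwise linked there, hence lie on one branch, and the
  lowest of them becomes the parent of \<open>s\<close>. The third conclusion records that each
  subtree has a vertex linked to the parent of its top; this is how the exploration can enter the
  subtree from that parent and come back to it.\<close>

theorem role_tree:
  fixes E :: "('a \<times> 'a) set" and R :: "'h set"
  assumes ms: "minor_sparse c E" and symE: "sym E" and irr: "irrefl E" and c: "c \<ge> 1" and symA: "sym A"
    and "finite R" "R \<noteq> {}" "card R \<le> h" "finite F" "elim_state E A \<kappa> F R \<E> Z"
  shows "\<exists>p r dep F'. rooted_tree R p r dep \<and> F' \<subseteq> F \<and> card F \<le> step_const c h ^ card R * card F' \<and>
    (\<forall>i\<in>R. \<forall>j\<in>R. linked A \<E> i j \<longrightarrow> anc p i j \<or> anc p j i) \<and>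
    (\<forall>k\<in>R - {r}. \<exists>j\<in>R. anc p j k \<and> linked A \<E> j (p k)) \<and>
    (\<forall>\<phi>\<in>F'. \<forall>\<psi>\<in>F'. \<forall>k\<in>R. \<phi> k = \<psi> k \<longrightarrow> \<phi> (p k) = \<psi> (p k))"
  using assms(6-10)
proof (induction "card R" arbitrary: R F \<E> Z)
  case 0
  then show ?case by simp
next
  case (Suc n)
  have R1: "card R \<ge> 1" using Suc.hyps(2) by simp
  have h1: "h \<ge> 1" using Suc.hyps(2) Suc.prems(3) by simp
  show ?case
  proof (cases "n = 0")
    case True
    then obtain r where r: "R = {r}" using Suc.hyps(2) by (metis One_nat_def card_1_singletonE)
    show ?thesis
    proof (intro exI[of _ "\<lambda>_. r"] exI[of _ r] exI[of _ "\<lambda>_. 0"] exI[of _ F] conjI)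
      show "rooted_tree R (\<lambda>_. r) r (\<lambda>_. 0)" using r by (simp add: rooted_tree_def)
      have "1 * card F \<le> step_const c h ^ card R * card F"
        using step_const_pos[OF c h1] by (intro mult_right_mono) auto
      then show "card F \<le> step_const c h ^ card R * card F" by simp
    qed (use r in auto)
  next
    case False
    obtain s F1 where s: "s \<in> R" and F1: "F1 \<subseteq> F" "card F \<le> step_const c h * card F1"
      and det0: "\<forall>\<phi>\<in>F1. \<forall>\<psi>\<in>F1. \<phi> s = \<psi> s \<longrightarrow> (\<forall>j\<in>{j \<in> R - {s}. linked A \<E> s j}. \<phi> j = \<psi> j)"
      using elim_state_select[OF ms symE irr c Suc.prems(1-5)] by blast
    define N where "N = {j \<in> R - {s}. linked A \<E> s j}"
    have det: "\<phi> j = \<psi> j" if "\<phi> \<in> F1" "\<psi> \<in> F1" "\<phi> s = \<psi> s" "j \<in> N" for \<phi> \<psi> j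
      using det0 that unfolding N_def by blast
    let ?R = "R - {s}" and ?E = "insert N {e \<in> \<E>. s \<notin> e}"
    have cR: "n = card ?R" using Suc.hyps(2) s Suc.prems(1) by simp
    have neR: "R \<noteq> {s}" using False cR by auto
    have "\<exists>Z'. elim_state E A \<kappa> F1 ?R ?E Z'"
      by (rule elim_state_step[OF symE Suc.prems(5) s neR F1(1) N_def symA]) (rule det)
    then obtain Z' where st': "elim_state E A \<kappa> F1 ?R ?E Z'" by (elim exE)
    have R': "finite ?R" "?R \<noteq> {}" "card ?R \<le> h" "finite F1"
      using Suc.prems Suc.hyps(2) cR False F1(1) finite_subset by auto
    obtain p r dep F' where IH: "rooted_tree ?R p r dep" "F' \<subseteq> F1" "card F1 \<le> step_const c h ^ card ?R * card F'"
      "\<forall>i\<in>?R. \<forall>j\<in>?R. linked A ?E i j \<longrightarrow> anc p i j \<or> anc p j i"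
      "\<forall>k\<in>?R - {r}. \<exists>j\<in>?R. anc p j k \<and> linked A ?E j (p k)"
      "\<forall>\<phi>\<in>F'. \<forall>\<psi>\<in>F'. \<forall>k\<in>?R. \<phi> k = \<psi> k \<longrightarrow> \<phi> (p k) = \<psi> (p k)"
      using Suc.hyps(1)[OF cR R' st'] by (elim exE conjE) (rule that)
    have NR: "N \<subseteq> ?R" by (auto simp: N_def)
    have Nne: "N \<noteq> {}" using st' by (simp add: elim_state_def)
    have finN: "finite N" using NR R'(1) finite_subset by blast
    \<comment> \<open>The element \<open>q\<close> of \<open>N\<close> with the largest
      \<open>dep\<close> has all other elements of \<open>N\<close> as ancestors, by
      comparability.\<close>
    have "Max (dep ` N) \<in> dep ` N" using finN Nne by simp
    then obtain q where q: "q \<in> N" "dep q = Max (dep ` N)" by auto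
    have qmax: "dep j \<le> dep q" if "j \<in> N" for j using q(2) finN that by simp
    have qR: "q \<in> ?R" using q(1) NR by blast
    have qN: "anc p q j" if "j \<in> N" for j
    proof -
      have "linked A ?E q j" using q(1) that unfolding linked_def by blast
      then have "anc p q j \<or> anc p j q" using IH(4) qR NR that by blast
      moreover have "q = j" if "anc p j q" using anc_dep[OF IH(1) _ that] qmax[OF \<open>j \<in> N\<close>] NR \<open>j \<in> N\<close> by fastforce
      ultimately show ?thesis by auto
    qed
    define p' where "p' = p(s := q)"
    define dep' where "dep' = dep(s := Suc (dep q))"
    have fp: "(p' ^^ m) i = (p ^^ m) i" if "i \<in> ?R" for i m
    proof (induction m)
      case (Suc m)
      have "(p ^^ m) i \<in> ?R" by (rule funpow_in[OF IH(1) that])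
      then show ?case using Suc by (simp add: p'_def)
    qed simp
    have ancR: "anc p' i a \<longleftrightarrow> anc p i a" if "i \<in> ?R" for i a using fp[OF that] by (simp add: anc_def)
    have ancs: "anc p' s j" if "anc p q j" for j
      by (rule anc_step) (use that ancR[OF qR] in \<open>simp add: p'_def\<close>)
    have rR: "r \<in> ?R" using IH(1) by (simp add: rooted_tree_def)
    have keep: "linked A ?E i j" if "linked A \<E> i j" "i \<in> ?R" "j \<in> ?R" for i j
    proof -
      from that(1) consider "(i, j) \<in> A" | e where "e \<in> \<E>" "i \<in> e" "j \<in> e" unfolding linked_def by blast
      then show ?thesis
      proof cases
        case (2 e)
        show ?thesis
        proof (cases "s \<in> e")
          case True
          then have "linked A \<E> s i" "linked A \<E> s j" using 2 unfolding linked_def by auto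
          then have "i \<in> N" "j \<in> N" using that by (auto simp: N_def)
          then show ?thesis unfolding linked_def by auto
        next
          case False
          then show ?thesis using 2 unfolding linked_def by auto
        qed
      qed (auto simp: linked_def)
    qed
    have lsym: "linked A \<E> i j \<longleftrightarrow> linked A \<E> j i" for i j using symA unfolding linked_def by (auto dest: symD)
    show ?thesis
    proof (intro exI[of _ p'] exI[of _ r] exI[of _ dep'] exI[of _ F'] conjI)
      show "rooted_tree R p' r dep'"
        unfolding rooted_tree_def
      proof (intro conjI ballI)
        show "r \<in> R" "p' r = r" using IH(1) rR by (auto simp: rooted_tree_def p'_def)
        fix i assume i: "i \<in> R"
        have *: "p j \<in> ?R" "dep j < card ?R" if "j \<in> ?R" for j using IH(1) that by (auto simp: rooted_tree_def)
        show "p' i \<in> R" using i *(1)[of i] qR by (auto simp: p'_def)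
        show "dep' i < card R" using i *(2)[of i] *(2)[OF qR] cR Suc.hyps(2) by (auto simp: dep'_def)
      next
        fix i assume i: "i \<in> R - {r}"
        show "dep' (p' i) < dep' i"
        proof (cases "i = s")
          case True
          then show ?thesis using qR by (simp add: p'_def dep'_def)
        next
          case False
          then have "i \<in> ?R - {r}" "p i \<in> ?R" using i IH(1) by (auto simp: rooted_tree_def)
          then have "dep (p i) < dep i" "p i \<noteq> s" using IH(1) by (auto simp: rooted_tree_def)
          then show ?thesis using False by (simp add: p'_def dep'_def)
        qed
      qed
      show "F' \<subseteq> F" using IH(2) F1(1) by blast
      have "card F \<le> step_const c h * card F1" by fact
      also have "\<dots> \<le> step_const c h * (step_const c h ^ card ?R * card F')" using IH(3) by (intro mult_left_mono) auto
      also have "\<dots> = step_const c h ^ card R * card F'" using cR Suc.hyps(2) by (metis mult.assoc power_Suc)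
      finally show "card F \<le> step_const c h ^ card R * card F'" .
      show "\<forall>i\<in>R. \<forall>j\<in>R. linked A \<E> i j \<longrightarrow> anc p' i j \<or> anc p' j i"
      proof (intro ballI impI)
        fix i j assume ij: "i \<in> R" "j \<in> R" "linked A \<E> i j"
        show "anc p' i j \<or> anc p' j i"
        proof (cases "i = s \<or> j = s")
          case False
          then have "i \<in> ?R" "j \<in> ?R" using ij by auto
          then show ?thesis using IH(4) keep[OF ij(3)] ancR by blast
        next
          case True
          then consider "i = j" | "i = s" "j \<in> N" | "j = s" "i \<in> N"
            using ij lsym[of i j] unfolding N_def by blast
          then show ?thesis using ancs qN by cases auto
        qed
      qed
      show "\<forall>k\<in>R - {r}. \<exists>j\<in>R. anc p' j k \<and> linked A \<E> j (p' k)"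
      proof
        fix k assume k: "k \<in> R - {r}"
        show "\<exists>j\<in>R. anc p' j k \<and> linked A \<E> j (p' k)"
        proof (cases "k = s")
          case True
          have "linked A \<E> s q" using q(1) by (simp add: N_def)
          then show ?thesis using True s by (intro bexI[of _ s]) (auto simp: p'_def)
        next
          case False
          then have kR: "k \<in> ?R - {r}" using k by blast
          then obtain j where j: "j \<in> ?R" "anc p j k" "linked A ?E j (p k)" using IH(5) by blast
          have pk: "p' k = p k" using False by (simp add: p'_def)
          from j(3) consider "linked A \<E> j (p k)" | "j \<in> N" "p k \<in> N" unfolding linked_def by blast
          then show ?thesis
          proof cases
            case 1
            then show ?thesis using j pk ancR[OF j(1)] by (intro bexI[of _ j]) auto
          next
            \<comment> \<open>The link came from the new hyperedge only. Then \<open>s\<close> takes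
              over: it lies below \<open>j\<close>, hence below \<open>k\<close>, and is itself
              linked to the parent of \<open>k\<close>.\<close>
            case 2
            have "anc p q k" using anc_trans[OF qN[OF 2(1)] j(2)] .
            then have "anc p' s k" by (rule ancs)
            moreover have "linked A \<E> s (p k)" using 2(2) by (simp add: N_def)
            ultimately show ?thesis using s pk by auto
          qed
        qed
      qed
      show "\<forall>\<phi>\<in>F'. \<forall>\<psi>\<in>F'. \<forall>k\<in>R. \<phi> k = \<psi> k \<longrightarrow> \<phi> (p' k) = \<psi> (p' k)"
      proof (intro ballI impI)
        fix \<phi> \<psi> k assume a: "\<phi> \<in> F'" "\<psi> \<in> F'" "k \<in> R" "\<phi> k = \<psi> k"
        show "\<phi> (p' k) = \<psi> (p' k)"
        proof (cases "k = s")
          case True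
          then show ?thesis using det[of \<phi> \<psi> q] a IH(2) q(1) by (auto simp: p'_def)
        next
          case False
          then have "k \<in> ?R" using a by blast
          then show ?thesis using IH(6) a False by (simp add: p'_def)
        qed
      qed
    qed
  qed
qed

section \<open>Traversal with answers drawn in advance\<close>

definition rep_nb :: "'a pair_pre_digraph \<Rightarrow> nat \<Rightarrow> 'a \<Rightarrow> 'a option list pmf" where
  "rep_nb G d u = replicate_pmf d (random_neighbor G u)"

definition det_round :: "('a \<Rightarrow> 'a option list) \<Rightarrow> 'a set \<times> 'a set \<times> ('a \<times> 'a) set \<times> nat
    \<Rightarrow> 'a set \<times> 'a set \<times> ('a \<times> 'a) set \<times> nat" where
  "det_round A = (\<lambda>(W, L, E, q). let \<Gamma> = (\<lambda>u. {x. Some x \<in> set (A u)}); L' = (\<Union>u\<in>L. \<Gamma> u) - W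
        in (W \<union> L', L', E \<union> Sigma L \<Gamma>, q + (\<Sum>u\<in>L. length (A u))))"

text \<open>Unlike \<open>traverse_state\<close>, the recursion splits off the first round, so
  inductions can generalise over the starting state.\<close>

primrec trav :: "'a pair_pre_digraph \<Rightarrow> nat \<Rightarrow> nat \<Rightarrow> 'a set \<times> 'a set \<times> ('a \<times> 'a) set \<times> nat
    \<Rightarrow> ('a set \<times> 'a set \<times> ('a \<times> 'a) set \<times> nat) pmf" where
  "trav G d 0 s = return_pmf s"
| "trav G d (Suc j) s = bind_pmf (traverse_round G d s) (trav G d j)"

lemma traverse_round_det:
  "traverse_round G d (W, L, E, q) = map_pmf (\<lambda>A. det_round A (W, L, E, q)) (Pi_pmf L [] (rep_nb G d))"
  unfolding traverse_round_def det_round_def rep_nb_def[abs_def] by simp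

lemma trav_snoc: "trav G d (Suc j) s = bind_pmf (trav G d j s) (traverse_round G d)"
proof (induction j arbitrary: s)
  case 0
  have "trav G d 0 = return_pmf" by (simp add: fun_eq_iff)
  then show ?case by (simp add: bind_return_pmf bind_return_pmf')
next
  case (Suc j)
  have "trav G d (Suc j) = (\<lambda>s. bind_pmf (trav G d j s) (traverse_round G d))" using Suc by (simp add: fun_eq_iff)
  then have "trav G d (Suc (Suc j)) s = bind_pmf (traverse_round G d s) (\<lambda>s. bind_pmf (trav G d j s) (traverse_round G d))"
    by simp
  then show ?case by (simp add: bind_assoc_pmf)
qed

lemma traverse_state_trav: "traverse_state G v d j = trav G d j ({v}, {v}, {}, 0)"
  by (induction j) (simp_all add: trav_snoc del: trav.simps(2))

lemma det_round_cong:
  assumes "\<And>u. u \<in> L \<Longrightarrow> A u = B u"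
  shows "det_round A (W, L, E, q) = det_round B (W, L, E, q)"
proof -
  have 1: "(\<Union>u\<in>L. {x. Some x \<in> set (A u)}) = (\<Union>u\<in>L. {x. Some x \<in> set (B u)})" using assms by auto
  have 2: "Sigma L (\<lambda>u. {x. Some x \<in> set (A u)}) = Sigma L (\<lambda>u. {x. Some x \<in> set (B u)})" using assms by auto
  have 3: "(\<Sum>u\<in>L. length (A u)) = (\<Sum>u\<in>L. length (B u))" using assms by (intro sum.cong) auto
  show ?thesis unfolding det_round_def Let_def by (simp add: 1 2 3)
qed

text \<open>Vertices in \<open>W - L\<close> have already been processed and never enter a layer
  again, so their table entries can be changed freely.\<close>

lemma det_rounds_cong:
  assumes "\<And>u. u \<notin> W - L \<Longrightarrow> A u = B u" "L \<subseteq> W"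
  shows "(det_round A ^^ j) (W, L, E, q) = (det_round B ^^ j) (W, L, E, q)"
  using assms
proof (induction j arbitrary: W L E q)
  case (Suc j)
  obtain W' L' E' q' where s: "det_round A (W, L, E, q) = (W', L', E', q')" by (metis prod_cases4)
  have s': "det_round B (W, L, E, q) = (W', L', E', q')"
    using det_round_cong[of L A B] Suc.prems s by (metis DiffD2)
  have WL: "W' = W \<union> L'" "L' \<inter> W = {}" using s by (auto simp: det_round_def Let_def)
  have "(det_round A ^^ j) (W', L', E', q') = (det_round B ^^ j) (W', L', E', q')"
    by (rule Suc.IH) (use Suc.prems WL in auto)
  then show ?case by (simp add: funpow_Suc_right s s' del: funpow.simps)
qed simp

lemma random_neighbor_in:
  assumes "finite (parcs G)" "Some x \<in> set_pmf (random_neighbor G u)"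
  shows "(u, x) \<in> parcs G"
proof -
  have "finite (parcs G `` {u})" using assms(1) by simp
  then show ?thesis using assms(2) unfolding random_neighbor_def by (auto split: if_splits)
qed

text \<open>Deferred decisions: a vertex is queried in at most one round, so all answers may be drawn in advance.\<close>

lemma trav_eq_det:
  fixes G :: "'a pair_pre_digraph"
  assumes "pair_graph G" "L \<subseteq> W" "L \<subseteq> pverts G"
  shows "trav G d j (W, L, E, q) =
    map_pmf (\<lambda>A. (det_round A ^^ j) (W, L, E, q)) (Pi_pmf (pverts G - (W - L)) [] (rep_nb G d))"
  using assms(2,3)
proof (induction j arbitrary: W L E q)
  case 0
  then show ?case by simp
next
  case (Suc j)
  interpret pair_graph G by fact
  let ?s = "(W, L, E, q)"
  let ?P = "\<lambda>S. Pi_pmf S [] (rep_nb G d)"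
  have finV: "finite (pverts G)" by simp
  then have finL: "finite L" using Suc.prems finite_subset by blast
  have "trav G d (Suc j) ?s = bind_pmf (?P L) (\<lambda>A. trav G d j (det_round A ?s))"
    by (simp add: traverse_round_det bind_map_pmf)
  also have "\<dots> = bind_pmf (?P L) (\<lambda>A. map_pmf (\<lambda>B. (det_round B ^^ j) (det_round A ?s)) (?P (pverts G - W)))"
  proof (rule bind_pmf_cong[OF refl])
    fix A assume A: "A \<in> set_pmf (?P L)"
    obtain W' L' E' q' where s: "det_round A ?s = (W', L', E', q')" by (metis prod_cases4)
    have WL: "W' = W \<union> L'" "L' \<inter> W = {}" and L': "L' \<subseteq> (\<Union>u\<in>L. {x. Some x \<in> set (A u)})"
      using s by (auto simp: det_round_def Let_def)
    have "L' \<subseteq> pverts G"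
    proof
      fix x assume "x \<in> L'"
      then obtain u where u: "u \<in> L" "Some x \<in> set (A u)" using L' by auto
      have "A u \<in> set_pmf (rep_nb G d u)" using A u(1) finL by (auto simp: set_Pi_pmf PiE_dflt_def)
      then have "Some x \<in> set_pmf (random_neighbor G u)" using u(2) by (auto simp: rep_nb_def set_replicate_pmf)
      then have "(u, x) \<in> parcs G" by (intro random_neighbor_in) auto
      then show "x \<in> pverts G" by (rule in_arcsD2)
    qed
    then have "trav G d j (W', L', E', q') =
        map_pmf (\<lambda>B. (det_round B ^^ j) (W', L', E', q')) (?P (pverts G - (W' - L')))"
      using WL by (intro Suc.IH) auto
    \<comment> \<open>After the first round the finished vertices are exactly the old
      \<open>W\<close>. The first round and the later ones therefore consult disjoint sets of table
      entries, which can be glued together as one independent product.\<close>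
    moreover have "W' - L' = W" using WL by auto
    ultimately show "trav G d j (det_round A ?s) = map_pmf (\<lambda>B. (det_round B ^^ j) (det_round A ?s)) (?P (pverts G - W))"
      by (simp add: s)
  qed
  also have "\<dots> = map_pmf (\<lambda>(A, B). (det_round B ^^ j) (det_round A ?s)) (pair_pmf (?P L) (?P (pverts G - W)))"
    by (simp add: pair_pmf_def map_bind_pmf map_pmf_def bind_assoc_pmf bind_return_pmf)
  also have "\<dots> = map_pmf (\<lambda>A. (det_round A ^^ Suc j) ?s)
      (map_pmf (\<lambda>(f, g) x. if x \<in> L then f x else g x) (pair_pmf (?P L) (?P (pverts G - W))))"
    unfolding pmf.map_comp
  proof (rule map_pmf_cong[OF refl], clarsimp simp: funpow_Suc_right simp del: funpow.simps)
    fix A B :: "'a \<Rightarrow> 'a option list"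
    let ?M = "\<lambda>x. if x \<in> L then A x else B x"
    have 1: "det_round ?M ?s = det_round A ?s" by (rule det_round_cong) simp
    obtain W' L' E' q' where s: "det_round A ?s = (W', L', E', q')" by (metis prod_cases4)
    have WL: "W' = W \<union> L'" "L' \<inter> W = {}" using s by (auto simp: det_round_def Let_def)
    have "(det_round B ^^ j) (W', L', E', q') = (det_round ?M ^^ j) (W', L', E', q')"
      by (rule det_rounds_cong) (use WL Suc.prems in auto)
    then show "(det_round B ^^ j) (det_round A ?s) = (det_round ?M ^^ j) (det_round ?M ?s)"
      by (simp only: 1 s)
  qed
  also have "map_pmf (\<lambda>(f, g) x. if x \<in> L then f x else g x) (pair_pmf (?P L) (?P (pverts G - W))) = ?P (L \<union> (pverts G - W))"
    by (rule Pi_pmf_union[symmetric]) (use finL finV Suc.prems in auto)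
  also have "L \<union> (pverts G - W) = pverts G - (W - L)" using Suc.prems by auto
  finally show ?case .
qed

section \<open>Answer tables and the walks they permit\<close>

definition answer_table :: "'a pair_pre_digraph \<Rightarrow> ('a \<Rightarrow> 'a option) pmf" where
  "answer_table G = Pi_pmf (pverts G) None (random_neighbor G)"

text \<open>The array of independent answers is transposed: instead of \<open>d\<close> answers at
  every vertex there are \<open>d\<close> independent tables with one answer per vertex. The tables
  can later be divided among the phases of an analysis.\<close>

lemma Pi_pmf_rep_nb:
  assumes "finite (pverts G)"
  shows "Pi_pmf (pverts G) [] (rep_nb G d) =
    map_pmf (\<lambda>bs u. if u \<in> pverts G then map (\<lambda>b. b u) bs else []) (replicate_pmf d (answer_table G))"
proof (induction d)
  case 0
  show ?case by (auto simp: rep_nb_def[abs_def] Pi_pmf_return_pmf[OF assms] if_distrib cong: if_cong)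
next
  case (Suc d)
  let ?V = "pverts G"
  have "Pi_pmf ?V [] (rep_nb G (Suc d)) =
      Pi_pmf ?V [] (\<lambda>u. bind_pmf (random_neighbor G u) (\<lambda>x. bind_pmf (rep_nb G d u) (\<lambda>xs. return_pmf (x # xs))))"
    by (simp add: rep_nb_def[abs_def])
  also have "\<dots> = bind_pmf (answer_table G) (\<lambda>b. Pi_pmf ?V [] (\<lambda>u. bind_pmf (rep_nb G d u) (\<lambda>xs. return_pmf (b u # xs))))"
    unfolding answer_table_def by (rule Pi_pmf_bind[OF assms])
  also have "\<dots> = bind_pmf (answer_table G) (\<lambda>b. bind_pmf (Pi_pmf ?V [] (rep_nb G d))
      (\<lambda>A. Pi_pmf ?V [] (\<lambda>u. return_pmf (b u # A u))))"
    by (subst Pi_pmf_bind[OF assms, where d' = "[]"]) simp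
  also have "\<dots> = bind_pmf (answer_table G) (\<lambda>b. bind_pmf (Pi_pmf ?V [] (rep_nb G d))
      (\<lambda>A. return_pmf (\<lambda>u. if u \<in> ?V then b u # A u else [])))"
    by (simp add: Pi_pmf_return_pmf[OF assms])
  also have "\<dots> = map_pmf (\<lambda>bs u. if u \<in> ?V then map (\<lambda>b. b u) bs else []) (replicate_pmf (Suc d) (answer_table G))"
    unfolding Suc by (simp add: map_pmf_def bind_assoc_pmf bind_return_pmf cong: if_cong)
  finally show ?case .
qed

definition arrows :: "('a \<Rightarrow> 'a option) list \<Rightarrow> ('a \<times> 'a) set" where
  "arrows bs = {(u, w). \<exists>b\<in>set bs. b u = Some w}"

text \<open>The length of the table list limits the number of steps as well as the number of answers
  per vertex. A single number thus measures the cost of a phase, and costs of consecutive phases add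
  up.\<close>

definition reached :: "'a \<Rightarrow> ('a \<Rightarrow> 'a option) list \<Rightarrow> 'a set" where
  "reached x bs = {y. \<exists>i\<le>length bs. (x, y) \<in> arrows bs ^^ i}"

definition explored :: "'a \<Rightarrow> ('a \<Rightarrow> 'a option) list \<Rightarrow> ('a \<times> 'a) set" where
  "explored x bs = {(u, w) \<in> arrows bs. \<exists>i<length bs. (x, u) \<in> arrows bs ^^ i}"

text \<open>The invariant of breadth-first search: after \<open>j\<close> rounds every vertex that a
  walk of at most \<open>j\<close> arrows reaches is visited, those with shorter walks are finished,
  and finished vertices have all their arrows recorded.\<close>

lemma det_rounds_explored:
  assumes V: "\<forall>b\<in>set bs. \<forall>u. u \<notin> V \<longrightarrow> b u = None"
    and s: "(det_round (\<lambda>u. if u \<in> V then map (\<lambda>b. b u) bs else []) ^^ j) ({v}, {v}, {}, 0) = (W, L, E, q)"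
  shows "(\<forall>i\<le>j. \<forall>y. (v, y) \<in> arrows bs ^^ i \<longrightarrow> y \<in> W) \<and> (\<forall>i<j. \<forall>y. (v, y) \<in> arrows bs ^^ i \<longrightarrow> y \<in> W - L) \<and>
    (\<forall>u\<in>W - L. \<forall>w. (u, w) \<in> arrows bs \<longrightarrow> (u, w) \<in> E \<and> w \<in> W) \<and> E \<subseteq> W \<times> W \<and> L \<subseteq> W \<and> v \<in> W"
  using s
proof (induction j arbitrary: W L E q)
  case 0
  then show ?case by auto
next
  case (Suc j)
  let ?A = "\<lambda>u. if u \<in> V then map (\<lambda>b. b u) bs else []"
  obtain W0 L0 E0 q0 where s0: "(det_round ?A ^^ j) ({v}, {v}, {}, 0) = (W0, L0, E0, q0)"
    by (cases "(det_round ?A ^^ j) ({v}, {v}, {}, 0)") auto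
  have \<Gamma>: "{x. Some x \<in> set (?A u)} = {w. (u, w) \<in> arrows bs}" for u
  proof (cases "u \<in> V")
    case True
    have "Some x \<in> set (map (\<lambda>b. b u) bs) \<longleftrightarrow> (\<exists>b\<in>set bs. b u = Some x)" for x
      by (simp add: image_iff eq_commute[of "Some x"])
    then show ?thesis using True by (simp add: arrows_def)
  next
    case False
    then have "\<forall>b\<in>set bs. b u = None" using V by blast
    then show ?thesis using False by (auto simp: arrows_def)
  qed
  have "det_round ?A (W0, L0, E0, q0) = (W, L, E, q)" using Suc.prems s0 by simp
  then have W: "W = W0 \<union> L" "L = (\<Union>u\<in>L0. {w. (u, w) \<in> arrows bs}) - W0"
    "E = E0 \<union> Sigma L0 (\<lambda>u. {w. (u, w) \<in> arrows bs})"
    unfolding det_round_def Let_def \<Gamma> by auto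
  note IH = Suc.IH[OF s0]
  have WL: "W - L = W0" using W by auto
  have IH1: "y \<in> W0" if "i \<le> j" "(v, y) \<in> arrows bs ^^ i" for i y using IH that by blast
  have IH3: "(u, w) \<in> E0 \<and> w \<in> W0" if "u \<in> W0 - L0" "(u, w) \<in> arrows bs" for u w using IH that by blast
  have c: "(u, w) \<in> E \<and> w \<in> W" if "u \<in> W0" "(u, w) \<in> arrows bs" for u w
  proof (cases "u \<in> L0")
    case True
    then show ?thesis using that(2) W by auto
  next
    case False
    then show ?thesis using IH3[of u w] that W by auto
  qed
  have a: "y \<in> W" if "i \<le> Suc j" "(v, y) \<in> arrows bs ^^ i" for i y
  proof (cases "i = Suc j")
    case True
    then have "(v, y) \<in> arrows bs ^^ j O arrows bs" using that(2) by simp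
    then obtain u where "(v, u) \<in> arrows bs ^^ j" "(u, y) \<in> arrows bs" by blast
    then show ?thesis using IH1[of j u] c by blast
  next
    case False
    then show ?thesis using IH1[of i y] that W by auto
  qed
  have E0: "E0 \<subseteq> W0 \<times> W0" "L0 \<subseteq> W0" "v \<in> W0" using IH by auto
  have "E \<subseteq> W \<times> W"
  proof
    fix e assume "e \<in> E"
    then consider "e \<in> E0" | u w where "e = (u, w)" "u \<in> L0" "(u, w) \<in> arrows bs" using W(3) by auto
    then show "e \<in> W \<times> W"
    proof cases
      case 1
      then show ?thesis using E0 W by auto
    next
      case 2
      then show ?thesis using c[of u w] E0 W by auto
    qed
  qed
  moreover have "L \<subseteq> W" "v \<in> W" using W E0 by auto
  moreover have "\<forall>i<Suc j. \<forall>y. (v, y) \<in> arrows bs ^^ i \<longrightarrow> y \<in> W - L" unfolding WL using IH1 less_Suc_eq_le by blast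
  moreover have "\<forall>u\<in>W - L. \<forall>w. (u, w) \<in> arrows bs \<longrightarrow> (u, w) \<in> E \<and> w \<in> W" unfolding WL using c by auto
  ultimately show ?case using a by blast
qed

text \<open>The traversal is coupled with the tables. It may go deeper than \<open>d\<close> steps
  and record more, so the property \<open>Q\<close> must follow for every graph extending what the
  tables explore.\<close>

lemma traverse_prob_ge:
  assumes G: "pair_graph G" and v: "v \<in> pverts G" and "d \<le> l"
    and sound: "\<And>bs W E. P (explored v bs) (reached v bs) \<Longrightarrow> explored v bs \<subseteq> E \<Longrightarrow> reached v bs \<subseteq> W \<Longrightarrow>
      E \<subseteq> W \<times> W \<Longrightarrow> Q \<lparr>pverts = W, parcs = E \<union> E\<inverse>\<rparr>"
  shows "measure_pmf.prob (traverse G v d l) {(S, q). Q S} \<ge>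
    measure_pmf.prob (replicate_pmf d (answer_table G)) {bs. P (explored v bs) (reached v bs)}"
proof -
  interpret pair_graph G by fact
  let ?V = "pverts G"
  let ?A = "\<lambda>bs u. if u \<in> ?V then map (\<lambda>b. b u) bs else []"
  let ?f = "\<lambda>(W, L, E, q). (\<lparr>pverts = W, parcs = E \<union> E\<inverse>\<rparr>, q)"
  let ?M = "replicate_pmf d (answer_table G)"
  have "traverse_state G v d l = map_pmf (\<lambda>A. (det_round A ^^ l) ({v}, {v}, {}, 0)) (Pi_pmf ?V [] (rep_nb G d))"
    unfolding traverse_state_trav using trav_eq_det[OF G, of "{v}" "{v}" d l "{}" 0] v by simp
  also have "\<dots> = map_pmf (\<lambda>bs. (det_round (?A bs) ^^ l) ({v}, {v}, {}, 0)) ?M"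
    by (simp add: Pi_pmf_rep_nb pmf.map_comp o_def)
  finally have st: "traverse_state G v d l = map_pmf (\<lambda>bs. (det_round (?A bs) ^^ l) ({v}, {v}, {}, 0)) ?M" .
  have "measure_pmf.prob ?M {bs. P (explored v bs) (reached v bs)} \<le>
      measure_pmf.prob ?M ((\<lambda>bs. ?f ((det_round (?A bs) ^^ l) ({v}, {v}, {}, 0))) -` {(S, q). Q S})"
  proof (rule measure_pmf.finite_measure_mono_AE)
    show "AE bs in measure_pmf ?M. bs \<in> {bs. P (explored v bs) (reached v bs)} \<longrightarrow>
       bs \<in> (\<lambda>bs. ?f ((det_round (?A bs) ^^ l) ({v}, {v}, {}, 0))) -` {(S, q). Q S}"
      unfolding AE_measure_pmf_iff
    proof (intro ballI impI)
      fix bs assume bs: "bs \<in> set_pmf ?M" and P: "bs \<in> {bs. P (explored v bs) (reached v bs)}"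
      have len: "length bs \<le> l" and sup: "\<And>b. b \<in> set bs \<Longrightarrow> b \<in> set_pmf (answer_table G)"
        using bs assms(3) by (auto simp: set_replicate_pmf)
      have none: "\<forall>b\<in>set bs. \<forall>u. u \<notin> ?V \<longrightarrow> b u = None"
        using sup by (auto simp: answer_table_def set_Pi_pmf PiE_dflt_def)
      obtain W L E q where s: "(det_round (?A bs) ^^ l) ({v}, {v}, {}, 0) = (W, L, E, q)"
        by (cases "(det_round (?A bs) ^^ l) ({v}, {v}, {}, 0)") auto
      note D = det_rounds_explored[OF none s]
      have 1: "reached v bs \<subseteq> W"
      proof
        fix y assume "y \<in> reached v bs"
        then obtain i where "i \<le> length bs" "(v, y) \<in> arrows bs ^^ i" by (auto simp: reached_def)
        then show "y \<in> W" using D len by (meson order_trans)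
      qed
      have 2: "explored v bs \<subseteq> E"
      proof
        fix e assume "e \<in> explored v bs"
        then obtain u w i where e: "e = (u, w)" "(u, w) \<in> arrows bs" "i < length bs" "(v, u) \<in> arrows bs ^^ i"
          by (auto simp: explored_def)
        then have "u \<in> W - L" using D len by (meson order_less_le_trans)
        then show "e \<in> E" using D e by blast
      qed
      have "Q \<lparr>pverts = W, parcs = E \<union> E\<inverse>\<rparr>" by (rule sound[OF _ 2 1]) (use P D in auto)
      then show "bs \<in> (\<lambda>bs. ?f ((det_round (?A bs) ^^ l) ({v}, {v}, {}, 0))) -` {(S, q). Q S}"
        using s by simp
    qed
  qed simp
  also have "\<dots> = measure_pmf.prob (traverse G v d l) {(S, q). Q S}"
    unfolding traverse_def st by (simp add: vimage_def)
  finally show ?thesis .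
qed

text \<open>The geometric sum in inductive form: the slack \<open>2\<close> absorbs the start, and
  \<open>2 * d ^ j \<le> d ^ Suc j\<close> for \<open>d \<ge> 2\<close> absorbs each round.\<close>

lemma traverse_queries:
  assumes G: "pair_graph G" and v: "v \<in> pverts G" and d: "d \<ge> 2"
    and s: "(W, L, E, q) \<in> set_pmf (traverse_state G v d j)"
  shows "finite L \<and> L \<subseteq> pverts G \<and> card L \<le> d ^ j \<and> q + 2 \<le> 2 * d ^ j"
  using s
proof (induction j arbitrary: W L E q)
  case 0
  then show ?case using v by simp
next
  case (Suc j)
  interpret pair_graph G by fact
  obtain s0 where s0: "s0 \<in> set_pmf (traverse_state G v d j)" "(W, L, E, q) \<in> set_pmf (traverse_round G d s0)"
    using Suc.prems by auto
  obtain W0 L0 E0 q0 where s0': "s0 = (W0, L0, E0, q0)" by (metis prod_cases4)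
  have IH: "finite L0" "L0 \<subseteq> pverts G" "card L0 \<le> d ^ j" "q0 + 2 \<le> 2 * d ^ j" using Suc.IH s0(1) s0' by auto
  obtain A where A: "A \<in> set_pmf (Pi_pmf L0 [] (rep_nb G d))" "(W, L, E, q) = det_round A (W0, L0, E0, q0)"
    using s0(2) unfolding s0' traverse_round_det by auto
  have Au: "A u \<in> set_pmf (rep_nb G d u)" if "u \<in> L0" for u
    using A(1) that IH(1) by (auto simp: set_Pi_pmf PiE_dflt_def)
  have len: "length (A u) = d" if "u \<in> L0" for u using Au[OF that] by (auto simp: rep_nb_def set_replicate_pmf)
  let ?\<Gamma> = "\<lambda>u. {x. Some x \<in> set (A u)}"
  have \<Gamma>: "finite (?\<Gamma> u) \<and> card (?\<Gamma> u) \<le> d \<and> ?\<Gamma> u \<subseteq> pverts G" if "u \<in> L0" for u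
  proof -
    have sub: "Some ` ?\<Gamma> u \<subseteq> set (A u)" by auto
    then have "finite (Some ` ?\<Gamma> u)" using finite_subset by blast
    then have f: "finite (?\<Gamma> u)" by (simp add: finite_image_iff)
    have "card (?\<Gamma> u) = card (Some ` ?\<Gamma> u)" by (simp add: card_image)
    also have "\<dots> \<le> card (set (A u))" using sub by (intro card_mono) auto
    also have "\<dots> \<le> d" using card_length[of "A u"] len[OF that] by simp
    finally have c: "card (?\<Gamma> u) \<le> d" .
    have "?\<Gamma> u \<subseteq> pverts G"
    proof
      fix x assume "x \<in> ?\<Gamma> u"
      then have "Some x \<in> set_pmf (random_neighbor G u)"
        using Au[OF that] by (auto simp: rep_nb_def set_replicate_pmf)
      then show "x \<in> pverts G" using random_neighbor_in[of G x u] in_arcsD2 by auto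
    qed
    then show ?thesis using f c by blast
  qed
  have L: "L = (\<Union>u\<in>L0. ?\<Gamma> u) - W0" "q = q0 + (\<Sum>u\<in>L0. length (A u))"
    using A(2) by (auto simp: det_round_def Let_def)
  have finU: "finite (\<Union>u\<in>L0. ?\<Gamma> u)" using IH(1) \<Gamma> by blast
  have "card L \<le> card (\<Union>u\<in>L0. ?\<Gamma> u)" unfolding L(1) using finU by (intro card_mono) auto
  also have "\<dots> \<le> (\<Sum>u\<in>L0. card (?\<Gamma> u))" by (rule card_UN_le[OF IH(1)])
  also have "\<dots> \<le> (\<Sum>u\<in>L0. d)" using \<Gamma> by (intro sum_mono) auto
  also have "\<dots> \<le> d ^ j * d" using IH(3) by simp
  finally have cL: "card L \<le> d ^ Suc j" by (simp add: mult.commute)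
  have "(\<Sum>u\<in>L0. length (A u)) = card L0 * d" using len by simp
  also have "\<dots> \<le> d ^ j * d" using IH(3) by simp
  finally have "q \<le> q0 + d ^ j * d" using L(2) by simp
  moreover have "2 * d ^ j \<le> d ^ j * d" using mult_right_mono[OF d, of "d ^ j"] by (simp add: mult.commute)
  moreover have "2 * d ^ Suc j = d ^ j * d + d ^ j * d" by simp
  ultimately have "q + 2 \<le> 2 * d ^ Suc j" using IH(4) by linarith
  then show ?case using cL finU \<Gamma> L(1) by blast
qed

section \<open>Success probabilities of explorations\<close>

text \<open>Every entry of \<open>bs\<close> answers one query at each vertex. As the entries are independent, the phases of an
  exploration can be analysed one after the other, each with its own block of entries.\<close>

definition finds :: "'a pair_pre_digraph \<Rightarrow> nat \<Rightarrow> real \<Rightarrow> 'a \<Rightarrow> (('a \<times> 'a) set \<Rightarrow> 'a set \<Rightarrow> bool) \<Rightarrow> bool" where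
  "finds G q \<delta> x P \<longleftrightarrow>
    measure_pmf.prob (replicate_pmf q (answer_table G)) {bs. P (explored x bs) (reached x bs)} \<ge> \<delta>"

definition upclosed :: "(('a \<times> 'a) set \<Rightarrow> 'a set \<Rightarrow> bool) \<Rightarrow> bool" where
  "upclosed P \<longleftrightarrow> (\<forall>E E' Y Y'. P E Y \<longrightarrow> E \<subseteq> E' \<longrightarrow> Y \<subseteq> Y' \<longrightarrow> P E' Y')"

lemma upclosedD: "upclosed P \<Longrightarrow> P E Y \<Longrightarrow> E \<subseteq> E' \<Longrightarrow> Y \<subseteq> Y' \<Longrightarrow> P E' Y'"
  unfolding upclosed_def by blast

lemma arrows_append: "arrows (bs @ cs) = arrows bs \<union> arrows cs"
  by (auto simp: arrows_def)

lemma relpow_mono: "R \<subseteq> S \<Longrightarrow> (R :: ('a \<times> 'a) set) ^^ n \<subseteq> S ^^ n"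
  by (induction n) auto

lemma explored_append_left: "explored x bs \<subseteq> explored x (bs @ cs)"
proof
  fix e assume "e \<in> explored x bs"
  then obtain u w i where e: "e = (u, w)" "(u, w) \<in> arrows bs" "i < length bs" "(x, u) \<in> arrows bs ^^ i"
    by (auto simp: explored_def)
  then have "i < length (bs @ cs)" "(x, u) \<in> arrows (bs @ cs) ^^ i" "(u, w) \<in> arrows (bs @ cs)"
    using relpow_mono[of "arrows bs" "arrows (bs @ cs)" i] by (auto simp: arrows_append)
  then show "e \<in> explored x (bs @ cs)" using e(1) unfolding explored_def by blast
qed

lemma reached_append_left: "reached x bs \<subseteq> reached x (bs @ cs)"
proof
  fix y assume "y \<in> reached x bs"
  then obtain i where "i \<le> length bs" "(x, y) \<in> arrows bs ^^ i" by (auto simp: reached_def)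
  then have "i \<le> length (bs @ cs)" "(x, y) \<in> arrows (bs @ cs) ^^ i"
    using relpow_mono[of "arrows bs" "arrows (bs @ cs)" i] by (auto simp: arrows_append)
  then show "y \<in> reached x (bs @ cs)" unfolding reached_def by blast
qed

lemma relpow_append:
  assumes "y \<in> reached x bs" "(y, z) \<in> arrows cs ^^ j"
  shows "\<exists>i\<le>length bs + j. (x, z) \<in> arrows (bs @ cs) ^^ i"
proof -
  obtain i where i: "i \<le> length bs" "(x, y) \<in> arrows bs ^^ i" using assms(1) by (auto simp: reached_def)
  have "(x, y) \<in> arrows (bs @ cs) ^^ i" "(y, z) \<in> arrows (bs @ cs) ^^ j"
    using relpow_mono[of "arrows bs" "arrows (bs @ cs)" i] relpow_mono[of "arrows cs" "arrows (bs @ cs)" j] i assms(2)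
    by (auto simp: arrows_append)
  then have "(x, z) \<in> arrows (bs @ cs) ^^ (i + j)" by (auto simp: relpow_add)
  then show ?thesis using i(1) by (intro exI[of _ "i + j"]) simp
qed

lemma explored_append_right:
  assumes "y \<in> reached x bs"
  shows "explored y cs \<subseteq> explored x (bs @ cs)"
proof
  fix e assume "e \<in> explored y cs"
  then obtain u w j where e: "e = (u, w)" "(u, w) \<in> arrows cs" "j < length cs" "(y, u) \<in> arrows cs ^^ j"
    by (auto simp: explored_def)
  obtain i where "i \<le> length bs + j" "(x, u) \<in> arrows (bs @ cs) ^^ i" using relpow_append[OF assms e(4)] by blast
  moreover from this have "i < length (bs @ cs)" using e(3) by simp
  moreover have "(u, w) \<in> arrows (bs @ cs)" using e(2) by (simp add: arrows_append)
  ultimately show "e \<in> explored x (bs @ cs)" using e(1) unfolding explored_def by blast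
qed

lemma reached_append_right:
  assumes "y \<in> reached x bs"
  shows "reached y cs \<subseteq> reached x (bs @ cs)"
proof
  fix z assume "z \<in> reached y cs"
  then obtain j where j: "j \<le> length cs" "(y, z) \<in> arrows cs ^^ j" by (auto simp: reached_def)
  obtain i where "i \<le> length bs + j" "(x, z) \<in> arrows (bs @ cs) ^^ i" using relpow_append[OF assms j(2)] by blast
  moreover from this have "i \<le> length (bs @ cs)" using j(1) by simp
  ultimately show "z \<in> reached x (bs @ cs)" unfolding reached_def by blast
qed

lemma reached_self: "x \<in> reached x bs"
  unfolding reached_def by (auto intro!: exI[of _ 0])

lemma prob_bind_ge:
  assumes "measure_pmf.prob M A \<ge> \<delta>1" "\<And>x. x \<in> set_pmf M \<Longrightarrow> x \<in> A \<Longrightarrow> measure_pmf.prob (N x) B \<ge> \<delta>2" "\<delta>2 \<ge> 0"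
  shows "measure_pmf.prob (bind_pmf M N) B \<ge> \<delta>1 * \<delta>2"
proof -
  have "ennreal (measure_pmf.prob M A * \<delta>2) = (\<integral>\<^sup>+x. ennreal \<delta>2 * indicator A x \<partial>measure_pmf M)"
    using assms(3) by (simp add: nn_integral_cmult_indicator measure_pmf.emeasure_eq_measure ennreal_mult mult.commute)
  also have "\<dots> \<le> (\<integral>\<^sup>+x. emeasure (measure_pmf (N x)) B \<partial>measure_pmf M)"
  proof (rule nn_integral_mono_AE, unfold AE_measure_pmf_iff, intro ballI)
    fix x assume "x \<in> set_pmf M"
    then show "ennreal \<delta>2 * indicator A x \<le> emeasure (measure_pmf (N x)) B"
      using assms(2)[of x] by (auto simp: indicator_def measure_pmf.emeasure_eq_measure ennreal_leI)
  qed
  also have "\<dots> = ennreal (measure_pmf.prob (bind_pmf M N) B)"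
    by (simp flip: measure_pmf.emeasure_eq_measure)
  finally have "measure_pmf.prob M A * \<delta>2 \<le> measure_pmf.prob (bind_pmf M N) B"
    by (simp add: ennreal_le_iff)
  moreover have "\<delta>1 * \<delta>2 \<le> measure_pmf.prob M A * \<delta>2" using assms(1,3) by (rule mult_right_mono)
  ultimately show ?thesis by linarith
qed

lemma prob_replicate_append_ge:
  assumes "measure_pmf.prob (replicate_pmf q1 M) A \<ge> \<delta>1"
    and "\<And>bs. length bs = q1 \<Longrightarrow> bs \<in> A \<Longrightarrow> measure_pmf.prob (replicate_pmf q2 M) {cs. bs @ cs \<in> B} \<ge> \<delta>2" and "\<delta>2 \<ge> 0"
  shows "measure_pmf.prob (replicate_pmf (q1 + q2) M) B \<ge> \<delta>1 * \<delta>2"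
  unfolding replicate_pmf_distrib
proof (rule prob_bind_ge[OF assms(1) _ assms(3)])
  fix bs assume "bs \<in> set_pmf (replicate_pmf q1 M)" "bs \<in> A"
  then have "measure_pmf.prob (replicate_pmf q2 M) {cs. bs @ cs \<in> B} \<ge> \<delta>2"
    by (intro assms(2)) (auto simp: set_replicate_pmf)
  then show "measure_pmf.prob (bind_pmf (replicate_pmf q2 M) (\<lambda>cs. return_pmf (bs @ cs))) B \<ge> \<delta>2"
    by (simp add: vimage_def flip: map_pmf_def)
qed

lemma finds_weaken:
  assumes "finds G q \<delta> x P" "\<And>E Y. P E Y \<Longrightarrow> Q E Y" "\<delta>' \<le> \<delta>"
  shows "finds G q \<delta>' x Q"
proof -
  have "measure_pmf.prob (replicate_pmf q (answer_table G)) {bs. P (explored x bs) (reached x bs)} \<le>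
      measure_pmf.prob (replicate_pmf q (answer_table G)) {bs. Q (explored x bs) (reached x bs)}"
    using assms(2) by (intro measure_pmf.finite_measure_mono) auto
  then show ?thesis using assms(1,3) unfolding finds_def by linarith
qed

text \<open>The first block of tables leads to a vertex \<open>y\<close>; the second block is fresh,
  so exploring from \<open>y\<close> is independent of how \<open>y\<close> was reached.\<close>

lemma finds_chain:
  assumes 1: "finds G q1 \<delta>1 x (\<lambda>E Y. \<exists>y\<in>Y. C y)"
    and 2: "\<And>y. C y \<Longrightarrow> finds G q2 \<delta>2 y P" and "\<delta>2 \<ge> 0" "upclosed P"
  shows "finds G (q1 + q2) (\<delta>1 * \<delta>2) x P"
  unfolding finds_def
proof (rule prob_replicate_append_ge[OF 1[unfolded finds_def] _ assms(3)])
  fix bs :: "('a \<Rightarrow> 'a option) list" assume "bs \<in> {bs. \<exists>y\<in>reached x bs. C y}"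
  then obtain y where y: "y \<in> reached x bs" "C y" by blast
  have "\<delta>2 \<le> measure_pmf.prob (replicate_pmf q2 (answer_table G)) {cs. P (explored y cs) (reached y cs)}"
    using 2[OF y(2)] by (simp add: finds_def)
  also have "\<dots> \<le> measure_pmf.prob (replicate_pmf q2 (answer_table G)) {cs. bs @ cs \<in> {bs. P (explored x bs) (reached x bs)}}"
    using upclosedD[OF assms(4)] explored_append_right[OF y(1)] reached_append_right[OF y(1)]
    by (intro measure_pmf.finite_measure_mono) auto
  finally show "\<delta>2 \<le> measure_pmf.prob (replicate_pmf q2 (answer_table G)) {cs. bs @ cs \<in> {bs. P (explored x bs) (reached x bs)}}" .
qed

text \<open>The exploration restarts at \<open>x\<close> with fresh tables. Monotonicity preserves
  what the first block has established.\<close>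

lemma finds_conj:
  assumes 1: "finds G q1 \<delta>1 x P" and 2: "finds G q2 \<delta>2 x Q" and "\<delta>2 \<ge> 0" "upclosed P" "upclosed Q"
  shows "finds G (q1 + q2) (\<delta>1 * \<delta>2) x (\<lambda>E Y. P E Y \<and> Q E Y)"
  unfolding finds_def
proof (rule prob_replicate_append_ge[OF 1[unfolded finds_def] _ assms(3)])
  fix bs :: "('a \<Rightarrow> 'a option) list" assume bs: "bs \<in> {bs. P (explored x bs) (reached x bs)}"
  have "\<delta>2 \<le> measure_pmf.prob (replicate_pmf q2 (answer_table G)) {cs. Q (explored x cs) (reached x cs)}"
    using 2 by (simp add: finds_def)
  also have "\<dots> \<le> measure_pmf.prob (replicate_pmf q2 (answer_table G))
      {cs. bs @ cs \<in> {bs. P (explored x bs) (reached x bs) \<and> Q (explored x bs) (reached x bs)}}"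
  proof (rule measure_pmf.finite_measure_mono, rule subsetI)
    fix cs assume "cs \<in> {cs. Q (explored x cs) (reached x cs)}"
    then have "Q (explored x (bs @ cs)) (reached x (bs @ cs))"
      using upclosedD[OF assms(5) _ explored_append_right[OF reached_self] reached_append_right[OF reached_self]] by simp
    moreover have "P (explored x (bs @ cs)) (reached x (bs @ cs))"
      using upclosedD[OF assms(4) _ explored_append_left reached_append_left] bs by simp
    ultimately show "cs \<in> {cs. bs @ cs \<in> {bs. P (explored x bs) (reached x bs) \<and> Q (explored x bs) (reached x bs)}}"
      by simp
  qed simp
  finally show "\<delta>2 \<le> measure_pmf.prob (replicate_pmf q2 (answer_table G))
      {cs. bs @ cs \<in> {bs. P (explored x bs) (reached x bs) \<and> Q (explored x bs) (reached x bs)}}" .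
qed

lemma finds_True: "finds G 0 1 x (\<lambda>E Y. True)"
  by (simp add: finds_def)

lemma finds_more:
  assumes "finds G q \<delta> x P" "upclosed P" "q \<le> q'"
  shows "finds G q' \<delta> x P"
proof -
  have "finds G (q' - q) 1 x (\<lambda>E Y. True)" by (simp add: finds_def)
  from finds_conj[OF assms(1) this] assms(2,3) show ?thesis by (simp add: upclosed_def)
qed

lemma finds_Ball:
  assumes "finite I" "\<And>i. i \<in> I \<Longrightarrow> finds G q \<delta> x (P i)" "\<And>i. i \<in> I \<Longrightarrow> upclosed (P i)" "\<delta> \<ge> 0"
  shows "finds G (card I * q) (\<delta> ^ card I) x (\<lambda>E Y. \<forall>i\<in>I. P i E Y)"
  using assms(1-3)
proof (induction I rule: finite_induct)
  case empty
  then show ?case using finds_True by simp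
next
  case (insert i I)
  have "finds G (q + card I * q) (\<delta> * \<delta> ^ card I) x (\<lambda>E Y. P i E Y \<and> (\<forall>i\<in>I. P i E Y))"
  proof (rule finds_conj)
    show "upclosed (\<lambda>E Y. \<forall>i\<in>I. P i E Y)" using insert.prems(2) unfolding upclosed_def by blast
    show "finds G (card I * q) (\<delta> ^ card I) x (\<lambda>E Y. \<forall>i\<in>I. P i E Y)" using insert by blast
  qed (use insert assms(4) in auto)
  then show ?case using insert by simp
qed

lemma finds_step:
  assumes "pair_graph G" "x \<in> pverts G" "S \<subseteq> parcs G `` {x}" "S \<noteq> {}"
    and "real (card S) \<ge> \<alpha> * real (card (parcs G `` {x}))"
  shows "finds G 1 \<alpha> x (\<lambda>E Y. \<exists>y\<in>S. y \<in> Y \<and> (x, y) \<in> E)"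
proof -
  interpret pair_graph G by fact
  let ?N = "parcs G `` {x}"
  have fin: "finite ?N" by simp
  have ne: "?N \<noteq> {}" using assms(3,4) by blast
  have "{b. \<exists>y\<in>S. b x = Some y} \<subseteq> {b. \<exists>y\<in>S. y \<in> reached x [b] \<and> (x, y) \<in> explored x [b]}"
  proof
    fix b assume "b \<in> {b. \<exists>y\<in>S. b x = Some y}"
    then obtain y where y: "y \<in> S" "b x = Some y" by blast
    then have a: "(x, y) \<in> arrows [b]" by (simp add: arrows_def)
    have "(x, y) \<in> explored x [b]" using a unfolding explored_def by (auto intro!: exI[of _ 0])
    moreover have "y \<in> reached x [b]" using a unfolding reached_def by (auto intro!: exI[of _ 1])
    ultimately show "b \<in> {b. \<exists>y\<in>S. y \<in> reached x [b] \<and> (x, y) \<in> explored x [b]}" using y by blast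
  qed
  then have le: "measure_pmf.prob (answer_table G) {b. \<exists>y\<in>S. b x = Some y} \<le>
      measure_pmf.prob (answer_table G) {b. \<exists>y\<in>S. y \<in> reached x [b] \<and> (x, y) \<in> explored x [b]}"
    by (intro measure_pmf.finite_measure_mono) auto
  have "measure_pmf.prob (answer_table G) {b. \<exists>y\<in>S. b x = Some y} =
      measure_pmf.prob (map_pmf (\<lambda>b. b x) (answer_table G)) (Some ` S)"
    by (simp add: vimage_def image_iff)
  also have "map_pmf (\<lambda>b. b x) (answer_table G) = map_pmf Some (pmf_of_set ?N)"
    unfolding answer_table_def using assms(2) ne by (simp add: Pi_pmf_component random_neighbor_def)
  also have "measure_pmf.prob (map_pmf Some (pmf_of_set ?N)) (Some ` S) = measure_pmf.prob (pmf_of_set ?N) S"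
    by (simp add: inj_vimage_image_eq)
  also have "\<dots> = real (card S) / real (card ?N)"
    using assms(3) by (simp add: measure_pmf_of_set[OF ne fin] Int_absorb1)
  also have "\<dots> \<ge> \<alpha>"
    using assms(5) ne fin by (simp add: pos_le_divide_eq card_gt_0_iff)
  finally have "\<alpha> \<le> measure_pmf.prob (answer_table G) {b. \<exists>y\<in>S. y \<in> reached x [b] \<and> (x, y) \<in> explored x [b]}"
    using le by linarith
  then show ?thesis unfolding finds_def replicate_pmf_1 by (simp add: vimage_def)
qed

section \<open>Exploring a forest of copies\<close>

lemma anc_linear: "anc p i a \<Longrightarrow> anc p i b \<Longrightarrow> anc p a b \<or> anc p b a"
proof -
  assume "anc p i a" "anc p i b"
  then obtain m n where mn: "(p ^^ m) i = a" "(p ^^ n) i = b" by (auto simp: anc_def)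
  show ?thesis
  proof (cases "m \<le> n")
    case True
    then have "(p ^^ (n - m)) a = b" using mn by (metis comp_apply funpow_add le_add_diff_inverse2)
    then show ?thesis by (auto simp: anc_def)
  next
    case False
    then have "(p ^^ (m - n)) b = a" using mn by (metis comp_apply funpow_add le_add_diff_inverse2 nat_le_linear)
    then show ?thesis by (auto simp: anc_def)
  qed
qed

lemma anc_fixed: "p i = i \<Longrightarrow> anc p i a \<Longrightarrow> a = i"
proof -
  assume "p i = i" "anc p i a"
  then obtain n where "(p ^^ n) i = a" by (auto simp: anc_def)
  moreover have "(p ^^ n) i = i" using \<open>p i = i\<close> by (induction n) auto
  ultimately show ?thesis by simp
qed

text \<open>The head of a recorded arrow is also a reached vertex, so a goal about recorded edges
  may be traded for one about positions.\<close>

lemma finds_heads: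
  assumes "finds G q \<delta> x P" "\<And>E Y. P E Y \<Longrightarrow> snd ` E \<subseteq> Y \<Longrightarrow> Q E Y"
  shows "finds G q \<delta> x Q"
proof -
  have h: "snd ` explored x bs \<subseteq> reached x bs" for bs
  proof
    fix w assume "w \<in> snd ` explored x bs"
    then obtain u i where u: "(u, w) \<in> arrows bs" "i < length bs" "(x, u) \<in> arrows bs ^^ i" by (auto simp: explored_def)
    then have "(x, w) \<in> arrows bs ^^ Suc i" by auto
    then show "w \<in> reached x bs" using u(2) unfolding reached_def by (auto intro!: exI[of _ "Suc i"])
  qed
  have "measure_pmf.prob (replicate_pmf q (answer_table G)) {bs. P (explored x bs) (reached x bs)} \<le>
      measure_pmf.prob (replicate_pmf q (answer_table G)) {bs. Q (explored x bs) (reached x bs)}"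
    using assms(2) h by (intro measure_pmf.finite_measure_mono) auto
  then show ?thesis using assms(1) unfolding finds_def by linarith
qed

text \<open>The argument \<open>n\<close> counts levels still to be explored. The first
  \<open>h\<close> tables serve the upward edges. Each of up to \<open>h\<close> children then costs
  one step into its subtree, up to \<open>h\<close> climbs to its top, and one exploration from
  there. The function \<open>success\<close> multiplies the probabilities of the same
  phases.\<close>

fun budget :: "nat \<Rightarrow> nat \<Rightarrow> nat" where
  "budget h 0 = 0"
| "budget h (Suc n) = h + h * (1 + (h * budget h n + budget h n))"

fun success :: "real \<Rightarrow> nat \<Rightarrow> nat \<Rightarrow> real" where
  "success \<alpha> h 0 = 1"
| "success \<alpha> h (Suc n) = \<alpha> ^ h * (\<alpha> * (success \<alpha> h n ^ h * success \<alpha> h n)) ^ h"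

lemma success_bounds: "0 < \<alpha> \<Longrightarrow> \<alpha> \<le> 1 \<Longrightarrow> 0 < success \<alpha> h n \<and> success \<alpha> h n \<le> 1"
proof (induction n)
  case (Suc n)
  then show ?case by (auto intro!: mult_le_one power_le_one)
qed simp

text \<open>The assumption \<open>det\<close> allows recombination, \<open>down\<close> gives every
  subtree an edge to the parent of its top, \<open>dense\<close> says that a constant fraction of
  the degree at a vertex is matched by the copies using it in the same role, and
  \<open>disjoint\<close> is edge-disjointness of the copies, with roles respected.\<close>

locale copy_forest =
  fixes G :: "'a pair_pre_digraph" and A :: "('h \<times> 'h) set" and R :: "'h set" and F :: "('h \<Rightarrow> 'a) set"
    and p :: "'h \<Rightarrow> 'h" and r :: 'h and dep :: "'h \<Rightarrow> nat" and \<alpha> :: real and h :: nat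
  assumes G: "pair_graph G" and finF: "finite F" and finR: "finite R" "card R \<le> h"
    and tree: "rooted_tree R p r dep" and AR: "A \<subseteq> R \<times> R" and symA: "sym A"
    and comparable: "\<And>i j. (i, j) \<in> A \<Longrightarrow> anc p i j \<or> anc p j i"
    and down: "\<And>k. k \<in> R \<Longrightarrow> k \<noteq> r \<Longrightarrow> \<exists>j\<in>R. anc p j k \<and> (j, p k) \<in> A"
    and edges: "\<And>\<phi> i j. \<phi> \<in> F \<Longrightarrow> (i, j) \<in> A \<Longrightarrow> (\<phi> i, \<phi> j) \<in> parcs G"
    and det: "\<And>\<phi> \<psi> k. \<phi> \<in> F \<Longrightarrow> \<psi> \<in> F \<Longrightarrow> k \<in> R \<Longrightarrow> \<phi> k = \<psi> k \<Longrightarrow> \<phi> (p k) = \<psi> (p k)"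
    and dense: "\<And>\<phi> i. \<phi> \<in> F \<Longrightarrow> i \<in> R \<Longrightarrow> \<alpha> * real (card (parcs G `` {\<phi> i})) \<le> real (card {\<psi> \<in> F. \<psi> i = \<phi> i})"
    and disjoint: "\<And>\<phi> \<psi> i j. \<phi> \<in> F \<Longrightarrow> \<psi> \<in> F \<Longrightarrow> (i, j) \<in> A \<Longrightarrow> \<phi> i = \<psi> i \<Longrightarrow> \<phi> j = \<psi> j \<Longrightarrow> \<phi> = \<psi>"
    and \<alpha>: "0 < \<alpha>" "\<alpha> \<le> 1"
begin

lemma det_anc:
  assumes "\<phi> \<in> F" "\<psi> \<in> F" "k \<in> R" "\<phi> k = \<psi> k" "anc p k a"
  shows "\<phi> a = \<psi> a"
proof -
  obtain n where "(p ^^ n) k = a" using assms(5) by (auto simp: anc_def)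
  then show ?thesis
  proof (induction n arbitrary: a)
    case (Suc n)
    let ?b = "(p ^^ n) k"
    have "\<phi> ?b = \<psi> ?b" using Suc.IH by blast
    then have "\<phi> (p ?b) = \<psi> (p ?b)" using det assms funpow_in[OF tree assms(3)] by blast
    then show ?case using Suc.prems by simp
  qed (use assms in simp)
qed

text \<open>Edge-disjoint copies with the same image of \<open>m\<close> have different images of
  \<open>j\<close>. So there are as many useful neighbours as such copies, and density makes these a
  fraction \<alpha> of all neighbours.\<close>

lemma finds_neighbor:
  assumes "\<phi> \<in> F" "(m, j) \<in> A"
  shows "finds G 1 \<alpha> (\<phi> m) (\<lambda>E Y. \<exists>\<psi>\<in>F. \<psi> m = \<phi> m \<and> \<psi> j \<in> Y \<and> (\<phi> m, \<psi> j) \<in> E)"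
proof -
  interpret pair_graph G by (rule G)
  let ?S = "(\<lambda>\<psi>. \<psi> j) ` {\<psi> \<in> F. \<psi> m = \<phi> m}"
  have "inj_on (\<lambda>\<psi>. \<psi> j) {\<psi> \<in> F. \<psi> m = \<phi> m}"
    by (rule inj_onI) (use disjoint[OF _ _ assms(2)] in auto)
  then have c: "card ?S = card {\<psi> \<in> F. \<psi> m = \<phi> m}" by (rule card_image)
  have "finds G 1 \<alpha> (\<phi> m) (\<lambda>E Y. \<exists>y\<in>?S. y \<in> Y \<and> (\<phi> m, y) \<in> E)"
  proof (rule finds_step[OF G])
    show "\<phi> m \<in> pverts G" using edges[OF assms] by (rule in_arcsD1)
    have "(\<phi> m, \<psi> j) \<in> parcs G" if "\<psi> \<in> F" "\<psi> m = \<phi> m" for \<psi> using edges[OF that(1) assms(2)] that(2) by simp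
    then show "?S \<subseteq> parcs G `` {\<phi> m}" by auto
    show "?S \<noteq> {}" using assms(1) by blast
    show "\<alpha> * real (card (parcs G `` {\<phi> m})) \<le> real (card ?S)"
      unfolding c using dense[OF assms(1)] assms(2) AR by blast
  qed
  then show ?thesis by (rule finds_weaken) auto
qed

section \<open>Recombined subtrees\<close>

definition sub :: "'h \<Rightarrow> 'h set" where "sub m = {i \<in> R. anc p i m}"

text \<open>Every \<open>i\<close> in the subtree has its own copy \<open>w i\<close>, and its image
  is \<open>w i i\<close>. Adjacent levels agree on the image of the parent. Only edges from
  \<open>i\<close> up to ancestors are demanded, including ancestors above \<open>m\<close>, whose
  images are read off \<open>w i\<close>.\<close>

definition found :: "'h \<Rightarrow> 'a \<Rightarrow> ('a \<times> 'a) set \<Rightarrow> bool" where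
  "found m x E \<longleftrightarrow> (\<exists>w. (\<forall>i\<in>sub m. w i \<in> F) \<and> w m m = x \<and> (\<forall>i\<in>sub m - {m}. w i (p i) = w (p i) (p i)) \<and>
     (\<forall>i\<in>sub m. \<forall>a. (i, a) \<in> A \<and> anc p i a \<longrightarrow> (w i i, w i a) \<in> E))"

lemma found_mono: "found m x E \<Longrightarrow> E \<subseteq> E' \<Longrightarrow> found m x E'"
proof -
  assume "found m x E" and E': "E \<subseteq> E'"
  then obtain w where w: "(\<forall>i\<in>sub m. w i \<in> F) \<and> w m m = x \<and> (\<forall>i\<in>sub m - {m}. w i (p i) = w (p i) (p i)) \<and>
     (\<forall>i\<in>sub m. \<forall>a. (i, a) \<in> A \<and> anc p i a \<longrightarrow> (w i i, w i a) \<in> E)" unfolding found_def by (elim exE)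
  have "\<forall>i\<in>sub m. \<forall>a. (i, a) \<in> A \<and> anc p i a \<longrightarrow> (w i i, w i a) \<in> E'" using w E' by blast
  then show ?thesis unfolding found_def using w by (intro exI[of _ w]) simp
qed

lemma parent_sub:
  assumes "i \<in> sub m" "i \<noteq> m"
  shows "p i \<in> sub m" "dep (p i) < dep i"
proof -
  have i: "i \<in> R" "anc p i m" using assms(1) by (auto simp: sub_def)
  then have "anc p (p i) m" using anc_cases[of p i m] assms(2) by auto
  moreover have "p i \<in> R" using tree i(1) by (auto simp: rooted_tree_def)
  ultimately show "p i \<in> sub m" by (simp add: sub_def)
  have "p i \<noteq> i" using anc_fixed[of p i m] i(2) assms(2) by auto
  then show "dep (p i) < dep i" using parent_dep_le[OF tree i(1)] by auto
qed

text \<open>Agreement with the parent spreads upwards, because a copy's image of a vertex determines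
  its images of all ancestors. Inside the subtree the upper end \<open>w i a\<close> of a recorded
  edge is therefore the recombined image of \<open>a\<close>.\<close>

lemma witness_agrees:
  assumes "\<forall>i\<in>sub m. w i \<in> F" "\<forall>i\<in>sub m - {m}. w i (p i) = w (p i) (p i)" "i \<in> sub m" "anc p i a" "a \<in> sub m"
  shows "w i a = w a a"
  using assms(3,4)
proof (induction "dep i" arbitrary: i rule: less_induct)
  case less
  show ?case
  proof (cases "i = a")
    case False
    then have pa: "anc p (p i) a" using anc_cases less.prems(2) by metis
    have im: "i \<noteq> m"
    proof
      assume "i = m"
      then have "anc p a m" "anc p m a" using assms(5) less.prems by (auto simp: sub_def)
      then have "dep a < dep m" "dep m < dep a"
        using anc_dep[OF tree] less.prems assms(5) False \<open>i = m\<close> by (auto simp: sub_def)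
      then show False by simp
    qed
    note ps = parent_sub[OF less.prems(1) im]
    have "w (p i) a = w a a" by (rule less.hyps[OF ps(2) ps(1) pa])
    moreover have "w i a = w (p i) a"
      by (rule det_anc[of _ _ "p i"]) (use assms(1,2) less.prems ps(1) im pa in \<open>auto simp: sub_def\<close>)
    ultimately show ?thesis by simp
  qed simp
qed

definition children :: "'h \<Rightarrow> 'h set" where "children m = {k \<in> R. p k = m \<and> k \<noteq> m}"

lemma child_dep: "k \<in> children m \<Longrightarrow> dep m < dep k \<and> k \<noteq> r"
  using tree unfolding children_def rooted_tree_def by auto

lemma in_child_sub:
  assumes "i \<in> sub m" "i \<noteq> m"
  shows "\<exists>k\<in>children m. i \<in> sub k"
  using assms
proof (induction "dep i" arbitrary: i rule: less_induct)
  case less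
  show ?case
  proof (cases "p i = m")
    case True
    then show ?thesis using less.prems by (auto simp: children_def sub_def)
  next
    case False
    note ps = parent_sub[OF less.prems]
    obtain k where "k \<in> children m" "p i \<in> sub k" using less.hyps[OF ps(2) ps(1) False] by blast
    then show ?thesis using less.prems by (auto simp: sub_def intro: anc_step)
  qed
qed

lemma child_unique:
  assumes "k \<in> children m" "l \<in> children m" "i \<in> sub k" "i \<in> sub l"
  shows "k = l"
proof -
  have *: "k = l" if "k \<in> children m" "l \<in> children m" "anc p k l" for k l
  proof (rule ccontr)
    assume "k \<noteq> l"
    then have "anc p m l" using anc_cases[OF that(3)] that(1) by (auto simp: children_def)
    moreover have "m \<in> R" using that(1) tree by (auto simp: children_def rooted_tree_def)
    ultimately have "l = m \<or> dep l < dep m" using anc_dep[OF tree] by blast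
    then show False using child_dep[OF that(2)] that(2) by (auto simp: children_def)
  qed
  have "anc p k l \<or> anc p l k" using assms anc_linear[of p i k l] by (simp add: sub_def)
  then show ?thesis using *[OF assms(1,2)] *[OF assms(2,1)] by auto
qed

text \<open>The subtrees below different children may come from different copies, but all of these
  agree with \<open>\<phi>\<close> at \<open>m\<close>. The subtrees are disjoint, so their
  witnesses can be put side by side.\<close>

lemma found_merge:
  assumes \<phi>: "\<phi> \<in> F" and m: "m \<in> R" and up: "\<forall>a\<in>{a. (m, a) \<in> A \<and> anc p m a}. (\<phi> m, \<phi> a) \<in> E"
    and ch: "\<forall>k\<in>children m. \<exists>\<psi>\<in>F. \<psi> m = \<phi> m \<and> found k (\<psi> k) E"
  shows "found m (\<phi> m) E"
proof -
  have "\<forall>k. \<exists>w. k \<in> children m \<longrightarrow> (\<forall>i\<in>sub k. w i \<in> F) \<and> w k m = \<phi> m \<and> (\<forall>i\<in>sub k - {k}. w i (p i) = w (p i) (p i)) \<and>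
     (\<forall>i\<in>sub k. \<forall>a. (i, a) \<in> A \<and> anc p i a \<longrightarrow> (w i i, w i a) \<in> E)"
  proof
    fix k
    show "\<exists>w. k \<in> children m \<longrightarrow> (\<forall>i\<in>sub k. w i \<in> F) \<and> w k m = \<phi> m \<and> (\<forall>i\<in>sub k - {k}. w i (p i) = w (p i) (p i)) \<and>
     (\<forall>i\<in>sub k. \<forall>a. (i, a) \<in> A \<and> anc p i a \<longrightarrow> (w i i, w i a) \<in> E)"
    proof (cases "k \<in> children m")
      case True
      then obtain \<psi> where \<psi>: "\<psi> \<in> F" "\<psi> m = \<phi> m" "found k (\<psi> k) E" using ch by blast
      then obtain w where w: "(\<forall>i\<in>sub k. w i \<in> F) \<and> w k k = \<psi> k \<and> (\<forall>i\<in>sub k - {k}. w i (p i) = w (p i) (p i)) \<and>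
         (\<forall>i\<in>sub k. \<forall>a. (i, a) \<in> A \<and> anc p i a \<longrightarrow> (w i i, w i a) \<in> E)" unfolding found_def by (elim exE)
      have k: "k \<in> R" "p k = m" using True by (auto simp: children_def)
      then have "w k \<in> F" using w by (simp add: sub_def)
      \<comment> \<open>The witness copy at \<open>k\<close> coincides with \<open>\<psi>\<close> at
        \<open>k\<close>, hence also at the parent \<open>m\<close>.\<close>
      then have "w k m = \<psi> m" using det[of "w k" \<psi> k] \<psi>(1) k w by simp
      then show ?thesis using w \<psi>(2) by (intro exI[of _ w]) simp
    qed simp
  qed
  from choice[OF this] obtain W where W: "\<forall>k. k \<in> children m \<longrightarrow> (\<forall>i\<in>sub k. W k i \<in> F) \<and> W k k m = \<phi> m \<and>
     (\<forall>i\<in>sub k - {k}. W k i (p i) = W k (p i) (p i)) \<and>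
     (\<forall>i\<in>sub k. \<forall>a. (i, a) \<in> A \<and> anc p i a \<longrightarrow> (W k i i, W k i a) \<in> E)" by (elim exE)
  define c where "c i = (SOME k. k \<in> children m \<and> i \<in> sub k)" for i
  have c: "c i \<in> children m \<and> i \<in> sub (c i)" if "i \<in> sub m" "i \<noteq> m" for i
    unfolding c_def by (rule someI_ex) (use in_child_sub[OF that] in blast)
  define w where "w i = (if i = m then \<phi> else W (c i) i)" for i
  have wi: "w i \<in> F" "\<And>a. (i, a) \<in> A \<Longrightarrow> anc p i a \<Longrightarrow> (w i i, w i a) \<in> E" if "i \<in> sub m" for i
  proof -
    have "w i \<in> F \<and> (\<forall>a. (i, a) \<in> A \<longrightarrow> anc p i a \<longrightarrow> (w i i, w i a) \<in> E)"
    proof (cases "i = m")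
      case True
      then show ?thesis using \<phi> up by (simp add: w_def)
    next
      case False
      then show ?thesis using c[OF that False] W unfolding w_def by simp
    qed
    then show "w i \<in> F" "\<And>a. (i, a) \<in> A \<Longrightarrow> anc p i a \<Longrightarrow> (w i i, w i a) \<in> E" by blast+
  qed
  have wc: "w i (p i) = w (p i) (p i)" if i: "i \<in> sub m" "i \<noteq> m" for i
  proof -
    let ?k = "c i"
    note ck = c[OF i]
    have pk: "p ?k = m" "?k \<noteq> m" using ck by (auto simp: children_def)
    show ?thesis
    proof (cases "i = ?k")
      case True
      then have "p i = m" using pk by simp
      moreover have "w i = W ?k ?k" using i(2) True by (simp add: w_def)
      ultimately show ?thesis using W ck by (simp add: w_def)
    next
      case False
      note ps = parent_sub[OF conjunct2[OF ck] False]
      have pm: "p i \<noteq> m"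
      proof
        assume "p i = m"
        then have "anc p m ?k" "m \<in> R" using ps by (auto simp: sub_def)
        then have "?k = m \<or> dep ?k < dep m" using anc_dep[OF tree] by blast
        then show False using child_dep[of ?k m] ck pk by auto
      qed
      have pim: "p i \<in> sub m" using parent_sub[OF i] by simp
      have "c (p i) = ?k" using child_unique[of "c (p i)" m ?k "p i"] c[OF pim pm] ck ps(1) by blast
      then show ?thesis using W ck False i(2) pm by (simp add: w_def)
    qed
  qed
  have "w m m = \<phi> m" by (simp add: w_def)
  then show ?thesis unfolding found_def using wi wc by (intro exI[of _ w]) simp
qed

text \<open>Some \<open>j\<close> in the subtree is adjacent in \<open>H\<close> to the parent of
  \<open>m\<close>, and the corresponding upward edge is among the recorded ones. Its head is the
  image that \<open>\<phi> m\<close> determines.\<close>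

lemma found_parent:
  assumes "\<phi> \<in> F" "m \<in> R" "found m (\<phi> m) E" "m \<noteq> r"
  shows "\<phi> (p m) \<in> snd ` E"
proof -
  obtain w where w: "(\<forall>i\<in>sub m. w i \<in> F) \<and> w m m = \<phi> m \<and> (\<forall>i\<in>sub m - {m}. w i (p i) = w (p i) (p i)) \<and>
     (\<forall>i\<in>sub m. \<forall>a. (i, a) \<in> A \<and> anc p i a \<longrightarrow> (w i i, w i a) \<in> E)"
    using assms(3) unfolding found_def by (elim exE)
  obtain j where j: "j \<in> R" "anc p j m" "(j, p m) \<in> A" using down[OF assms(2,4)] by blast
  have js: "j \<in> sub m" "m \<in> sub m" using j assms(2) by (auto simp: sub_def)
  have "w j m = w m m" by (rule witness_agrees[of m]) (use w js j in auto)
  then have "w j m = \<phi> m" using w by simp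
  then have "w j (p m) = \<phi> (p m)" using det[of "w j" \<phi> m] w js assms by blast
  moreover have "(w j j, w j (p m)) \<in> E" using w js j anc_parent[OF j(2)] by blast
  ultimately show ?thesis by (metis imageI snd_conv)
qed

text \<open>One block of tables is spent per level. The number of levels is at most
  \<open>dep j\<close>, hence at most \<open>h\<close>.\<close>

lemma finds_climb:
  assumes B: "\<And>i \<phi>. i \<in> sub k \<Longrightarrow> \<phi> \<in> F \<Longrightarrow> finds G q \<delta> (\<phi> i) (\<lambda>E Y. \<phi> (p i) \<in> Y)"
    and \<delta>: "0 < \<delta>" "\<delta> \<le> 1" and \<phi>: "\<phi> \<in> F" and j: "j \<in> sub k"
  shows "finds G (h * q) (\<delta> ^ h) (\<phi> j) (\<lambda>E Y. \<phi> k \<in> Y)"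
proof -
  have up: "upclosed (\<lambda>E Y. \<phi> k \<in> Y)" by (auto simp: upclosed_def)
  have "finds G (dep j * q) (\<delta> ^ dep j) (\<phi> j) (\<lambda>E Y. \<phi> k \<in> Y)"
    using j
  proof (induction "dep j" arbitrary: j rule: less_induct)
    case less
    show ?case
    proof (cases "j = k")
      case True
      have f0: "finds G 0 1 (\<phi> j) (\<lambda>E Y. \<phi> k \<in> Y)" using True by (simp add: finds_def reached_self)
      have "finds G (dep j * q) 1 (\<phi> j) (\<lambda>E Y. \<phi> k \<in> Y)" by (rule finds_more[OF f0 up]) simp
      then show ?thesis by (rule finds_weaken) (use \<delta> in \<open>auto intro: power_le_one\<close>)
    next
      case False
      note ps = parent_sub[OF less.prems False]
      have "finds G (q + dep (p j) * q) (\<delta> * \<delta> ^ dep (p j)) (\<phi> j) (\<lambda>E Y. \<phi> k \<in> Y)"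
      proof (rule finds_chain[where C = "\<lambda>y. y = \<phi> (p j)"])
        show "finds G q \<delta> (\<phi> j) (\<lambda>E Y. \<exists>y\<in>Y. y = \<phi> (p j))" using B[OF less.prems \<phi>] by simp
        show "\<And>y. y = \<phi> (p j) \<Longrightarrow> finds G (dep (p j) * q) (\<delta> ^ dep (p j)) y (\<lambda>E Y. \<phi> k \<in> Y)"
          using less.hyps[OF ps(2) ps(1)] by simp
      qed (use \<delta> up in auto)
      then have "finds G (dep j * q) (\<delta> * \<delta> ^ dep (p j)) (\<phi> j) (\<lambda>E Y. \<phi> k \<in> Y)"
      proof (rule finds_more[OF _ up])
        have "Suc (dep (p j)) * q \<le> dep j * q" using ps(2) by (intro mult_right_mono) auto
        then show "q + dep (p j) * q \<le> dep j * q" by simp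
      qed
      then show ?thesis
      proof (rule finds_weaken)
        show "\<delta> ^ dep j \<le> \<delta> * \<delta> ^ dep (p j)"
          using power_decreasing[of "Suc (dep (p j))" "dep j" \<delta>] ps(2) \<delta> by simp
      qed
    qed
  qed
  note climbed = this
  have d: "dep j \<le> h" using tree j finR(2) unfolding rooted_tree_def sub_def by fastforce
  from finds_more[OF climbed up] d have "finds G (h * q) (\<delta> ^ dep j) (\<phi> j) (\<lambda>E Y. \<phi> k \<in> Y)" by simp
  then show ?thesis
  proof (rule finds_weaken)
    show "\<delta> ^ h \<le> \<delta> ^ dep j" by (rule power_decreasing[OF d]) (use \<delta> in auto)
  qed
qed

text \<open>Having found the subtree means having met the image of the parent. At the root the
  parent is the root itself and is reached without a step.\<close>

lemma finds_parent:
  assumes "\<phi> \<in> F" "m \<in> R" "finds G q \<delta> (\<phi> m) (\<lambda>E Y. found m (\<phi> m) E)"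
  shows "finds G q \<delta> (\<phi> m) (\<lambda>E Y. \<phi> (p m) \<in> Y)"
proof (cases "m = r")
  case True
  have pr: "p r = r" using tree by (simp add: rooted_tree_def)
  have "\<delta> \<le> 1" using assms(3) unfolding finds_def by (meson measure_pmf.prob_le_1 order_trans)
  then show ?thesis using True by (simp add: finds_def reached_self pr)
next
  case False
  show ?thesis
    by (rule finds_heads[OF assms(3)]) (use found_parent[OF assms(1,2) _ False] in blast)
qed

text \<open>Induction on the number \<open>n\<close> of levels that may remain below
  \<open>m\<close>. Upward edges are hit directly from the image of \<open>m\<close>; each child
  subtree is entered from below, since the child itself need not be adjacent to
  \<open>m\<close>.\<close>

lemma finds_sub:
  assumes "m \<in> R" "h \<le> dep m + n" "\<phi> \<in> F"
  shows "finds G (budget h n) (success \<alpha> h n) (\<phi> m) (\<lambda>E Y. found m (\<phi> m) E)"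
  using assms
proof (induction n arbitrary: m \<phi>)
  case 0
  \<comment> \<open>With no level left the hypothesis \<open>h \<le> dep m\<close> contradicts the
    bound on \<open>dep\<close>.\<close>
  then have "dep m < h" using tree finR(2) unfolding rooted_tree_def by fastforce
  then show ?case using 0 by simp
next
  case (Suc n)
  let ?q = "budget h n" and ?\<delta> = "success \<alpha> h n"
  have \<delta>: "0 < ?\<delta>" "?\<delta> \<le> 1" using success_bounds[OF \<alpha>] by auto
  have upf: "upclosed (\<lambda>E Y. found k x E)" for k x using found_mono unfolding upclosed_def by blast
  have upe: "upclosed (\<lambda>E Y. e \<in> E)" for e :: "'a \<times> 'a" by (auto simp: upclosed_def)
  let ?up = "{a. (m, a) \<in> A \<and> anc p m a}"
  have subR: "?up \<subseteq> R" "children m \<subseteq> R" using AR by (auto simp: children_def)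
  then have fin: "finite ?up" "finite (children m)" using finR(1) finite_subset by auto
  have cR: "card ?up \<le> h" "card (children m) \<le> h"
    using card_mono[OF finR(1) subR(1)] card_mono[OF finR(1) subR(2)] finR(2) by auto
  have upb: "upclosed (\<lambda>E Y. \<forall>a\<in>?up. (\<phi> m, \<phi> a) \<in> E)" by (auto simp: upclosed_def)
  have 1: "finds G h (\<alpha> ^ h) (\<phi> m) (\<lambda>E Y. \<forall>a\<in>?up. (\<phi> m, \<phi> a) \<in> E)"
  proof -
    have "finds G (card ?up * 1) (\<alpha> ^ card ?up) (\<phi> m) (\<lambda>E Y. \<forall>a\<in>?up. (\<phi> m, \<phi> a) \<in> E)"
    proof (rule finds_Ball[OF fin(1)])
      fix a assume a: "a \<in> ?up"
      \<comment> \<open>All copies through the image of \<open>m\<close> share the image of the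
        ancestor \<open>a\<close>. A random neighbour that follows any of them is therefore the one
        required vertex.\<close>
      have eq: "\<psi> a = \<phi> a" if "\<psi> \<in> F" "\<psi> m = \<phi> m" for \<psi>
        using det_anc[OF that(1) Suc.prems(3,1) that(2)] a by blast
      have n: "finds G 1 \<alpha> (\<phi> m) (\<lambda>E Y. \<exists>\<psi>\<in>F. \<psi> m = \<phi> m \<and> \<psi> a \<in> Y \<and> (\<phi> m, \<psi> a) \<in> E)"
        by (rule finds_neighbor) (use Suc.prems(3) a in auto)
      show "finds G 1 \<alpha> (\<phi> m) (\<lambda>E Y. (\<phi> m, \<phi> a) \<in> E)"
      proof (rule finds_weaken[OF n])
        fix E Y assume "\<exists>\<psi>\<in>F. \<psi> m = \<phi> m \<and> \<psi> a \<in> Y \<and> (\<phi> m, \<psi> a) \<in> E"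
        then obtain \<psi> where "\<psi> \<in> F" "\<psi> m = \<phi> m" "(\<phi> m, \<psi> a) \<in> E" by blast
        then show "(\<phi> m, \<phi> a) \<in> E" using eq[of \<psi>] by simp
      qed simp
    qed (use \<alpha> upe in auto)
    then have "finds G h (\<alpha> ^ card ?up) (\<phi> m) (\<lambda>E Y. \<forall>a\<in>?up. (\<phi> m, \<phi> a) \<in> E)"
      by (rule finds_more[OF _ upb]) (use cR in simp)
    then show ?thesis
    proof (rule finds_weaken)
      show "\<alpha> ^ h \<le> \<alpha> ^ card ?up" by (rule power_decreasing[OF cR(1)]) (use \<alpha> in auto)
    qed
  qed
  let ?qc = "1 + (h * ?q + ?q)" and ?\<delta>c = "\<alpha> * (?\<delta> ^ h * ?\<delta>)"
  have \<delta>c: "0 < ?\<delta>c" "?\<delta>c \<le> 1" using \<delta> \<alpha> by (auto intro!: mult_le_one power_le_one)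
  let ?P = "\<lambda>k E Y. \<exists>\<psi>\<in>F. \<psi> m = \<phi> m \<and> found k (\<psi> k) E"
  have upP: "upclosed (?P k)" for k using found_mono unfolding upclosed_def by blast
  have upP': "upclosed (\<lambda>E Y. \<forall>k\<in>children m. ?P k E Y)" using upP unfolding upclosed_def by blast
  have child: "finds G ?qc ?\<delta>c (\<phi> m) (?P k)" if k: "k \<in> children m" for k
  proof -
    have kR: "k \<in> R" "p k = m" using k by (auto simp: children_def)
    have kd: "dep m < dep k" "k \<noteq> r" using child_dep[OF k] by auto
    \<comment> \<open>The entrance to the subtree of \<open>k\<close>: a random step towards the
      image of \<open>j\<close> selects a copy \<open>\<psi>\<close>, a climb leads to
      \<open>\<psi> k\<close>, and the subtree is explored from there.\<close>
    obtain j where j: "j \<in> R" "anc p j k" "(j, m) \<in> A" using down[OF kR(1) kd(2)] kR(2) by blast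
    have IH: "finds G ?q ?\<delta> (\<psi> i) (\<lambda>E Y. found i (\<psi> i) E)" if "i \<in> sub k" "\<psi> \<in> F" for i \<psi>
    proof (rule Suc.IH)
      show "i \<in> R" using that by (simp add: sub_def)
      have "k = i \<or> dep k < dep i" using that anc_dep[OF tree] by (auto simp: sub_def)
      then show "h \<le> dep i + n" using Suc.prems(2) kd(1) by auto
    qed (use that in simp)
    have B: "finds G ?q ?\<delta> (\<psi> i) (\<lambda>E Y. \<psi> (p i) \<in> Y)" if "i \<in> sub k" "\<psi> \<in> F" for i \<psi>
      by (rule finds_parent[OF that(2) _ IH[OF that]]) (use that in \<open>simp add: sub_def\<close>)
    show ?thesis
    proof (rule finds_chain[where C = "\<lambda>y. \<exists>\<psi>\<in>F. \<psi> m = \<phi> m \<and> y = \<psi> j"])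
      have "finds G 1 \<alpha> (\<phi> m) (\<lambda>E Y. \<exists>\<psi>\<in>F. \<psi> m = \<phi> m \<and> \<psi> j \<in> Y \<and> (\<phi> m, \<psi> j) \<in> E)"
        using finds_neighbor Suc.prems(3) symD[OF symA j(3)] by blast
      then show "finds G 1 \<alpha> (\<phi> m) (\<lambda>E Y. \<exists>y\<in>Y. \<exists>\<psi>\<in>F. \<psi> m = \<phi> m \<and> y = \<psi> j)"
        by (rule finds_weaken) auto
      fix y assume "\<exists>\<psi>\<in>F. \<psi> m = \<phi> m \<and> y = \<psi> j"
      then obtain \<psi> where \<psi>: "\<psi> \<in> F" "\<psi> m = \<phi> m" "y = \<psi> j" by blast
      have "finds G (h * ?q + ?q) (?\<delta> ^ h * ?\<delta>) (\<psi> j) (\<lambda>E Y. found k (\<psi> k) E)"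
      proof (rule finds_chain[where C = "\<lambda>y. y = \<psi> k"])
        show "finds G (h * ?q) (?\<delta> ^ h) (\<psi> j) (\<lambda>E Y. \<exists>y\<in>Y. y = \<psi> k)"
          using finds_climb[OF B \<delta> \<psi>(1), of k j] j by (simp add: sub_def)
        show "\<And>y. y = \<psi> k \<Longrightarrow> finds G ?q ?\<delta> y (\<lambda>E Y. found k (\<psi> k) E)"
          using IH[of k \<psi>] \<psi>(1) kR(1) by (simp add: sub_def)
      qed (use \<delta> upf in auto)
      then show "finds G (h * ?q + ?q) (?\<delta> ^ h * ?\<delta>) y (?P k)"
        unfolding \<psi>(3) by (rule finds_weaken) (use \<psi> in auto)
    qed (use \<delta> upP in auto)
  qed
  have 2: "finds G (h * ?qc) (?\<delta>c ^ h) (\<phi> m) (\<lambda>E Y. \<forall>k\<in>children m. ?P k E Y)"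
  proof -
    have "finds G (card (children m) * ?qc) (?\<delta>c ^ card (children m)) (\<phi> m) (\<lambda>E Y. \<forall>k\<in>children m. ?P k E Y)"
      by (rule finds_Ball[OF fin(2) child upP]) (use \<delta>c in auto)
    then have "finds G (h * ?qc) (?\<delta>c ^ card (children m)) (\<phi> m) (\<lambda>E Y. \<forall>k\<in>children m. ?P k E Y)"
      by (rule finds_more[OF _ upP']) (use cR in \<open>intro mult_right_mono, auto\<close>)
    then show ?thesis
    proof (rule finds_weaken)
      show "?\<delta>c ^ h \<le> ?\<delta>c ^ card (children m)" by (rule power_decreasing) (use \<delta>c cR in auto)
    qed
  qed
  have "finds G (h + h * ?qc) (\<alpha> ^ h * ?\<delta>c ^ h) (\<phi> m)
      (\<lambda>E Y. (\<forall>a\<in>?up. (\<phi> m, \<phi> a) \<in> E) \<and> (\<forall>k\<in>children m. ?P k E Y))"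
    by (rule finds_conj[OF 1 2 _ upb upP']) (use \<delta>c in auto)
  then show ?case unfolding budget.simps success.simps
  proof (rule finds_weaken)
    fix E :: "('a \<times> 'a) set"
    assume "(\<forall>a\<in>?up. (\<phi> m, \<phi> a) \<in> E) \<and> (\<forall>k\<in>children m. \<exists>\<psi>\<in>F. \<psi> m = \<phi> m \<and> found k (\<psi> k) E)"
    then show "found m (\<phi> m) E" using found_merge[OF Suc.prems(3,1)] by blast
  qed (simp add: power_mult_distrib)
qed

lemma finds_root:
  assumes "i \<in> R" "\<phi> \<in> F"
  shows "finds G (h * budget h h + budget h h) (success \<alpha> h h ^ h * success \<alpha> h h) (\<phi> i) (\<lambda>E Y. \<exists>y. found r y E)"
proof (rule finds_chain[where C = "\<lambda>y. y = \<phi> r"])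
  have \<delta>: "0 < success \<alpha> h h" "success \<alpha> h h \<le> 1" using success_bounds[OF \<alpha>] by auto
  have rR: "r \<in> R" using tree by (simp add: rooted_tree_def)
  have "anc p i r"
    using assms(1)
  proof (induction "dep i" arbitrary: i rule: less_induct)
    case less
    show ?case
    proof (cases "i = r")
      case False
      then have "dep (p i) < dep i" "p i \<in> R" using tree less.prems by (auto simp: rooted_tree_def)
      then show ?thesis by (intro anc_step[OF less.hyps])
    qed simp
  qed
  then have "finds G (h * budget h h) (success \<alpha> h h ^ h) (\<phi> i) (\<lambda>E Y. \<phi> r \<in> Y)"
    using finds_climb[of r "budget h h" "success \<alpha> h h" \<phi> i] finds_parent finds_sub \<delta> assms
    by (auto simp: sub_def)
  then show "finds G (h * budget h h) (success \<alpha> h h ^ h) (\<phi> i) (\<lambda>E Y. \<exists>y\<in>Y. y = \<phi> r)" by simp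
  show "0 \<le> success \<alpha> h h" using \<delta> by simp
  show "upclosed (\<lambda>E Y. \<exists>y. found r y E)" using found_mono unfolding upclosed_def by blast
  fix y assume "y = \<phi> r"
  then show "finds G (budget h h) (success \<alpha> h h) y (\<lambda>E Y. \<exists>y. found r y E)"
    using finds_weaken[OF finds_sub[OF rR _ assms(2), of h], of "\<lambda>E Y. \<exists>y. found r y E"] by auto
qed

text \<open>At the root every ancestor lies in the subtree, so all recorded ends are recombined
  images. Edges of \<open>H\<close> join comparable vertices and were recorded upwards, which
  accounts for the converse.\<close>

lemma found_root_copy:
  assumes "found r y E"
  shows "\<exists>\<psi>. (\<forall>i\<in>R. \<exists>\<phi>\<in>F. \<psi> i = \<phi> i) \<and> (\<forall>i j. (i, j) \<in> A \<longrightarrow> (\<psi> i, \<psi> j) \<in> E \<union> E\<inverse>)"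
proof -
  obtain w where w: "(\<forall>i\<in>sub r. w i \<in> F) \<and> w r r = y \<and> (\<forall>i\<in>sub r - {r}. w i (p i) = w (p i) (p i)) \<and>
     (\<forall>i\<in>sub r. \<forall>a. (i, a) \<in> A \<and> anc p i a \<longrightarrow> (w i i, w i a) \<in> E)"
    using assms unfolding found_def by (elim exE)
  have all: "i \<in> sub r" if "i \<in> R" for i
    using that
  proof (induction "dep i" arbitrary: i rule: less_induct)
    case less
    show ?case
    proof (cases "i = r")
      case False
      then have "dep (p i) < dep i" "p i \<in> R" using tree less.prems by (auto simp: rooted_tree_def)
      then have "p i \<in> sub r" by (intro less.hyps)
      then show ?thesis using less.prems by (simp add: sub_def anc_step)
    qed (use less.prems in \<open>simp add: sub_def\<close>)
  qed
  have e: "(w i i, w a a) \<in> E" if "(i, a) \<in> A" "anc p i a" for i a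
  proof -
    have ia: "i \<in> sub r" "a \<in> sub r" using that(1) AR all by auto
    have "w i a = w a a" by (rule witness_agrees[of r]) (use w ia that in auto)
    then show ?thesis using w ia that by metis
  qed
  have "(w i i, w j j) \<in> E \<union> E\<inverse>" if "(i, j) \<in> A" for i j
    using comparable[OF that] e[OF that] e[OF symD[OF symA that]] by auto
  moreover have "\<exists>\<phi>\<in>F. w i i = \<phi> i" if "i \<in> R" for i using w all[OF that] by blast
  ultimately show ?thesis by (intro exI[of _ "\<lambda>i. w i i"]) simp
qed

end

section \<open>Packings of copies\<close>

text \<open>A subgraph that need not be induced amounts to an injective homomorphism. The
  isomorphism must use \<open>fst\<close> and \<open>snd\<close> as tail and head, for compatibility
  with \<open>with_proj K\<close>.\<close>

lemma contains_copyI: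
  assumes "pair_graph H" "pair_wf_digraph K" "inj_on \<psi> (pverts H)" "\<psi> ` pverts H \<subseteq> pverts K"
    "\<And>i j. (i, j) \<in> parcs H \<Longrightarrow> (\<psi> i, \<psi> j) \<in> parcs K"
  shows "contains_copy H K"
proof -
  interpret H: pair_graph H by fact
  interpret K: pair_wf_digraph K by fact
  define f where "f = \<lparr>iso_verts = \<psi>, iso_arcs = map_prod \<psi> \<psi>, iso_head = snd, iso_tail = fst\<rparr>"
  let ?S = "app_iso f (with_proj H)"
  have arcs: "fst e \<in> pverts H \<and> snd e \<in> pverts H" if "e \<in> parcs H" for e
    using that H.arc_fst_in_verts H.arc_snd_in_verts by blast
  have "inj_on (map_prod \<psi> \<psi>) (parcs H)"
  proof (rule inj_onI)
    fix d e assume "d \<in> parcs H" "e \<in> parcs H" "map_prod \<psi> \<psi> d = map_prod \<psi> \<psi> e"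
    then show "d = e" using arcs[of d] arcs[of e] inj_onD[OF assms(3)] by (auto simp: prod_eq_iff)
  qed
  then have "pre_digraph.digraph_isomorphism (with_proj H) f"
    unfolding pre_digraph.digraph_isomorphism_def f_def using assms(3) H.wf_digraph by simp
  then have "digraph_iso (with_proj H) ?S" unfolding digraph_iso_def by blast
  then have "digraph_iso ?S (with_proj H)" by (rule digraph_iso_swap[OF H.wf_digraph])
  moreover have "subgraph ?S (with_proj K)"
    unfolding subgraph_def
  proof (intro conjI)
    show "wf_digraph ?S"
      by unfold_locales (auto simp: f_def dest: H.in_arcsD1 H.in_arcsD2)
    show "arcs ?S \<subseteq> arcs (with_proj K)" using assms(5) by (auto simp: f_def)
  qed (use assms(4) K.wf_digraph in \<open>auto simp: f_def compatible_def\<close>)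
  ultimately show ?thesis unfolding contains_copy_def by blast
qed

lemma contains_copyD:
  assumes "pair_graph H" "contains_copy H K"
  shows "\<exists>\<psi>. inj_on \<psi> (pverts H) \<and> \<psi> ` pverts H \<subseteq> pverts K \<and> (\<forall>i j. (i, j) \<in> parcs H \<longrightarrow> (\<psi> i, \<psi> j) \<in> parcs K)"
proof -
  interpret H: pair_graph H by fact
  obtain S where S: "subgraph S (with_proj K)" "digraph_iso S (with_proj H)"
    using assms(2) unfolding contains_copy_def by blast
  have "wf_digraph S" using S(1) by (simp add: subgraph_def)
  then have "digraph_iso (with_proj H) S" using S(2) by (rule digraph_iso_swap)
  then obtain f where f: "pre_digraph.digraph_isomorphism (with_proj H) f" "S = app_iso f (with_proj H)"
    unfolding digraph_iso_def by blast
  have ts: "iso_tail f = fst" "iso_head f = snd" using S(1) unfolding f(2) subgraph_def compatible_def by auto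
  have "(iso_verts f i, iso_verts f j) \<in> parcs K" if "(i, j) \<in> parcs H" for i j
  proof -
    have "iso_verts f i = fst (iso_arcs f (i, j)) \<and> iso_verts f j = snd (iso_arcs f (i, j))"
      using f(1) that ts unfolding pre_digraph.digraph_isomorphism_def by force
    then have "(iso_verts f i, iso_verts f j) = iso_arcs f (i, j)" by simp
    moreover have "iso_arcs f (i, j) \<in> arcs S" using that unfolding f(2) by simp
    ultimately show ?thesis using S(1) by (auto simp: subgraph_def)
  qed
  moreover have "inj_on (iso_verts f) (pverts H)"
    using f(1) by (simp add: pre_digraph.digraph_isomorphism_def)
  moreover have "iso_verts f ` pverts H \<subseteq> pverts K" using S(1) unfolding f(2) subgraph_def by simp
  ultimately show ?thesis by blast
qed

definition embeddings :: "'h pair_pre_digraph \<Rightarrow> 'a pair_pre_digraph \<Rightarrow> ('h \<Rightarrow> 'a) set" where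
  "embeddings H G = {\<phi> \<in> pverts H \<rightarrow>\<^sub>E pverts G. inj_on \<phi> (pverts H) \<and>
     (\<forall>i j. (i, j) \<in> parcs H \<longrightarrow> (\<phi> i, \<phi> j) \<in> parcs G)}"

definition copy_edges :: "'h pair_pre_digraph \<Rightarrow> ('h \<Rightarrow> 'a) \<Rightarrow> 'a set set" where
  "copy_edges H \<phi> = (\<lambda>(i, j). {\<phi> i, \<phi> j}) ` parcs H"

text \<open>Deleting all edges used by a largest packing leaves an \<open>H\<close>-free graph, so
  the packing uses many edges, while each copy uses at most \<open>card (parcs H)\<close> of
  them.\<close>

lemma edge_disjoint_copies:
  fixes G :: "'a pair_pre_digraph" and H :: "'h pair_pre_digraph"
  assumes H: "pair_graph H" "parcs H \<noteq> {}" and G: "pair_graph G" and far: "far_from_free \<epsilon> H G"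
  shows "\<exists>F\<subseteq>embeddings H G. (\<forall>\<phi>\<in>F. \<forall>\<psi>\<in>F. \<phi> \<noteq> \<psi> \<longrightarrow> copy_edges H \<phi> \<inter> copy_edges H \<psi> = {}) \<and>
    real (card F) * real (card (parcs H)) \<ge> \<epsilon> * real (card (pverts G))"
proof -
  interpret H: pair_graph H by fact
  interpret G: pair_graph G by fact
  have symG: "sym (parcs G)" using G.pair_sym_arcs by (simp add: symmetric_def)
  have finE: "finite (embeddings H G)"
    by (rule finite_subset[of _ "pverts H \<rightarrow>\<^sub>E pverts G"]) (auto simp: embeddings_def intro: finite_PiE)
  define ok where "ok F \<longleftrightarrow> F \<subseteq> embeddings H G \<and> (\<forall>\<phi>\<in>F. \<forall>\<psi>\<in>F. \<phi> \<noteq> \<psi> \<longrightarrow> copy_edges H \<phi> \<inter> copy_edges H \<psi> = {})" for F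
  have "\<exists>F. ok F \<and> (\<forall>F'. ok F' \<longrightarrow> card F' \<le> card F)"
  proof (rule ex_has_greatest_nat[of ok "{}" card "Suc (card (embeddings H G))"])
    show "ok {}" by (simp add: ok_def)
    show "\<forall>F. ok F \<longrightarrow> card F < Suc (card (embeddings H G))"
      using card_mono[OF finE] by (auto simp: ok_def less_Suc_eq_le)
  qed
  then obtain F where F: "ok F" and max: "\<And>F'. ok F' \<Longrightarrow> card F' \<le> card F" by blast
  have finF: "finite F" using F finE finite_subset by (auto simp: ok_def)
  define used where "used = (\<Union>\<phi>\<in>F. copy_edges H \<phi>)"
  define G' where "G' = \<lparr>pverts = pverts G, parcs = {(u, v). (u, v) \<in> parcs G \<and> {u, v} \<notin> used}\<rparr>"
  have sub: "parcs G' \<subseteq> parcs G" "pverts G' = pverts G" by (auto simp: G'_def)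
  have G': "pair_graph G'"
  proof
    show "finite (pverts G')" "finite (parcs G')" using sub finite_subset[OF sub(1)] by auto
    show "fst e \<in> pverts G'" if "e \<in> parcs G'" for e using that sub G.arc_fst_in_verts by auto
    show "snd e \<in> pverts G'" if "e \<in> parcs G'" for e using that sub G.arc_snd_in_verts by auto
    show "fst e \<noteq> snd e" if "e \<in> parcs G'" for e using that sub G.pair_no_loops by auto
    have "sym (parcs G')" using symG unfolding sym_def G'_def by (auto simp: insert_commute)
    then show "symmetric (with_proj G')" by (simp add: symmetric_def)
  qed
  interpret G': pair_graph G' by fact
  have sp: "spanning (with_proj G') (with_proj G)"
    using sub G.wf_digraph G'.wf_digraph by (simp add: spanning_def subgraph_def compatible_def)
  have free: "\<not> contains_copy H G'"
  proof
    assume "contains_copy H G'"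
    then obtain \<psi>0 where \<psi>0: "inj_on \<psi>0 (pverts H)" "\<psi>0 ` pverts H \<subseteq> pverts G'"
      "\<forall>i j. (i, j) \<in> parcs H \<longrightarrow> (\<psi>0 i, \<psi>0 j) \<in> parcs G'" using contains_copyD[OF H(1)] by blast
    define \<psi> where "\<psi> = restrict \<psi>0 (pverts H)"
    have eq: "\<psi> i = \<psi>0 i \<and> \<psi> j = \<psi>0 j" if "(i, j) \<in> parcs H" for i j
      using H.in_arcsD1[OF that] H.in_arcsD2[OF that] by (simp add: \<psi>_def)
    have arcs: "(\<psi> i, \<psi> j) \<in> parcs G'" if "(i, j) \<in> parcs H" for i j using \<psi>0(3) eq[OF that] that by simp
    have emb: "\<psi> \<in> embeddings H G"
      unfolding embeddings_def
    proof (intro CollectI conjI allI impI)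
      show "\<psi> \<in> pverts H \<rightarrow>\<^sub>E pverts G" using \<psi>0(2) sub by (auto simp: \<psi>_def)
      show "inj_on \<psi> (pverts H)" using \<psi>0(1) by (auto simp: \<psi>_def inj_on_def)
      show "(\<psi> i, \<psi> j) \<in> parcs G" if "(i, j) \<in> parcs H" for i j using arcs[OF that] sub by blast
    qed
    have unused: "e \<notin> used" if "e \<in> copy_edges H \<psi>" for e
      using that arcs unfolding copy_edges_def G'_def by auto
    have dis: "copy_edges H \<psi> \<inter> copy_edges H \<phi> = {}" if "\<phi> \<in> F" for \<phi> using unused that unfolding used_def by blast
    \<comment> \<open>Since \<open>H\<close> has an edge, a copy is not disjoint from itself. Hence
      \<open>\<psi>\<close> is new and the packing was not largest.\<close>
    have "copy_edges H \<psi> \<noteq> {}" using H(2) by (simp add: copy_edges_def)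
    then have "\<psi> \<notin> F" using dis by blast
    have "ok (insert \<psi> F)" using F emb dis unfolding ok_def by (auto simp: Int_commute)
    from max[OF this] show False using \<open>\<psi> \<notin> F\<close> finF by simp
  qed
  have "\<epsilon> * real (card (pverts G)) < real (card (uedges G - uedges G'))"
    using far G' sp free unfolding far_from_free_def by blast
  moreover have "card (uedges G - uedges G') \<le> card F * card (parcs H)"
  proof -
    have "uedges G - uedges G' \<subseteq> used" unfolding uedges_def G'_def by auto
    moreover have finU: "finite used" using finF unfolding used_def copy_edges_def by auto
    ultimately have "card (uedges G - uedges G') \<le> card used" by (rule card_mono[rotated])
    also have "\<dots> \<le> (\<Sum>\<phi>\<in>F. card (copy_edges H \<phi>))" unfolding used_def by (rule card_UN_le[OF finF])
    also have "\<dots> \<le> (\<Sum>\<phi>\<in>F. card (parcs H))"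
      unfolding copy_edges_def by (intro sum_mono card_image_le) auto
    finally show ?thesis by simp
  qed
  ultimately have "\<epsilon> * real (card (pverts G)) \<le> real (card F) * real (card (parcs H))"
    by (metis of_nat_mono of_nat_mult less_le_trans less_imp_le)
  then show ?thesis using F unfolding ok_def by (intro exI[of _ F]) simp
qed

text \<open>Averaging over all colourings \<open>V \<rightarrow> R\<close>: an injective
  \<open>\<phi>\<close> fixes the colours of \<open>card R\<close> vertices, so it is respected by
  one colouring in \<open>card R ^ card R\<close>.\<close>

lemma color_coding:
  fixes F :: "('h \<Rightarrow> 'a) set"
  assumes "finite V" "finite R" "R \<noteq> {}" "finite F" "\<And>\<phi>. \<phi> \<in> F \<Longrightarrow> inj_on \<phi> R \<and> \<phi> ` R \<subseteq> V"
  shows "\<exists>\<kappa>. card F \<le> card R ^ card R * card {\<phi> \<in> F. \<forall>i\<in>R. \<kappa> (\<phi> i) = i}"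
proof (cases "F = {}")
  case False
  let ?h = "card R" and ?n = "card V" and ?K = "V \<rightarrow>\<^sub>E R"
  have h: "?h > 0" using assms by (simp add: card_gt_0_iff)
  have count: "card {\<kappa> \<in> ?K. \<forall>i\<in>R. \<kappa> (\<phi> i) = i} = ?h ^ (?n - ?h)" and hn: "?h \<le> ?n" if "\<phi> \<in> F" for \<phi>
  proof -
    have inj: "inj_on \<phi> R" and sub: "\<phi> ` R \<subseteq> V" using assms(5)[OF that] by auto
    let ?B = "\<lambda>x. if x \<in> \<phi> ` R then {the_inv_into R \<phi> x} else R"
    have "{\<kappa> \<in> ?K. \<forall>i\<in>R. \<kappa> (\<phi> i) = i} = Pi\<^sub>E V ?B"
    proof (intro set_eqI iffI)
      fix \<kappa> assume \<kappa>: "\<kappa> \<in> {\<kappa> \<in> ?K. \<forall>i\<in>R. \<kappa> (\<phi> i) = i}"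
      then have "\<kappa> x \<in> ?B x" if "x \<in> V" for x using that inj by (auto simp: the_inv_into_f_f)
      then show "\<kappa> \<in> Pi\<^sub>E V ?B" using \<kappa> by (auto simp: PiE_iff)
    next
      fix \<kappa> assume \<kappa>: "\<kappa> \<in> Pi\<^sub>E V ?B"
      have B: "\<kappa> x \<in> ?B x" if "x \<in> V" for x using \<kappa> that by (rule PiE_mem)
      have "\<kappa> (\<phi> i) = i" if "i \<in> R" for i
        using B[of "\<phi> i"] that sub inj by (auto simp: the_inv_into_f_f)
      moreover have "\<kappa> x \<in> R" if "x \<in> V" for x using B[OF that] inj by (auto simp: the_inv_into_f_f split: if_splits)
      ultimately show "\<kappa> \<in> {\<kappa> \<in> ?K. \<forall>i\<in>R. \<kappa> (\<phi> i) = i}" using \<kappa> by (auto simp: PiE_iff)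
    qed
    then have "card {\<kappa> \<in> ?K. \<forall>i\<in>R. \<kappa> (\<phi> i) = i} = (\<Prod>x\<in>V. card (?B x))" using assms(1) by (simp add: card_PiE)
    also have "\<dots> = (\<Prod>x\<in>V. if x \<in> \<phi> ` R then 1 else ?h)" by (rule prod.cong) auto
    also have "\<dots> = ?h ^ card (V - \<phi> ` R)" using assms(1) by (simp add: prod.If_cases Diff_eq)
    also have "card (V - \<phi> ` R) = ?n - ?h"
      using sub assms(1,2) inj by (simp add: card_Diff_subset card_image)
    finally show "card {\<kappa> \<in> ?K. \<forall>i\<in>R. \<kappa> (\<phi> i) = i} = ?h ^ (?n - ?h)" .
    show "?h \<le> ?n" using card_mono[OF assms(1) sub] inj by (simp add: card_image)
  qed
  let ?g = "\<lambda>\<kappa>. card {\<phi> \<in> F. \<forall>i\<in>R. \<kappa> (\<phi> i) = i}"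
  have finK: "finite ?K" using assms by (intro finite_PiE) auto
  have neK: "?K \<noteq> {}" using assms(3) by (simp add: PiE_eq_empty_iff)
  have "(\<Sum>\<kappa>\<in>?K. ?g \<kappa>) = card (SIGMA \<kappa>:?K. {\<phi> \<in> F. \<forall>i\<in>R. \<kappa> (\<phi> i) = i})" using finK assms(4) by simp
  also have "\<dots> = card (SIGMA \<phi>:F. {\<kappa> \<in> ?K. \<forall>i\<in>R. \<kappa> (\<phi> i) = i})"
    by (rule bij_betw_same_card[of prod.swap]) (auto simp: bij_betw_def inj_on_def image_iff)
  also have "\<dots> = (\<Sum>\<phi>\<in>F. ?h ^ (?n - ?h))" using finK assms(4) count by simp
  finally have sum: "(\<Sum>\<kappa>\<in>?K. ?g \<kappa>) = card F * ?h ^ (?n - ?h)" by simp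
  show ?thesis
  proof (rule ccontr)
    assume n: "\<not> ?thesis"
    have "(\<Sum>\<kappa>\<in>?K. ?h ^ ?h * ?g \<kappa>) < (\<Sum>\<kappa>\<in>?K. card F)"
      by (rule sum_strict_mono[OF finK neK]) (use n in \<open>auto simp: not_le\<close>)
    also have "\<dots> = ?h ^ ?n * card F" using assms(1) by (simp add: card_PiE)
    also have "?h ^ ?n = ?h ^ ?h * ?h ^ (?n - ?h)" using hn False by (metis ex_in_conv le_add_diff_inverse power_add)
    finally show False by (simp add: sum_distrib_left[symmetric] sum mult.commute mult.left_commute)
  qed
qed simp

text \<open>Choose \<open>F'\<close> to maximise its size minus \<alpha> times the total weight of
  the images it uses, counted per role. Deleting a fibre that is too small would lose fewer than
  \<open>\<alpha> * wt\<close> copies but save that much cost, so none remains.\<close>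

lemma prune_sparse_fibers:
  fixes F :: "('h \<Rightarrow> 'a) set" and wt :: "'a \<Rightarrow> real"
  assumes "finite F" "finite R" "finite V" "\<And>\<phi> i. \<phi> \<in> F \<Longrightarrow> i \<in> R \<Longrightarrow> \<phi> i \<in> V" "\<And>x. wt x \<ge> 0" "\<alpha> \<ge> 0"
  shows "\<exists>F'\<subseteq>F. (\<forall>\<phi>\<in>F'. \<forall>i\<in>R. \<alpha> * wt (\<phi> i) \<le> real (card {\<psi> \<in> F'. \<psi> i = \<phi> i})) \<and>
    real (card F) - \<alpha> * (real (card R) * (\<Sum>x\<in>V. wt x)) \<le> real (card F')"
proof -
  define cost where "cost F' = (\<Sum>i\<in>R. \<Sum>x\<in>(\<lambda>\<phi>. \<phi> i) ` F'. wt x)" for F' :: "('h \<Rightarrow> 'a) set"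
  define \<Phi> where "\<Phi> F' = real (card F') - \<alpha> * cost F'" for F'
  have fin: "finite (\<Phi> ` Pow F)" "\<Phi> ` Pow F \<noteq> {}" using assms(1) by auto
  from Max_in[OF fin] obtain F' where "F' \<in> Pow F" "Max (\<Phi> ` Pow F) = \<Phi> F'" by (rule imageE)
  then have F': "F' \<subseteq> F" "\<Phi> F' = Max (\<Phi> ` Pow F)" by simp_all
  have max: "\<Phi> F'' \<le> \<Phi> F'" if "F'' \<subseteq> F" for F'' unfolding F'(2) using fin(1) that by (intro Max_ge) auto
  have finF': "finite F'" using F'(1) assms(1) finite_subset by blast
  have good: "\<alpha> * wt (\<phi> i) \<le> real (card {\<psi> \<in> F'. \<psi> i = \<phi> i})" if \<phi>: "\<phi> \<in> F'" and i: "i \<in> R" for \<phi> i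
  proof (rule ccontr)
    assume n: "\<not> ?thesis"
    let ?D = "{\<psi> \<in> F'. \<psi> i = \<phi> i}" and ?F = "{\<psi> \<in> F'. \<psi> i \<noteq> \<phi> i}"
    have "F' = ?F \<union> ?D" "?F \<inter> ?D = {}" by auto
    then have c: "card F' = card ?F + card ?D" using finF' card_Un_disjoint[of ?F ?D] by simp
    have le: "(\<Sum>x\<in>(\<lambda>\<psi>. \<psi> j) ` ?F. wt x) \<le> (\<Sum>x\<in>(\<lambda>\<psi>. \<psi> j) ` F'. wt x)" for j
      using finF' assms(5) by (intro sum_mono2) auto
    have "(\<Sum>x\<in>(\<lambda>\<psi>. \<psi> i) ` ?F. wt x) + wt (\<phi> i) = (\<Sum>x\<in>insert (\<phi> i) ((\<lambda>\<psi>. \<psi> i) ` ?F). wt x)"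
      using finF' by (subst sum.insert) auto
    also have "\<dots> \<le> (\<Sum>x\<in>(\<lambda>\<psi>. \<psi> i) ` F'. wt x)" using finF' assms(5) \<phi> by (intro sum_mono2) auto
    finally have i': "(\<Sum>x\<in>(\<lambda>\<psi>. \<psi> i) ` ?F. wt x) + wt (\<phi> i) \<le> (\<Sum>x\<in>(\<lambda>\<psi>. \<psi> i) ` F'. wt x)" .
    have "cost ?F + wt (\<phi> i) \<le> cost F'"
    proof -
      have "cost ?F = (\<Sum>x\<in>(\<lambda>\<psi>. \<psi> i) ` ?F. wt x) + (\<Sum>j\<in>R - {i}. \<Sum>x\<in>(\<lambda>\<psi>. \<psi> j) ` ?F. wt x)"
        "cost F' = (\<Sum>x\<in>(\<lambda>\<psi>. \<psi> i) ` F'. wt x) + (\<Sum>j\<in>R - {i}. \<Sum>x\<in>(\<lambda>\<psi>. \<psi> j) ` F'. wt x)"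
        unfolding cost_def by (rule sum.remove[OF assms(2) i])+
      moreover have "(\<Sum>j\<in>R - {i}. \<Sum>x\<in>(\<lambda>\<psi>. \<psi> j) ` ?F. wt x) \<le> (\<Sum>j\<in>R - {i}. \<Sum>x\<in>(\<lambda>\<psi>. \<psi> j) ` F'. wt x)"
        using le by (intro sum_mono) auto
      ultimately show ?thesis using i' by linarith
    qed
    from mult_left_mono[OF this assms(6)] have "\<alpha> * cost ?F + \<alpha> * wt (\<phi> i) \<le> \<alpha> * cost F'" by (simp add: distrib_left)
    then have "\<Phi> ?F > \<Phi> F'" using n c unfolding \<Phi>_def by simp
    moreover have "?F \<subseteq> F" using F'(1) by blast
    ultimately show False using max[of ?F] by linarith
  qed
  have "cost F \<le> (\<Sum>i\<in>R. \<Sum>x\<in>V. wt x)"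
    unfolding cost_def using assms by (intro sum_mono sum_mono2) auto
  then have "\<alpha> * cost F \<le> \<alpha> * (real (card R) * (\<Sum>x\<in>V. wt x))" using assms(6) by (intro mult_left_mono) auto
  moreover have "\<Phi> F \<le> \<Phi> F'" by (rule max) simp
  moreover have "0 \<le> cost F'" unfolding cost_def using assms(5) by (intro sum_nonneg) auto
  then have "\<Phi> F' \<le> real (card F')" using assms(6) unfolding \<Phi>_def by simp
  ultimately have "real (card F) - \<alpha> * (real (card R) * (\<Sum>x\<in>V. wt x)) \<le> real (card F')"
    unfolding \<Phi>_def by linarith
  then show ?thesis using F'(1) good by (intro exI[of _ F']) simp
qed

lemma connected_graph_cut:
  assumes "pair_graph H" "Digraph_Component.connected (with_proj H)" "S \<subset> pverts H" "S \<noteq> {}"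
  shows "\<exists>i\<in>S. \<exists>j\<in>pverts H - S. (i, j) \<in> parcs H"
proof (rule ccontr)
  assume n: "\<not> ?thesis"
  interpret H: pair_graph H by fact
  obtain u v where uv: "u \<in> S" "v \<in> pverts H" "v \<notin> S" using assms(3,4) by blast
  have "strongly_connected (with_proj H)"
    using H.symmetric_connected_imp_strongly_connected[OF H.sym_arcs assms(2)] .
  then have "reachable (with_proj H) u v" using uv assms(3) by (auto simp: strongly_connected_def)
  then have "(u, v) \<in> rtrancl_on (pverts H) (parcs H)" by (simp add: reachable_def)
  then have "v \<in> S"
    by (induction rule: rtrancl_on_induct) (use uv n in auto)
  then show False using uv by simp
qed

section \<open>The tester\<close>

lemma embedding_disjoint:
  assumes "copy_edges H \<phi> \<inter> copy_edges H \<psi> = {} \<or> \<phi> = \<psi>" "(i, j) \<in> parcs H" "\<phi> i = \<psi> i" "\<phi> j = \<psi> j"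
  shows "\<phi> = \<psi>"
proof -
  have "{\<phi> i, \<phi> j} \<in> copy_edges H \<phi>" "{\<psi> i, \<psi> j} \<in> copy_edges H \<psi>"
    using assms(2) by (auto simp: copy_edges_def image_iff)
  then show ?thesis using assms by auto
qed

text \<open>The factor \<open>h ^ h\<close> is lost to colouring, and one
  \<open>step_const 64 h\<close> to each of the \<open>h\<close> eliminations.\<close>

definition copy_ratio :: "nat \<Rightarrow> nat" where
  "copy_ratio h = h ^ h * step_const 64 h ^ h"

definition copy_density :: "real \<Rightarrow> 'h pair_pre_digraph \<Rightarrow> real" where
  "copy_density \<epsilon> H = \<epsilon> / (real (card (parcs H)) * real (copy_ratio (card (pverts H))))"

text \<open>The degrees sum to at most 64 times the number of vertices, so pruning at this rate over
  all roles removes at most half of the guaranteed copies.\<close>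

definition hit_rate :: "real \<Rightarrow> 'h pair_pre_digraph \<Rightarrow> real" where
  "hit_rate \<epsilon> H = min 1 (copy_density \<epsilon> H / (128 * real (card (pverts H))))"

text \<open>Pruning comes last because density refers to the final family; disjointness, colours and
  the tree are inherited by subfamilies.\<close>

lemma copy_forest_exists:
  fixes G :: "'a pair_pre_digraph" and H :: "'h pair_pre_digraph"
  assumes H: "pair_graph H" "Digraph_Component.connected (with_proj H)" "parcs H \<noteq> {}"
    and G: "pair_graph G" "planar G" "far_from_free \<epsilon> H G" and \<epsilon>: "\<epsilon> > 0"
  shows "\<exists>F p r dep \<kappa>. copy_forest G (parcs H) (pverts H) F p r dep (hit_rate \<epsilon> H) (card (pverts H)) \<and>
    (\<forall>\<phi>\<in>F. \<phi> \<in> embeddings H G) \<and> (\<forall>\<phi>\<in>F. \<forall>i\<in>pverts H. \<kappa> (\<phi> i) = i) \<and>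
    real (card F) \<ge> copy_density \<epsilon> H / 2 * real (card (pverts G))"
proof -
  interpret H: pair_graph H by fact
  interpret G: pair_graph G by fact
  let ?R = "pverts H" and ?A = "parcs H" and ?n = "real (card (pverts G))"
  let ?h = "card ?R" and ?\<alpha> = "hit_rate \<epsilon> H" and ?\<gamma> = "copy_density \<epsilon> H"
  have symH: "sym ?A" using H.pair_sym_arcs by (simp add: symmetric_def)
  have symG: "sym (parcs G)" using G.pair_sym_arcs by (simp add: symmetric_def)
  have irrG: "irrefl (parcs G)" using G.pair_no_loops by (intro irreflI) fastforce
  have AR: "?A \<subseteq> ?R \<times> ?R" using H.in_arcsD1 H.in_arcsD2 by auto
  have neR: "?R \<noteq> {}" using H(3) AR by auto
  have h: "?h \<ge> 1" using neR by (simp add: Suc_le_eq card_gt_0_iff)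
  have ms: "minor_sparse 64 (parcs G)" by (rule planar_minor_sparse[OF G(1,2)])
  have cA: "card ?A > 0" using H(3) by (simp add: card_gt_0_iff)
  have cr: "copy_ratio ?h > 0" using h step_const_pos[of 64 ?h] by (simp add: copy_ratio_def)
  have \<gamma>: "?\<gamma> > 0" using \<epsilon> cA cr by (simp add: copy_density_def)
  have \<alpha>: "0 < ?\<alpha>" "?\<alpha> \<le> 1" using \<gamma> h by (auto simp: hit_rate_def)
  obtain F0 where F0: "F0 \<subseteq> embeddings H G"
    "\<forall>\<phi>\<in>F0. \<forall>\<psi>\<in>F0. \<phi> \<noteq> \<psi> \<longrightarrow> copy_edges H \<phi> \<inter> copy_edges H \<psi> = {}"
    "real (card F0) * real (card ?A) \<ge> \<epsilon> * ?n"
    using edge_disjoint_copies[OF H(1,3) G(1,3)] by (elim exE conjE)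
  have emb: "\<phi> \<in> ?R \<rightarrow>\<^sub>E pverts G" "inj_on \<phi> ?R" "\<And>i j. (i, j) \<in> ?A \<Longrightarrow> (\<phi> i, \<phi> j) \<in> parcs G" if "\<phi> \<in> F0" for \<phi>
  proof -
    have "\<phi> \<in> embeddings H G" using that F0(1) by blast
    then show "\<phi> \<in> ?R \<rightarrow>\<^sub>E pverts G" "inj_on \<phi> ?R" "\<And>i j. (i, j) \<in> ?A \<Longrightarrow> (\<phi> i, \<phi> j) \<in> parcs G"
      by (simp_all add: embeddings_def)
  qed
  have finF0: "finite F0"
    by (rule finite_subset[of _ "?R \<rightarrow>\<^sub>E pverts G"]) (use emb(1) in \<open>auto intro: finite_PiE\<close>)
  have inV: "\<phi> i \<in> pverts G" if "\<phi> \<in> F0" "i \<in> ?R" for \<phi> i using emb(1)[OF that(1)] that(2) by (rule PiE_mem)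
  have "\<exists>\<kappa>. card F0 \<le> ?h ^ ?h * card {\<phi> \<in> F0. \<forall>i\<in>?R. \<kappa> (\<phi> i) = i}"
    by (rule color_coding[of "pverts G"]) (use emb(2) inV neR finF0 in auto)
  then obtain \<kappa> where \<kappa>: "card F0 \<le> ?h ^ ?h * card {\<phi> \<in> F0. \<forall>i\<in>?R. \<kappa> (\<phi> i) = i}" by (elim exE)
  define F1 where "F1 = {\<phi> \<in> F0. \<forall>i\<in>?R. \<kappa> (\<phi> i) = i}"
  have F1: "F1 \<subseteq> F0" "finite F1" using finF0 by (auto simp: F1_def)
  \<comment> \<open>Nothing is eliminated yet: there are no hyperedges, and the branch sets are a
    dummy.\<close>
  have st: "elim_state (parcs G) ?A \<kappa> F1 ?R {} (\<lambda>_. {})"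
    unfolding elim_state_def
  proof (intro conjI)
    show "\<forall>S. S \<subset> ?R \<and> S \<noteq> {} \<longrightarrow> (\<exists>i\<in>S. \<exists>j\<in>?R - S. linked ?A {} i j)"
      using connected_graph_cut[OF H(1,2)] by (simp add: linked_def)
    show "\<forall>\<phi>\<in>F1. \<forall>i\<in>?R. \<forall>j\<in>?R. (i, j) \<in> ?A \<longrightarrow> (\<phi> i, \<phi> j) \<in> parcs G" using emb(3) F1(1) by blast
  qed (auto simp: F1_def)
  have one_le_64: "(1::nat) \<le> 64" by simp
  obtain p r dep F2 where tree: "rooted_tree ?R p r dep" and F2: "F2 \<subseteq> F1" "card F1 \<le> step_const 64 ?h ^ ?h * card F2"
    and cmp: "\<forall>i\<in>?R. \<forall>j\<in>?R. linked ?A {} i j \<longrightarrow> anc p i j \<or> anc p j i"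
    and down: "\<forall>k\<in>?R - {r}. \<exists>j\<in>?R. anc p j k \<and> linked ?A {} j (p k)"
    and det: "\<forall>\<phi>\<in>F2. \<forall>\<psi>\<in>F2. \<forall>k\<in>?R. \<phi> k = \<psi> k \<longrightarrow> \<phi> (p k) = \<psi> (p k)"
    using role_tree[OF ms symG irrG one_le_64 symH H.pair_finite_verts neR order_refl F1(2) st]
    by (elim exE conjE) (rule that)
  have F20: "F2 \<subseteq> F0" "finite F2" using F1 F2(1) finite_subset by blast+
  have "card F0 \<le> ?h ^ ?h * card F1" using \<kappa> by (simp add: F1_def)
  also have "\<dots> \<le> ?h ^ ?h * (step_const 64 ?h ^ ?h * card F2)" using F2(2) by (intro mult_left_mono) auto
  finally have "card F0 \<le> copy_ratio ?h * card F2" by (simp add: copy_ratio_def mult.assoc)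
  then have "real (card F0) \<le> real (copy_ratio ?h) * real (card F2)" by (metis of_nat_le_iff of_nat_mult)
  then have "real (card F0) * real (card ?A) \<le> real (copy_ratio ?h) * real (card F2) * real (card ?A)"
    by (intro mult_right_mono) auto
  then have "\<epsilon> * ?n \<le> real (card F2) * (real (card ?A) * real (copy_ratio ?h))"
    using F0(3) by (simp add: mult_ac)
  then have big: "?\<gamma> * ?n \<le> real (card F2)" using cA cr by (simp add: copy_density_def divide_le_eq)
  let ?wt = "\<lambda>x. real (card (parcs G `` {x}))"
  obtain F3 where F3: "F3 \<subseteq> F2" "\<forall>\<phi>\<in>F3. \<forall>i\<in>?R. ?\<alpha> * ?wt (\<phi> i) \<le> real (card {\<psi> \<in> F3. \<psi> i = \<phi> i})"
    "real (card F2) - ?\<alpha> * (real ?h * (\<Sum>x\<in>pverts G. ?wt x)) \<le> real (card F3)"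
    using prune_sparse_fibers[OF F20(2) H.pair_finite_verts G.pair_finite_verts, of ?wt ?\<alpha>] inV F20(1) \<alpha>(1)
    by (auto simp: subset_iff)
  have F30: "F3 \<subseteq> F0" "F3 \<subseteq> F1" "finite F3" using F3(1) F2(1) F20 finite_subset by blast+
  have "(\<Sum>x\<in>pverts G. card (parcs G `` {x})) = card (SIGMA x:pverts G. parcs G `` {x})" by simp
  also have "(SIGMA x:pverts G. parcs G `` {x}) = parcs G \<inter> pverts G \<times> pverts G" using G.in_arcsD1 G.in_arcsD2 by auto
  also have "card \<dots> \<le> 64 * card (pverts G)" by (rule minor_sparse_edges[OF ms _ irrG]) simp
  finally have deg: "(\<Sum>x\<in>pverts G. ?wt x) \<le> 64 * ?n" by (simp flip: of_nat_sum)
  have "?\<alpha> * (real ?h * (\<Sum>x\<in>pverts G. ?wt x)) \<le> ?\<gamma> / (128 * real ?h) * (real ?h * (64 * ?n))"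
  proof (rule mult_mono)
    show "?\<alpha> \<le> ?\<gamma> / (128 * real ?h)" by (simp add: hit_rate_def)
    show "0 \<le> real ?h * (\<Sum>x\<in>pverts G. ?wt x)" by (intro mult_nonneg_nonneg sum_nonneg) auto
  qed (use \<gamma> deg in \<open>auto intro: mult_left_mono\<close>)
  also have "\<dots> = ?\<gamma> / 2 * ?n" using neR by (simp add: field_simps)
  finally have size: "?\<gamma> / 2 * ?n \<le> real (card F3)" using F3(3) big by linarith
  have "copy_forest G ?A ?R F3 p r dep ?\<alpha> ?h"
  proof
    show "finite F3" "finite ?R" "card ?R \<le> ?h" using F30(3) by auto
    show "anc p i j \<or> anc p j i" if "(i, j) \<in> ?A" for i j using cmp that AR by (auto simp: linked_def)
    show "\<exists>j\<in>?R. anc p j k \<and> (j, p k) \<in> ?A" if "k \<in> ?R" "k \<noteq> r" for k using down that by (auto simp: linked_def)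
    show "(\<phi> i, \<phi> j) \<in> parcs G" if "\<phi> \<in> F3" "(i, j) \<in> ?A" for \<phi> i j using emb(3) that F30(1) by blast
    show "\<phi> (p k) = \<psi> (p k)" if "\<phi> \<in> F3" "\<psi> \<in> F3" "k \<in> ?R" "\<phi> k = \<psi> k" for \<phi> \<psi> k
      using det that F3(1) by blast
    show "?\<alpha> * ?wt (\<phi> i) \<le> real (card {\<psi> \<in> F3. \<psi> i = \<phi> i})" if "\<phi> \<in> F3" "i \<in> ?R" for \<phi> i
      using F3(2) that by blast
    show "\<phi> = \<psi>" if "\<phi> \<in> F3" "\<psi> \<in> F3" "(i, j) \<in> ?A" "\<phi> i = \<psi> i" "\<phi> j = \<psi> j" for \<phi> \<psi> i j
      by (rule embedding_disjoint[OF _ that(3-5)]) (use F0(2) that(1,2) F30(1) in blast)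
  qed (use G(1) tree AR symH \<alpha> in auto)
  moreover have "\<forall>\<phi>\<in>F3. \<phi> \<in> embeddings H G" using F30(1) F0(1) by blast
  moreover have "\<forall>\<phi>\<in>F3. \<forall>i\<in>?R. \<kappa> (\<phi> i) = i" using F30(2) by (auto simp: F1_def)
  ultimately show ?thesis using size by blast
qed

text \<open>The summand 2 makes \<open>d \<ge> 2\<close>, as the geometric bound on the queries
  requires.\<close>

definition query_budget :: "nat \<Rightarrow> nat" where
  "query_budget h = h * budget h h + budget h h + 2"

definition walk_success :: "real \<Rightarrow> nat \<Rightarrow> real" where
  "walk_success \<alpha> h = success \<alpha> h h ^ h * success \<alpha> h h"

lemma RLBD_found_ge:
  fixes H :: "'h pair_pre_digraph"
  assumes V: "finite (pverts G)" "pverts G \<noteq> {}" and X: "X \<subseteq> pverts G" "real (card X) \<ge> \<gamma> * real (card (pverts G))"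
    and tr: "\<And>v. v \<in> X \<Longrightarrow> measure_pmf.prob (traverse G v d l) {(S, q). contains_copy H S} \<ge> \<delta>" and "\<delta> \<ge> 0"
  shows "measure_pmf.prob (RLBD G H d l) {(found, q). found} \<ge> \<gamma> * \<delta>"
  unfolding RLBD_def
proof (rule prob_bind_ge[where A = X])
  have "measure_pmf.prob (pmf_of_set (pverts G)) X = real (card X) / real (card (pverts G))"
    using X(1) by (simp add: measure_pmf_of_set[OF V(2,1)] Int_absorb1)
  then show "\<gamma> \<le> measure_pmf.prob (pmf_of_set (pverts G)) X"
    using X(2) V by (simp add: le_divide_eq card_gt_0_iff)
  fix v assume "v \<in> X"
  have eq: "(\<lambda>(S, q). (contains_copy H S, q)) -` {(found, q). found} = {(S, q). contains_copy H S}" by auto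
  show "\<delta> \<le> measure_pmf.prob (map_pmf (\<lambda>(S, q). (contains_copy H S, q)) (traverse G v d l)) {(found, q). found}"
    unfolding measure_map_pmf eq by (rule tr[OF \<open>v \<in> X\<close>])
qed fact

lemma RLBD_finds_copy:
  fixes G :: "'a pair_pre_digraph" and H :: "'h pair_pre_digraph"
  assumes H: "pair_graph H" "Digraph_Component.connected (with_proj H)" "parcs H \<noteq> {}"
    and G: "pair_graph G" "planar G" "far_from_free \<epsilon> H G" and \<epsilon>: "\<epsilon> > 0" and neV: "pverts G \<noteq> {}"
    and d: "d = query_budget (card (pverts H))"
  shows "measure_pmf.prob (RLBD G H d d) {(found, q). found} \<ge>
    copy_density \<epsilon> H / 2 * walk_success (hit_rate \<epsilon> H) (card (pverts H))"
proof -
  interpret H: pair_graph H by fact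
  interpret G: pair_graph G by fact
  let ?R = "pverts H" and ?A = "parcs H"
  obtain F p r dep \<kappa> where cf: "copy_forest G ?A ?R F p r dep (hit_rate \<epsilon> H) (card ?R)"
    and emb: "\<forall>\<phi>\<in>F. \<phi> \<in> embeddings H G" and \<kappa>: "\<forall>\<phi>\<in>F. \<forall>i\<in>?R. \<kappa> (\<phi> i) = i"
    and size: "real (card F) \<ge> copy_density \<epsilon> H / 2 * real (card (pverts G))"
    using copy_forest_exists[OF H G \<epsilon>] by (elim exE conjE)
  interpret copy_forest G ?A ?R F p r dep "hit_rate \<epsilon> H" "card ?R" by (rule cf)
  obtain a b where ab: "(a, b) \<in> ?A" using H(3) by auto
  \<comment> \<open>Starting vertices are images of the lower end \<open>i\<close> of an edge of
    \<open>H\<close>. Such an image determines that of \<open>j\<close>, hence an edge, hence the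
    copy; so there are as many good starting vertices as copies.\<close>
  have "\<exists>i j. (i, j) \<in> ?A \<and> anc p i j" using comparable[OF ab] ab symD[OF symA ab] by blast
  then obtain i j where ij: "(i, j) \<in> ?A" "anc p i j" by blast
  have iR: "i \<in> ?R" using ij(1) AR by blast
  let ?X = "(\<lambda>\<phi>. \<phi> i) ` F"
  have "inj_on (\<lambda>\<phi>. \<phi> i) F"
  proof (rule inj_onI)
    fix \<phi> \<psi> assume a: "\<phi> \<in> F" "\<psi> \<in> F" "\<phi> i = \<psi> i"
    then have "\<phi> j = \<psi> j" using det_anc iR ij(2) by blast
    then show "\<phi> = \<psi>" using disjoint a ij(1) by blast
  qed
  then have cX: "card ?X = card F" by (rule card_image)
  have \<delta>: "0 < walk_success (hit_rate \<epsilon> H) (card ?R)" using success_bounds[OF \<alpha>] by (simp add: walk_success_def)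
  show ?thesis
  proof (rule RLBD_found_ge[OF G.pair_finite_verts neV, where X = ?X])
    show "?X \<subseteq> pverts G" using emb iR by (auto simp: embeddings_def)
    show "copy_density \<epsilon> H / 2 * real (card (pverts G)) \<le> real (card ?X)" using size cX by simp
    fix v assume "v \<in> ?X"
    then obtain \<phi> where \<phi>: "\<phi> \<in> F" "v = \<phi> i" by blast
    have up: "upclosed (\<lambda>E Y. \<exists>y. found r y E)" using found_mono unfolding upclosed_def by blast
    have "finds G d (walk_success (hit_rate \<epsilon> H) (card ?R)) v (\<lambda>E Y. \<exists>y. found r y E)"
      using finds_more[OF finds_root[OF iR \<phi>(1)] up, of d] \<phi>(2) by (simp add: d query_budget_def walk_success_def)
    then have "walk_success (hit_rate \<epsilon> H) (card ?R) \<le>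
        measure_pmf.prob (replicate_pmf d (answer_table G)) {bs. \<exists>y. found r y (explored v bs)}"
      by (simp add: finds_def)
    also have "\<dots> \<le> measure_pmf.prob (traverse G v d d) {(S, q). contains_copy H S}"
    proof (rule traverse_prob_ge[OF G(1), where P = "\<lambda>E Y. \<exists>y. found r y E"])
      have "(\<phi> i, \<phi> j) \<in> parcs G" using edges[OF \<phi>(1) ij(1)] .
      then show "v \<in> pverts G" using \<phi>(2) G.in_arcsD1 by simp
      fix bs :: "('a \<Rightarrow> 'a option) list" and W E
      assume "\<exists>y. found r y (explored v bs)" and E: "explored v bs \<subseteq> E" "E \<subseteq> W \<times> W"
      then obtain y where "found r y (explored v bs)" by (elim exE)
      from found_root_copy[OF this] obtain \<psi> where \<psi>: "(\<forall>i\<in>?R. \<exists>\<phi>\<in>F. \<psi> i = \<phi> i) \<and>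
          (\<forall>i j. (i, j) \<in> ?A \<longrightarrow> (\<psi> i, \<psi> j) \<in> explored v bs \<union> (explored v bs)\<inverse>)" by (elim exE)
      let ?K = "\<lparr>pverts = W, parcs = E \<union> E\<inverse>\<rparr>"
      have arcs: "(\<psi> i, \<psi> j) \<in> E \<union> E\<inverse>" if "(i, j) \<in> ?A" for i j
      proof -
        have "(\<psi> i, \<psi> j) \<in> explored v bs \<union> (explored v bs)\<inverse>" using \<psi> that by simp
        then show ?thesis using E(1) by auto
      qed
      have col: "\<kappa> (\<psi> k) = k" if k: "k \<in> ?R" for k
      proof -
        obtain \<theta> where "\<theta> \<in> F" "\<psi> k = \<theta> k" using \<psi> k by auto
        then show ?thesis using \<kappa> k by simp
      qed
      have nb: "\<exists>l. (k, l) \<in> ?A" if k: "k \<in> ?R" for k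
      proof -
        have "a \<noteq> b" "a \<in> ?R" "b \<in> ?R" using H.pair_no_loops[OF ab] ab AR by auto
        then have "?R \<noteq> {k}" by (metis singletonD)
        then have "{k} \<subset> ?R" using k by blast
        then show ?thesis using connected_graph_cut[OF H(1,2), of "{k}"] by blast
      qed
      show "contains_copy H ?K"
      proof (rule contains_copyI[OF H(1), where \<psi> = \<psi>])
        show "pair_wf_digraph ?K" using E(2) by unfold_locales auto
        \<comment> \<open>Images of different vertices of \<open>H\<close> carry different colours,
          even when they stem from different copies.\<close>
        show "inj_on \<psi> ?R" using col by (metis inj_onI)
        show "\<psi> ` ?R \<subseteq> pverts ?K"
        proof
          fix x assume "x \<in> \<psi> ` ?R"
          then obtain k l where "x = \<psi> k" "(k, l) \<in> ?A" using nb by blast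
          then show "x \<in> pverts ?K" using arcs[of k l] E(2) by auto
        qed
      qed (use arcs in simp)
    qed simp
    finally show "walk_success (hit_rate \<epsilon> H) (card ?R) \<le> measure_pmf.prob (traverse G v d d) {(S, q). contains_copy H S}" .
  qed (use \<delta> in simp)
qed

lemma RLBD_finds_vertex:
  fixes G :: "'a pair_pre_digraph" and H :: "'h pair_pre_digraph"
  assumes H: "pair_graph H" "pverts H = {a}" "parcs H = {}" and G: "pair_graph G" "pverts G \<noteq> {}" and "d \<le> l"
  shows "measure_pmf.prob (RLBD G H d l) {(found, q). found} \<ge> 1"
proof -
  interpret G: pair_graph G by fact
  have "1 * 1 \<le> measure_pmf.prob (RLBD G H d l) {(found, q). found}"
  proof (rule RLBD_found_ge[OF G.pair_finite_verts G(2), where X = "pverts G"])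
    fix v assume v: "v \<in> pverts G"
    have "1 = measure_pmf.prob (replicate_pmf d (answer_table G)) {bs. True}" by simp
    also have "\<dots> \<le> measure_pmf.prob (traverse G v d l) {(S, q). contains_copy H S}"
    proof (rule traverse_prob_ge[OF G(1) v \<open>d \<le> l\<close>, where P = "\<lambda>E Y. True"])
      fix bs :: "('a \<Rightarrow> 'a option) list" and W E
      assume "reached v bs \<subseteq> W" "E \<subseteq> W \<times> W"
      moreover have "v \<in> reached v bs" by (rule reached_self)
      ultimately show "contains_copy H \<lparr>pverts = W, parcs = E \<union> E\<inverse>\<rparr>"
        by (intro contains_copyI[OF H(1), where \<psi> = "\<lambda>_. v"]) (use H(2,3) in \<open>auto intro!: pair_wf_digraph.intro\<close>)
    qed
    finally show "1 \<le> measure_pmf.prob (traverse G v d l) {(S, q). contains_copy H S}" .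
  qed auto
  then show ?thesis by simp
qed

lemma RLBD_queries_le:
  assumes "pair_graph G" "pverts G \<noteq> {}" "d \<ge> 2" "(found, q) \<in> set_pmf (RLBD G H d l)"
  shows "q \<le> 2 * d ^ l"
proof -
  interpret G: pair_graph G by fact
  obtain v W L E where v: "v \<in> pverts G" "(W, L, E, q) \<in> set_pmf (traverse_state G v d l)"
    using assms(2,4) unfolding RLBD_def traverse_def by (auto simp: set_pmf_of_set)
  from traverse_queries[OF assms(1) v(1) assms(3) v(2)] show ?thesis by simp
qed

theorem theorem3p2:
  shows "\<exists>C::real. C > 0 \<and>
    (\<forall>H :: nat pair_pre_digraph. pair_graph H \<and> Digraph_Component.connected (with_proj H) \<longrightarrow>
      (\<forall>\<epsilon>::real. \<epsilon> > 0 \<longrightarrow>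
        (\<exists>(d::nat) (l::nat) (\<delta>::real). d > 0 \<and> l > 0 \<and> \<delta> > 0 \<and>
          (\<forall>(n::nat) (G :: nat pair_pre_digraph).
            n \<ge> 1 \<and> pair_graph G \<and> pverts G = {1..n} \<and> planar G \<and> far_from_free \<epsilon> H G \<longrightarrow>
            measure_pmf.prob (RLBD G H d l) {(found, q). found} \<ge> \<delta>) \<and>
          (\<forall>(n::nat) (G :: nat pair_pre_digraph).
            n \<ge> 1 \<and> pair_graph G \<and> pverts G = {1..n} \<longrightarrow>
            (\<forall>(found, q) \<in> set_pmf (RLBD G H d l). real q \<le> C * real d ^ l)))))"
proof (intro exI[of _ "2::real"] conjI allI impI)
  fix H :: "nat pair_pre_digraph" and \<epsilon> :: real
  assume H: "pair_graph H \<and> Digraph_Component.connected (with_proj H)" and \<epsilon>: "\<epsilon> > 0"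
  then interpret H: pair_graph H by blast
  define d where "d = query_budget (card (pverts H))"
  have d: "d \<ge> 2" by (simp add: d_def query_budget_def)
  have "\<exists>\<delta>>0. \<forall>(n::nat) (G :: nat pair_pre_digraph). n \<ge> 1 \<and> pair_graph G \<and> pverts G = {1..n} \<and> planar G \<and> far_from_free \<epsilon> H G \<longrightarrow>
            measure_pmf.prob (RLBD G H d d) {(found, q). found} \<ge> \<delta>"
  proof (cases "parcs H = {}")
    \<comment> \<open>Without edges a connected \<open>H\<close> is a single vertex. Packings by
      edges say nothing here, but the start vertex is already a copy.\<close>
    case True
    have "pverts H \<noteq> {}" using H by (simp add: connected_conv)
    then obtain a where a: "a \<in> pverts H" by blast
    have "pverts H = {a}"
    proof (rule ccontr)
      assume "pverts H \<noteq> {a}"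
      then have "{a} \<subset> pverts H" using a by blast
      then show False using connected_graph_cut[of H "{a}"] H True by blast
    qed
    then have always: "measure_pmf.prob (RLBD G H d d) {(found, q). found} \<ge> 1"
      if "n \<ge> 1" "pair_graph G" "pverts G = {1..n}" for n and G :: "nat pair_pre_digraph"
      using RLBD_finds_vertex[of H a G d d] H True that by simp
    show ?thesis by (intro exI[of _ "1::real"] conjI allI impI) (simp, elim conjE, rule always)
  next
    case False
    let ?\<delta> = "copy_density \<epsilon> H / 2 * walk_success (hit_rate \<epsilon> H) (card (pverts H))"
    have cA: "card (parcs H) > 0" using False by (simp add: card_gt_0_iff)
    have "pverts H \<noteq> {}" using False H.in_arcsD1 by auto
    then have h: "card (pverts H) \<ge> 1" by (simp add: Suc_le_eq card_gt_0_iff)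
    then have "copy_ratio (card (pverts H)) > 0" using step_const_pos[of 64 "card (pverts H)"] by (simp add: copy_ratio_def)
    then have \<gamma>: "copy_density \<epsilon> H > 0" using \<epsilon> cA by (simp add: copy_density_def)
    then have "0 < hit_rate \<epsilon> H" "hit_rate \<epsilon> H \<le> 1" using h by (auto simp: hit_rate_def)
    from success_bounds[OF this] have "0 < walk_success (hit_rate \<epsilon> H) (card (pverts H))"
      by (simp add: walk_success_def)
    then have pos: "0 < ?\<delta>" using \<gamma> by simp
    have often: "measure_pmf.prob (RLBD G H d d) {(found, q). found} \<ge> ?\<delta>"
      if "n \<ge> 1" "pair_graph G" "pverts G = {1..n}" "planar G" "far_from_free \<epsilon> H G" for n and G :: "nat pair_pre_digraph"
      by (rule RLBD_finds_copy) (use H False that \<epsilon> d_def in auto)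
    show ?thesis by (intro exI[of _ ?\<delta>] conjI allI impI) (rule pos, elim conjE, rule often)
  qed
  then obtain \<delta> where \<delta>: "\<delta> > 0" "\<forall>(n::nat) (G :: nat pair_pre_digraph). n \<ge> 1 \<and> pair_graph G \<and> pverts G = {1..n} \<and> planar G \<and> far_from_free \<epsilon> H G \<longrightarrow>
            measure_pmf.prob (RLBD G H d d) {(found, q). found} \<ge> \<delta>" by blast
  show "\<exists>(d::nat) (l::nat) (\<delta>::real). d > 0 \<and> l > 0 \<and> \<delta> > 0 \<and>
          (\<forall>(n::nat) (G :: nat pair_pre_digraph).
            n \<ge> 1 \<and> pair_graph G \<and> pverts G = {1..n} \<and> planar G \<and> far_from_free \<epsilon> H G \<longrightarrow>
            measure_pmf.prob (RLBD G H d l) {(found, q). found} \<ge> \<delta>) \<and>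
          (\<forall>(n::nat) (G :: nat pair_pre_digraph).
            n \<ge> 1 \<and> pair_graph G \<and> pverts G = {1..n} \<longrightarrow>
            (\<forall>(found, q) \<in> set_pmf (RLBD G H d l). real q \<le> 2 * real d ^ l))"
  \<comment> \<open>The same number serves as \<open>d\<close> and \<open>l\<close>, since the table
    budget bounds both the queries per vertex and the depth.\<close>
  proof (intro exI[of _ d] exI[of _ \<delta>] conjI)
    show "\<forall>(n::nat) (G :: nat pair_pre_digraph). n \<ge> 1 \<and> pair_graph G \<and> pverts G = {1..n} \<longrightarrow>
            (\<forall>(found, q) \<in> set_pmf (RLBD G H d d). real q \<le> 2 * real d ^ d)"
    proof (intro allI impI, clarify)
      fix n :: nat and G :: "nat pair_pre_digraph" and fd q
      assume "n \<ge> 1" "pair_graph G" "pverts G = {1..n}" "(fd, q) \<in> set_pmf (RLBD G H d d)"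
      then have "q \<le> 2 * d ^ d" using RLBD_queries_le[of G d fd q H d] d by auto
      then have "real q \<le> real (2 * d ^ d)" by (simp only: of_nat_le_iff)
      then show "real q \<le> 2 * real d ^ d" by simp
    qed
  qed (use d \<delta> in auto)
qed simp

end
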